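(* Let $\alpha\in\mathbb{R}$ and let the convolution quadrature $\kappa$ (with weights $\kappa_j=e^{-j\sigma h}\omega_j$) be convergent of order $p$, i.e. $$(E_{s,h}^\alpha[e^{-\sigma t}t^{\beta'-1}])(1)=\mathcal{O}(h^{\beta'})+\mathcal{O}(h^p)\quad\text{for all }\beta'\in\mathbb{C},\ \beta'\neq0,-1,-2,\dots .$$ Let $f(x)=x^{\beta-1}g(x)$, where $\beta\neq0,-1,-2,\dots$ if $\alpha\ge0$ and $\beta>\lceil-\alpha\rceil$ if $\alpha<0$, and where $g$ is sufficiently differentiable. Then there exists a starting quadrature $\kappa_{n,j}$ such that the approximation $$I_{s,h}^\alpha f(x)=h^\alpha\sum_{j=0}^n\kappa_{n-j}f(jh)+h^\alpha\sum_{j=1}^r\kappa_{n,j}f(jh)\qquad(x=nh)$$ satisfies $$I_{s,h}^\alpha f(x)-I_s^\alpha f(x)=\mathcal{O}(h^p).$$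
   Context: $\sigma$ is a constant. For $\alpha>0$, $I_s^\alpha f(x)=\frac{1}{\Gamma(\alpha)}\int_0^x(x-\tau)^{\alpha-1}e^{-\sigma(x-\tau)}f(\tau)\,d\tau$; $I_s^0f=f$; for $\alpha<0$, $I_s^\alpha f=D_s^{-\alpha}f$, where for $\mu>0$, $D_s^\mu f=D_s^m[I_s^{m-\mu}f]$ with $m$ the smallest integer exceeding $\mu$ and $D_s=\frac{d}{dx}+\sigma$. On powers, $I_s^\alpha[e^{-\sigma t}t^{\beta-1}](x)=e^{-\sigma x}\frac{\Gamma(\beta)}{\Gamma(\alpha+\beta)}x^{\alpha+\beta-1}$ for $\beta\ne0,-1,-2,\dots$. Let $\omega=(\omega_n)_0^\infty$ be a sequence (convolution quadrature weights for the case $\sigma=0$) with generating power series $\omega(\zeta)=\sum_{n\ge0}\omega_n\zeta^n$; its generating function is of the form $\omega(\zeta)=(1-\zeta)^{-\alpha}\widetilde\omega(\zeta)$, with $\widetilde\omega(\zeta)=c_0+c_1(1-\zeta)+\dots+c_{N-1}(1-\zeta)^{N-1}+(1-\zeta)^N\widetilde r(\zeta)$ the Taylor expansion of $\widetilde\omega$ at $\zeta=1$. For a step size $h>0$ and grid points $x=nh$, put $\kappa_j=e^{-j\sigma h}\omega_j$ (convolution quadrature weights). The $\kappa_{n,j}$, $j=1,\dots,r$ (with $r$ fixed), are called starting quadrature weights. Put $\Omega_{s,h}^\alpha f(x)=h^\alpha\sum_{j=0}^n\kappa_{n-j}f(jh)$ for $x=nh$ and $E_{s,h}^\alpha=\Omega_{s,h}^\alpha-I_s^\alpha$;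 the $j=0$ term of the sums is dropped when the function is undefined at $0$. All $\mathcal{O}$-terms are for $h\to0$. *)

theory Defs
  imports "HOL-Analysis.Analysis" "HOL-Library.Landau_Symbols"
begin

text \<open>
  On powers with real part of \<open>\<beta>\<close> at most 0 the integral defining the fractional integral diverges
  at 0, and the rule
  \<open>I\<^sup>\<alpha> [exp (-\<sigma> t) t^(\<beta>-1)] (x) = exp (-\<sigma> x) \<Gamma>(\<beta>) / \<Gamma>(\<alpha>+\<beta>) x^(\<alpha>+\<beta>-1)\<close>
  is the one of Hadamard's finite part: a finite combination of powers of \<open>\<epsilon>\<close> with non-zero exponents
  is split off from the integral over \<open>{\<epsilon>..x}\<close> before \<open>\<epsilon>\<close> tends to 0. The value is unique, and it is
  the ordinary integral whenever that exists (\<open>has_fp_integral_unique\<close>, \<open>fp_integral_eq_integral\<close>).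
\<close>

definition has_fp_integral :: "(real \<Rightarrow> complex) \<Rightarrow> complex \<Rightarrow> real \<Rightarrow> bool"
  where "has_fp_integral \<phi> L x \<longleftrightarrow>
    (\<forall>\<epsilon>\<in>{0<..<x}. \<phi> integrable_on {\<epsilon>..x}) \<and>
    (\<exists>\<Lambda> c. finite \<Lambda> \<and> 0 \<notin> \<Lambda> \<and>
      ((\<lambda>\<epsilon>. integral {\<epsilon>..x} \<phi> - (\<Sum>\<nu>\<in>\<Lambda>. c \<nu> * of_real \<epsilon> powr \<nu>)) \<longlongrightarrow> L) (at_right 0))"

definition fp_integral :: "(real \<Rightarrow> complex) \<Rightarrow> real \<Rightarrow> complex"
  where "fp_integral \<phi> x = (THE L. has_fp_integral \<phi> L x)"

definition subst_kernel :: "complex \<Rightarrow> real \<Rightarrow> (real \<Rightarrow> complex) \<Rightarrow> real \<Rightarrow> real \<Rightarrow> complex"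
  where "subst_kernel \<sigma> \<alpha> f x \<tau> =
    of_real ((x - \<tau>) powr (\<alpha> - 1)) * exp (- \<sigma> * of_real (x - \<tau>)) * f \<tau>"

text \<open>The case \<open>\<alpha> > 0\<close>:\<close>

definition subst_int_pos :: "complex \<Rightarrow> real \<Rightarrow> (real \<Rightarrow> complex) \<Rightarrow> real \<Rightarrow> complex"
  where "subst_int_pos \<sigma> \<alpha> f x = fp_integral (subst_kernel \<sigma> \<alpha> f x) x / of_real (Gamma \<alpha>)"

definition subst_D :: "complex \<Rightarrow> (real \<Rightarrow> complex) \<Rightarrow> real \<Rightarrow> complex"
  where "subst_D \<sigma> F x = vector_derivative F (at x) + \<sigma> * F x"

definition subst_deriv :: "complex \<Rightarrow> real \<Rightarrow> (real \<Rightarrow> complex) \<Rightarrow> real \<Rightarrow> complex"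
  where "subst_deriv \<sigma> \<mu> f =
    (let m = nat (\<lfloor>\<mu>\<rfloor> + 1) in (subst_D \<sigma> ^^ m) (subst_int_pos \<sigma> (real m - \<mu>) f))"

definition subst_int :: "complex \<Rightarrow> real \<Rightarrow> (real \<Rightarrow> complex) \<Rightarrow> real \<Rightarrow> complex"
  where "subst_int \<sigma> \<alpha> f =
    (if \<alpha> > 0 then subst_int_pos \<sigma> \<alpha> f else if \<alpha> = 0 then f else subst_deriv \<sigma> (- \<alpha>) f)"

definition cq_weight :: "complex \<Rightarrow> (nat \<Rightarrow> complex) \<Rightarrow> real \<Rightarrow> nat \<Rightarrow> complex"
  where "cq_weight \<sigma> \<omega> h j = exp (- of_nat j * \<sigma> * of_real h) * \<omega> j"

text \<open>The quadrature at \<open>x = n h\<close>. A function that is undefined at 0 is given the value 0 there,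
  which drops the term \<open>j = 0\<close>.\<close>

definition conv_quad ::
    "complex \<Rightarrow> (nat \<Rightarrow> complex) \<Rightarrow> real \<Rightarrow> real \<Rightarrow> (real \<Rightarrow> complex) \<Rightarrow> nat \<Rightarrow> complex"
  where "conv_quad \<sigma> \<omega> \<alpha> h f n =
    of_real (h powr \<alpha>) * (\<Sum>j=0..n. cq_weight \<sigma> \<omega> h (n - j) * f (real j * h))"

definition quad_error ::
    "complex \<Rightarrow> (nat \<Rightarrow> complex) \<Rightarrow> real \<Rightarrow> real \<Rightarrow> (real \<Rightarrow> complex) \<Rightarrow> nat \<Rightarrow> complex"
  where "quad_error \<sigma> \<omega> \<alpha> h f n = conv_quad \<sigma> \<omega> \<alpha> h f n - subst_int \<sigma> \<alpha> f (real n * h)"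

text \<open>The function \<open>t^(\<beta>-1)\<close>. At 0 it is 1 for \<open>\<beta> = 1\<close>, it is 0 if the real part of \<open>\<beta>\<close> exceeds 1,
  and it is undefined (hence 0, see above) otherwise.\<close>

definition pow_fun :: "complex \<Rightarrow> real \<Rightarrow> complex"
  where "pow_fun \<beta> t = (if t = 0 then if \<beta> = 1 then 1 else 0 else of_real t powr (\<beta> - 1))"

text \<open>The error at \<open>x = 1\<close> is taken over the step sizes \<open>h = 1/n\<close>, for which 1 is a grid point.\<close>

definition cq_convergent :: "complex \<Rightarrow> (nat \<Rightarrow> complex) \<Rightarrow> real \<Rightarrow> real \<Rightarrow> bool"
  where "cq_convergent \<sigma> \<omega> \<alpha> p \<longleftrightarrow>
    (\<forall>\<beta>. \<beta> \<notin> \<int>\<^sub>\<le>\<^sub>0 \<longrightarrow>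
      (\<lambda>n. norm (quad_error \<sigma> \<omega> \<alpha> (1 / real n) (\<lambda>t. exp (- \<sigma> * of_real t) * pow_fun \<beta> t) n))
        \<in> O(\<lambda>n. (1 / real n) powr Re \<beta> + (1 / real n) powr p))"

definition corrected_quad ::
    "complex \<Rightarrow> (nat \<Rightarrow> complex) \<Rightarrow> real \<Rightarrow> nat \<Rightarrow> (nat \<Rightarrow> nat \<Rightarrow> complex) \<Rightarrow>
     real \<Rightarrow> (real \<Rightarrow> complex) \<Rightarrow> nat \<Rightarrow> complex"
  where "corrected_quad \<sigma> \<omega> \<alpha> r \<kappa> h f n =
    conv_quad \<sigma> \<omega> \<alpha> h f n + of_real (h powr \<alpha>) * (\<Sum>j=1..r. \<kappa> n j * f (real j * h))"

definition Ck_on :: "nat \<Rightarrow> (real \<Rightarrow> complex) \<Rightarrow> real set \<Rightarrow> bool"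
  where "Ck_on k g S \<longleftrightarrow>
    (\<exists>G. (\<forall>x\<in>S. G 0 x = g x) \<and> (\<forall>i\<le>k. continuous_on S (G i)) \<and>
      (\<forall>i<k. \<forall>x\<in>S. (G i has_vector_derivative G (Suc i) x) (at x within S)))"

lemma powers_tendsto_imp_zero:
  fixes c :: "complex \<Rightarrow> complex"
  assumes "finite \<Lambda>" "0 \<notin> \<Lambda>"
    and "((\<lambda>\<epsilon>. \<Sum>\<nu>\<in>\<Lambda>. c \<nu> * of_real \<epsilon> powr \<nu>) \<longlongrightarrow> L) (at_right (0::real))"
  shows "L = 0"
  using assms
proof (induction \<Lambda> arbitrary: c L rule: finite_induct)
  case empty
  then show ?case by (simp add: tendsto_const_iff)
next
  case (insert \<mu> \<Lambda>)
  define q where "q = exp (- (1 / norm \<mu>))"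
  have mu: "\<mu> \<noteq> 0" and q: "q > 0" using insert.prems by (auto simp: q_def)
  define Q where "Q = (of_real q :: complex) powr \<mu>"
  have Q: "Q \<noteq> 1"
  proof
    assume "Q = 1"
    then have "exp (- (\<mu> / of_real (norm \<mu>))) = 1"
      using q by (simp add: Q_def powr_def q_def Ln_of_real)
    then obtain n :: int where n: "Re (- (\<mu> / of_real (norm \<mu>))) = 0"
        "Im (- (\<mu> / of_real (norm \<mu>))) = of_int (2 * n) * pi"
      unfolding exp_eq_1 by blast
    have "norm (- (\<mu> / of_real (norm \<mu>))) = 1" using mu by (simp add: norm_divide)
    then have e: "\<bar>of_int (2 * n) * pi\<bar> = 1"
      unfolding cmod_eq_Im[OF n(1)] n(2) .
    show False
    proof (cases "n = 0")
      case False
      then have "\<bar>real_of_int n\<bar> \<ge> 1" by linarith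
      then have "\<bar>real_of_int n\<bar> * (2 * pi) \<ge> 1 * (2 * pi)" by (intro mult_right_mono) auto
      moreover have "\<bar>real_of_int n\<bar> * (2 * pi) = 1" using e by (simp add: abs_mult algebra_simps)
      ultimately show False using pi_gt3 by linarith
    qed (use e in simp)
  qed
  define S where "S = (\<lambda>\<epsilon>. \<Sum>\<nu>\<in>insert \<mu> \<Lambda>. c \<nu> * of_real \<epsilon> powr \<nu>)"
  have S: "(S \<longlongrightarrow> L) (at_right 0)" using insert.prems by (simp add: S_def)
  have "filterlim (\<lambda>\<epsilon>. q * \<epsilon>) (at_right 0) (at_right 0)"
    using q by (intro filterlim_times_pos[OF filterlim_ident]) auto
  from filterlim_compose[OF S this] have "((\<lambda>\<epsilon>. S (q * \<epsilon>) - Q * S \<epsilon>) \<longlongrightarrow> L - Q * L) (at_right 0)"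
    by (intro tendsto_intros S)
  moreover have "\<forall>\<^sub>F \<epsilon> in at_right 0. S (q * \<epsilon>) - Q * S \<epsilon> =
      (\<Sum>\<nu>\<in>\<Lambda>. (c \<nu> * (of_real q powr \<nu> - Q)) * of_real \<epsilon> powr \<nu>)"
    using eventually_at_right_less[of 0]
  proof eventually_elim
    case (elim \<epsilon>)
    have "of_real (q * \<epsilon>) powr \<nu> = of_real q powr \<nu> * of_real \<epsilon> powr \<nu>" for \<nu> :: complex
      using q elim by (simp add: powr_times_real)
    then have "S (q * \<epsilon>) - Q * S \<epsilon> =
      (\<Sum>\<nu>\<in>insert \<mu> \<Lambda>. (c \<nu> * (of_real q powr \<nu> - Q)) * of_real \<epsilon> powr \<nu>)"
      unfolding S_def sum_distrib_left sum_subtractf[symmetric]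
      by (intro sum.cong) (auto simp: algebra_simps)
    then show ?case using insert.hyps by (simp add: Q_def)
  qed
  ultimately have "((\<lambda>\<epsilon>. \<Sum>\<nu>\<in>\<Lambda>. (c \<nu> * (of_real q powr \<nu> - Q)) * of_real \<epsilon> powr \<nu>)
      \<longlongrightarrow> L - Q * L) (at_right 0)"
    by (rule Lim_transform_eventually)
  from insert.IH[OF _ this] insert.prems have "L - Q * L = 0" by simp
  then have "L * (1 - Q) = 0" by (simp add: algebra_simps)
  with Q show ?case by simp
qed

lemma has_fp_integral_unique:
  assumes "has_fp_integral \<phi> L x" "has_fp_integral \<phi> M x"
  shows "L = M"
proof -
  obtain \<Lambda> c where L: "finite \<Lambda>" "0 \<notin> \<Lambda>"
    "((\<lambda>\<epsilon>. integral {\<epsilon>..x} \<phi> - (\<Sum>\<nu>\<in>\<Lambda>. c \<nu> * of_real \<epsilon> powr \<nu>)) \<longlongrightarrow> L) (at_right 0)"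
    using assms(1) unfolding has_fp_integral_def by blast
  obtain \<Lambda>' d where M: "finite \<Lambda>'" "0 \<notin> \<Lambda>'"
    "((\<lambda>\<epsilon>. integral {\<epsilon>..x} \<phi> - (\<Sum>\<nu>\<in>\<Lambda>'. d \<nu> * of_real \<epsilon> powr \<nu>)) \<longlongrightarrow> M) (at_right 0)"
    using assms(2) unfolding has_fp_integral_def by blast
  define e where "e = (\<lambda>\<nu>. (if \<nu> \<in> \<Lambda>' then d \<nu> else 0) - (if \<nu> \<in> \<Lambda> then c \<nu> else 0))"
  have "(\<Sum>\<nu>\<in>\<Lambda> \<union> \<Lambda>'. e \<nu> * of_real \<epsilon> powr \<nu>) =
      (\<Sum>\<nu>\<in>\<Lambda>'. d \<nu> * of_real \<epsilon> powr \<nu>) - (\<Sum>\<nu>\<in>\<Lambda>. c \<nu> * of_real \<epsilon> powr \<nu>)" for \<epsilon> :: real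
  proof -
    have "(\<Sum>\<nu>\<in>\<Lambda> \<union> \<Lambda>'. e \<nu> * of_real \<epsilon> powr \<nu>) =
        (\<Sum>\<nu>\<in>\<Lambda> \<union> \<Lambda>'. if \<nu> \<in> \<Lambda>' then d \<nu> * of_real \<epsilon> powr \<nu> else 0) -
        (\<Sum>\<nu>\<in>\<Lambda> \<union> \<Lambda>'. if \<nu> \<in> \<Lambda> then c \<nu> * of_real \<epsilon> powr \<nu> else 0)"
      unfolding sum_subtractf[symmetric] by (intro sum.cong) (auto simp: e_def algebra_simps)
    also have "(\<Sum>\<nu>\<in>\<Lambda> \<union> \<Lambda>'. if \<nu> \<in> \<Lambda>' then d \<nu> * of_real \<epsilon> powr \<nu> else 0) =
        (\<Sum>\<nu>\<in>\<Lambda>'. d \<nu> * of_real \<epsilon> powr \<nu>)"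
      using L M by (intro sum.mono_neutral_cong_right) auto
    also have "(\<Sum>\<nu>\<in>\<Lambda> \<union> \<Lambda>'. if \<nu> \<in> \<Lambda> then c \<nu> * of_real \<epsilon> powr \<nu> else 0) =
        (\<Sum>\<nu>\<in>\<Lambda>. c \<nu> * of_real \<epsilon> powr \<nu>)"
      using L M by (intro sum.mono_neutral_cong_right) auto
    finally show ?thesis .
  qed
  then have "((\<lambda>\<epsilon>::real. \<Sum>\<nu>\<in>\<Lambda> \<union> \<Lambda>'. e \<nu> * of_real \<epsilon> powr \<nu>) \<longlongrightarrow> L - M) (at_right 0)"
    using tendsto_diff[OF L(3) M(3)] by simp
  from powers_tendsto_imp_zero[OF _ _ this] L M show ?thesis by simp
qed

lemma fp_integral_eqI: "has_fp_integral \<phi> L x \<Longrightarrow> fp_integral \<phi> x = L"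
  unfolding fp_integral_def using has_fp_integral_unique by blast

lemma has_fp_integral_integral:
  assumes "\<phi> integrable_on {0..x}" "x > 0"
  shows "has_fp_integral \<phi> (integral {0..x} \<phi>) x"
proof -
  have "continuous_on {0..x} (\<lambda>\<epsilon>. integral {\<epsilon>..x} \<phi>)"
    using assms by (intro indefinite_integral_continuous_1')
  then have "((\<lambda>\<epsilon>. integral {\<epsilon>..x} \<phi>) \<longlongrightarrow> integral {0..x} \<phi>) (at 0 within {0..x})"
    using assms(2) by (auto simp: continuous_on)
  then have "((\<lambda>\<epsilon>. integral {\<epsilon>..x} \<phi>) \<longlongrightarrow> integral {0..x} \<phi>) (at_right 0)"
    using assms(2) by (simp add: at_within_Icc_at_right)
  moreover have "\<phi> integrable_on {\<epsilon>..x}" if "\<epsilon> \<in> {0<..<x}" for \<epsilon>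
    using that by (intro integrable_on_subinterval[OF assms(1)]) auto
  ultimately show ?thesis
    unfolding has_fp_integral_def by (intro conjI exI[of _ "{}"]) auto
qed

corollary fp_integral_eq_integral:
  "\<phi> integrable_on {0..x} \<Longrightarrow> x > 0 \<Longrightarrow> fp_integral \<phi> x = integral {0..x} \<phi>"
  by (intro fp_integral_eqI has_fp_integral_integral)

end

theory Submission
  imports Defs
begin

text \<open>
  After multiplication by \<open>exp (\<sigma> x)\<close> one may take \<open>\<sigma> = 0\<close>. The quadrature error of a power is homogeneous, so
  convergence at \<open>x = 1\<close> gives the order \<open>O(h^\<beta>) + O(h^p)\<close> on every compact subset of the positive half-line. Choose the
  starting weights, by inverting the Vandermonde matrix of the nodes \<open>1, \<dots>, M\<close>, such that \<open>x^(\<beta>-1+k)\<close> is integrated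
  exactly for \<open>k < M\<close>. For large \<open>M\<close>, Taylor's formula leaves a remainder \<open>x^(\<beta>-1) R(x)\<close> that is an \<open>L\<close>-fold
  integral of a continuous function \<open>u\<close>, and its quadrature error is the convolution of \<open>u\<close> with the error for
  \<open>x^(L-1)\<close> at arbitrary, also off-grid, points. Binomial expansion around the nearest grid point and convergence
  at \<open>\<beta> = 1, \<dots>, L\<close> show that this kernel is \<open>O(h^p)\<close>. On the remainder the starting weights contribute
  \<open>O(h^p)\<close> as well, since they grow at most like \<open>h^(-M)\<close> times the errors they cancel.
\<close>

subsection \<open>Finite parts\<close>

text \<open>Convergence speaks about pure powers only, and the Taylor remainder is not one. As an
  \<open>L\<close>-fold integral it is a superposition of truncated powers (x - t)^(L-1), set to 0
  left of a kink t. The kink is in general not a grid point, so the error of a monomial is required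
  at points q + \<theta> with 0 \<le> \<theta> \<le> 1. Since L - 1 is a natural number, the
  quadrature sum is a polynomial in \<theta> whose coefficients are moments of the weights, known
  from the grid. The exact integral (q + \<theta>)^(\<alpha>+L-1) has an infinite expansion; cutting
  it after L terms leaves O(q^(\<alpha>-1)), a size that the grid error has anyway. A second
  obstacle is that the starting weights may blow up as h tends to 0. On the remainder they act only
  at the first M nodes, where R is O(h^M), and this order pays for the growth.\<close>

lemma of_real_powr_eq: "t > 0 \<Longrightarrow> of_real t powr (of_real a :: complex) = of_real (t powr a)"
  by (simp add: powr_of_real)

lemma has_vector_derivative_powr_complex:
  assumes "t > 0"
  shows "((\<lambda>t. of_real t powr (\<nu> :: complex)) has_vector_derivative \<nu> * of_real t powr (\<nu> - 1)) (at t within S)"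
proof -
  have "((\<lambda>z. z powr \<nu>) has_field_derivative \<nu> * of_real t powr (\<nu> - 1)) (at (of_real t))"
    using assms by (intro has_field_derivative_powr) (auto simp: complex_nonpos_Reals_iff)
  from has_vector_derivative_real_field[OF this] show ?thesis .
qed

lemma continuous_on_powr_complex:
  "\<forall>t\<in>S. t > 0 \<Longrightarrow> continuous_on S (\<lambda>t. of_real t powr (\<nu> :: complex))"
  by (auto simp: continuous_on_eq_continuous_within
      intro: has_vector_derivative_continuous[OF has_vector_derivative_powr_complex])

lemma norm_powr_complex: "t > 0 \<Longrightarrow> norm (of_real t powr (\<nu> :: complex)) = t powr Re \<nu>"
  by (simp add: norm_powr_real_powr)

lemma powr_complex_tendsto_0:
  assumes "Re \<nu> > 0"
  shows "((\<lambda>t. of_real t powr \<nu>) \<longlongrightarrow> 0) (at_right (0::real))"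
proof (rule tendsto_norm_zero_cancel)
  have "((\<lambda>t. t powr Re \<nu>) \<longlongrightarrow> 0 powr Re \<nu>) (at_right (0::real))"
    using assms eventually_at_right_less[of "0::real"]
    by (intro tendsto_powr2 tendsto_intros) (auto elim: eventually_mono)
  moreover have "\<forall>\<^sub>F t in at_right (0::real). t powr Re \<nu> = norm (of_real t powr \<nu> :: complex)"
    using eventually_at_right_less[of "0::real"] by eventually_elim (simp add: norm_powr_complex)
  ultimately show "((\<lambda>t. norm (of_real t powr \<nu>)) \<longlongrightarrow> 0) (at_right (0::real))"
    using assms by (simp add: Lim_transform_eventually)
qed

text \<open>The limit condition of \<open>has_fp_integral\<close>, detached from integrability, so
  that linearity and rescaling of the cutoff can be proved for arbitrary functions of
  \<epsilon>.\<close>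

definition fp_lim :: "(real \<Rightarrow> complex) \<Rightarrow> complex \<Rightarrow> bool"
  where "fp_lim \<Phi> L \<longleftrightarrow> (\<exists>\<Lambda> c. finite \<Lambda> \<and> 0 \<notin> \<Lambda> \<and>
    ((\<lambda>\<epsilon>. \<Phi> \<epsilon> - (\<Sum>\<nu>\<in>\<Lambda>. c \<nu> * of_real \<epsilon> powr \<nu>)) \<longlongrightarrow> L) (at_right 0))"

lemma has_fp_integral_iff_fp_lim:
  "has_fp_integral \<phi> L x \<longleftrightarrow>
    (\<forall>\<epsilon>\<in>{0<..<x}. \<phi> integrable_on {\<epsilon>..x}) \<and> fp_lim (\<lambda>\<epsilon>. integral {\<epsilon>..x} \<phi>) L"
  by (simp add: has_fp_integral_def fp_lim_def)

lemma fp_lim_tendsto: "(\<Phi> \<longlongrightarrow> L) (at_right 0) \<Longrightarrow> fp_lim \<Phi> L"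
  unfolding fp_lim_def by (intro exI[of _ "{}"]) auto

lemma fp_lim_powr: "\<nu> \<noteq> 0 \<Longrightarrow> fp_lim (\<lambda>\<epsilon>. of_real \<epsilon> powr \<nu>) 0"
  unfolding fp_lim_def by (intro exI[of _ "{\<nu>}"] exI[of _ "\<lambda>_. 1"]) auto

lemma fp_lim_cong:
  assumes "fp_lim \<Phi> L" "\<forall>\<^sub>F \<epsilon> in at_right 0. \<Phi> \<epsilon> = \<Psi> \<epsilon>"
  shows "fp_lim \<Psi> L"
proof -
  obtain \<Lambda> c where *: "finite \<Lambda>" "0 \<notin> \<Lambda>"
    "((\<lambda>\<epsilon>. \<Phi> \<epsilon> - (\<Sum>\<nu>\<in>\<Lambda>. c \<nu> * of_real \<epsilon> powr \<nu>)) \<longlongrightarrow> L) (at_right 0)"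
    using assms(1) unfolding fp_lim_def by blast
  have "((\<lambda>\<epsilon>. \<Psi> \<epsilon> - (\<Sum>\<nu>\<in>\<Lambda>. c \<nu> * of_real \<epsilon> powr \<nu>)) \<longlongrightarrow> L) (at_right 0)"
    by (rule Lim_transform_eventually[OF *(3)]) (use assms(2) in eventually_elim, simp)
  with * show ?thesis unfolding fp_lim_def by blast
qed

lemma fp_lim_cmult:
  assumes "fp_lim \<Phi> L"
  shows "fp_lim (\<lambda>\<epsilon>. k * \<Phi> \<epsilon>) (k * L)"
proof -
  obtain \<Lambda> c where *: "finite \<Lambda>" "0 \<notin> \<Lambda>"
    "((\<lambda>\<epsilon>. \<Phi> \<epsilon> - (\<Sum>\<nu>\<in>\<Lambda>. c \<nu> * of_real \<epsilon> powr \<nu>)) \<longlongrightarrow> L) (at_right 0)"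
    using assms(1) unfolding fp_lim_def by blast
  have "((\<lambda>\<epsilon>. k * (\<Phi> \<epsilon> - (\<Sum>\<nu>\<in>\<Lambda>. c \<nu> * of_real \<epsilon> powr \<nu>))) \<longlongrightarrow> k * L) (at_right 0)"
    by (intro tendsto_intros *)
  then have "((\<lambda>\<epsilon>. k * \<Phi> \<epsilon> - (\<Sum>\<nu>\<in>\<Lambda>. (k * c \<nu>) * of_real \<epsilon> powr \<nu>)) \<longlongrightarrow> k * L) (at_right 0)"
    by (simp add: algebra_simps sum_distrib_left)
  with * show ?thesis unfolding fp_lim_def by (intro exI[of _ \<Lambda>] exI[of _ "\<lambda>\<nu>. k * c \<nu>"]) auto
qed

lemma fp_lim_add:
  assumes "fp_lim \<Phi> L" "fp_lim \<Psi> M"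
  shows "fp_lim (\<lambda>\<epsilon>. \<Phi> \<epsilon> + \<Psi> \<epsilon>) (L + M)"
proof -
  obtain \<Lambda> c where L: "finite \<Lambda>" "0 \<notin> \<Lambda>"
    "((\<lambda>\<epsilon>. \<Phi> \<epsilon> - (\<Sum>\<nu>\<in>\<Lambda>. c \<nu> * of_real \<epsilon> powr \<nu>)) \<longlongrightarrow> L) (at_right 0)"
    using assms(1) unfolding fp_lim_def by blast
  obtain \<Lambda>' d where M: "finite \<Lambda>'" "0 \<notin> \<Lambda>'"
    "((\<lambda>\<epsilon>. \<Psi> \<epsilon> - (\<Sum>\<nu>\<in>\<Lambda>'. d \<nu> * of_real \<epsilon> powr \<nu>)) \<longlongrightarrow> M) (at_right 0)"
    using assms(2) unfolding fp_lim_def by blast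
  define e where "e = (\<lambda>\<nu>. (if \<nu> \<in> \<Lambda> then c \<nu> else 0) + (if \<nu> \<in> \<Lambda>' then d \<nu> else 0))"
  have *: "(\<Sum>\<nu>\<in>\<Lambda> \<union> \<Lambda>'. e \<nu> * of_real \<epsilon> powr \<nu>) =
      (\<Sum>\<nu>\<in>\<Lambda>. c \<nu> * of_real \<epsilon> powr \<nu>) + (\<Sum>\<nu>\<in>\<Lambda>'. d \<nu> * of_real \<epsilon> powr \<nu>)" for \<epsilon> :: real
  proof -
    have "(\<Sum>\<nu>\<in>\<Lambda> \<union> \<Lambda>'. e \<nu> * of_real \<epsilon> powr \<nu>) =
        (\<Sum>\<nu>\<in>\<Lambda> \<union> \<Lambda>'. if \<nu> \<in> \<Lambda> then c \<nu> * of_real \<epsilon> powr \<nu> else 0) +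
        (\<Sum>\<nu>\<in>\<Lambda> \<union> \<Lambda>'. if \<nu> \<in> \<Lambda>' then d \<nu> * of_real \<epsilon> powr \<nu> else 0)"
      unfolding sum.distrib[symmetric] by (intro sum.cong) (auto simp: e_def algebra_simps)
    also have "(\<Sum>\<nu>\<in>\<Lambda> \<union> \<Lambda>'. if \<nu> \<in> \<Lambda>' then d \<nu> * of_real \<epsilon> powr \<nu> else 0) =
        (\<Sum>\<nu>\<in>\<Lambda>'. d \<nu> * of_real \<epsilon> powr \<nu>)"
      using L M by (intro sum.mono_neutral_cong_right) auto
    also have "(\<Sum>\<nu>\<in>\<Lambda> \<union> \<Lambda>'. if \<nu> \<in> \<Lambda> then c \<nu> * of_real \<epsilon> powr \<nu> else 0) =
        (\<Sum>\<nu>\<in>\<Lambda>. c \<nu> * of_real \<epsilon> powr \<nu>)"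
      using L M by (intro sum.mono_neutral_cong_right) auto
    finally show ?thesis .
  qed
  have "((\<lambda>\<epsilon>. (\<Phi> \<epsilon> + \<Psi> \<epsilon>) - (\<Sum>\<nu>\<in>\<Lambda> \<union> \<Lambda>'. e \<nu> * of_real \<epsilon> powr \<nu>)) \<longlongrightarrow> L + M) (at_right 0)"
    using tendsto_add[OF L(3) M(3)] by (simp add: * algebra_simps)
  with L M show ?thesis unfolding fp_lim_def by (intro exI[of _ "\<Lambda> \<union> \<Lambda>'"] exI[of _ e]) auto
qed

lemma fp_lim_sum:
  "finite A \<Longrightarrow> (\<And>k. k \<in> A \<Longrightarrow> fp_lim (\<Phi> k) (L k)) \<Longrightarrow> fp_lim (\<lambda>\<epsilon>. \<Sum>k\<in>A. \<Phi> k \<epsilon>) (\<Sum>k\<in>A. L k)"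
  by (induction A rule: finite_induct) (auto intro: fp_lim_tendsto fp_lim_add)

text \<open>Rescaling \<epsilon> multiplies each power by a constant. As neither logarithms nor the
  exponent 0 are split off, no constant term arises and the limit stays the same; finite parts
  therefore scale like ordinary integrals.\<close>

lemma fp_lim_scale:
  assumes "fp_lim \<Phi> L" "x > 0"
  shows "fp_lim (\<lambda>\<epsilon>. \<Phi> (\<epsilon> / x)) L"
proof -
  obtain \<Lambda> c where *: "finite \<Lambda>" "0 \<notin> \<Lambda>"
    "((\<lambda>\<epsilon>. \<Phi> \<epsilon> - (\<Sum>\<nu>\<in>\<Lambda>. c \<nu> * of_real \<epsilon> powr \<nu>)) \<longlongrightarrow> L) (at_right 0)"
    using assms(1) unfolding fp_lim_def by blast
  have "filterlim (\<lambda>\<epsilon>. inverse x * \<epsilon>) (at_right 0) (at_right 0)"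
    using assms by (intro filterlim_times_pos[OF filterlim_ident]) auto
  then have "filterlim (\<lambda>\<epsilon>. \<epsilon> / x) (at_right 0) (at_right 0)"
    by (simp add: field_simps)
  from filterlim_compose[OF *(3) this]
  have "((\<lambda>\<epsilon>. \<Phi> (\<epsilon> / x) - (\<Sum>\<nu>\<in>\<Lambda>. c \<nu> * of_real (\<epsilon> / x) powr \<nu>)) \<longlongrightarrow> L) (at_right 0)" .
  moreover have "\<forall>\<^sub>F \<epsilon> in at_right 0. \<Phi> (\<epsilon> / x) - (\<Sum>\<nu>\<in>\<Lambda>. c \<nu> * of_real (\<epsilon> / x) powr \<nu>) =
      \<Phi> (\<epsilon> / x) - (\<Sum>\<nu>\<in>\<Lambda>. (c \<nu> * of_real (inverse x) powr \<nu>) * of_real \<epsilon> powr \<nu>)"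
    using eventually_at_right_less[of 0]
  proof eventually_elim
    case (elim \<epsilon>)
    have "of_real (\<epsilon> / x) powr \<nu> = of_real \<epsilon> powr \<nu> * of_real (inverse x) powr \<nu>" for \<nu> :: complex
      using assms elim by (subst powr_times_real[symmetric]) (auto simp: divide_inverse)
    then show ?case by (simp add: mult_ac)
  qed
  ultimately have "((\<lambda>\<epsilon>. \<Phi> (\<epsilon> / x) - (\<Sum>\<nu>\<in>\<Lambda>. (c \<nu> * of_real (inverse x) powr \<nu>) * of_real \<epsilon> powr \<nu>)) \<longlongrightarrow> L)
      (at_right 0)" by (rule Lim_transform_eventually)
  with * show ?thesis unfolding fp_lim_def
    by (intro exI[of _ \<Lambda>] exI[of _ "\<lambda>\<nu>. c \<nu> * of_real (inverse x) powr \<nu>"]) auto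
qed

section \<open>Finite-part integrals: dependence on the integrand and scaling\<close>

lemma has_fp_integral_cong:
  assumes "has_fp_integral \<phi> L x" "\<And>t. 0 < t \<Longrightarrow> t \<le> x \<Longrightarrow> \<phi> t = \<psi> t"
  shows "has_fp_integral \<psi> L x"
proof -
  have "\<forall>\<^sub>F \<epsilon> in at_right 0. integral {\<epsilon>..x} \<phi> = integral {\<epsilon>..x} \<psi>"
    using eventually_at_right_less[of 0]
    by eventually_elim (intro integral_cong, use assms(2) in auto)
  moreover have "\<psi> integrable_on {\<epsilon>..x}" if "\<epsilon> \<in> {0<..<x}" for \<epsilon>
  proof -
    have "\<phi> integrable_on {\<epsilon>..x}" using assms(1) that by (simp add: has_fp_integral_def)
    then show ?thesis by (rule integrable_eq) (use that assms(2) in auto)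
  qed
  ultimately show ?thesis
    using assms(1) by (auto simp: has_fp_integral_iff_fp_lim intro: fp_lim_cong)
qed

lemma has_fp_integral_add:
  assumes "has_fp_integral \<phi> L x" "has_fp_integral \<psi> M x" "x > 0"
  shows "has_fp_integral (\<lambda>t. \<phi> t + \<psi> t) (L + M) x"
proof -
  have "\<forall>\<^sub>F \<epsilon> in at_right 0. integral {\<epsilon>..x} \<phi> + integral {\<epsilon>..x} \<psi> = integral {\<epsilon>..x} (\<lambda>t. \<phi> t + \<psi> t)"
    using eventually_at_right_less[of 0] eventually_at_right_real[OF assms(3)]
    by eventually_elim (rule integral_add[symmetric], use assms in \<open>auto simp: has_fp_integral_def\<close>)
  with assms show ?thesis
    by (auto simp: has_fp_integral_iff_fp_lim intro: fp_lim_cong[OF fp_lim_add] integrable_add)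
qed

lemma has_fp_integral_cmult:
  assumes "has_fp_integral \<phi> L x"
  shows "has_fp_integral (\<lambda>t. k * \<phi> t) (k * L) x"
  using assms fp_lim_cmult[of "\<lambda>\<epsilon>. integral {\<epsilon>..x} \<phi>" L k]
  by (auto simp: has_fp_integral_iff_fp_lim intro: integrable_on_mult_right)

lemma has_fp_integral_stretch:
  assumes "has_fp_integral \<phi> L 1" "x > 0"
  shows "has_fp_integral (\<lambda>t. \<phi> (t / x)) (of_real x * L) x"
proof -
  have *: "((\<lambda>t. \<phi> (t / x)) has_integral of_real x * integral {\<epsilon> / x..1} \<phi>) {\<epsilon>..x}"
    if "\<epsilon> \<in> {0<..<x}" for \<epsilon>
  proof -
    have "\<phi> integrable_on {\<epsilon> / x..1}"
      using assms that by (auto simp: has_fp_integral_def)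
    then have "(\<phi> has_integral integral {\<epsilon> / x..1} \<phi>) {\<epsilon> / x..1}" by blast
    from has_integral_stretch_real[OF this, of "1 / x"] assms(2)
    have "((\<lambda>t. \<phi> (t / x)) has_integral x *\<^sub>R integral {\<epsilon> / x..1} \<phi>) ((\<lambda>t. t * x) ` {\<epsilon> / x..1})"
      by simp
    also have "(\<lambda>t. t * x) ` {\<epsilon> / x..1} = {\<epsilon>..x}"
      using assms(2) that by (intro set_eqI iffI) (auto simp: field_simps intro!: image_eqI[of _ _ "_ / x"])
    finally show ?thesis by (simp add: scaleR_conv_of_real)
  qed
  have "\<forall>\<^sub>F \<epsilon> in at_right 0. of_real x * integral {\<epsilon> / x..1} \<phi> = integral {\<epsilon>..x} (\<lambda>t. \<phi> (t / x))"
    using eventually_at_right_real[OF assms(2)]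
    by eventually_elim (rule integral_unique[OF *, symmetric], auto)
  then have "fp_lim (\<lambda>\<epsilon>. integral {\<epsilon>..x} (\<lambda>t. \<phi> (t / x))) (of_real x * L)"
    using assms by (auto simp: has_fp_integral_iff_fp_lim intro: fp_lim_cong[OF fp_lim_cmult[OF fp_lim_scale]])
  moreover have "(\<lambda>t. \<phi> (t / x)) integrable_on {\<epsilon>..x}" if "\<epsilon> \<in> {0<..<x}" for \<epsilon>
    using *[OF that] by blast
  ultimately show ?thesis by (auto simp: has_fp_integral_iff_fp_lim)
qed

text \<open>The antiderivative -(x-t)^\<gamma>/\<gamma> of the kernel is continuous at t = x even
  for \<gamma> < 1, so the fundamental theorem with derivatives in the open interval applies, and
  integrability of the singular integrand is a conclusion.\<close>

lemma kernel_by_parts: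
  fixes u :: "real \<Rightarrow> complex"
  assumes "\<gamma> > 0" "a \<le> x" "continuous_on {a..x} u" "continuous_on {a..x} u'"
    and der: "\<And>t. a < t \<Longrightarrow> t < x \<Longrightarrow> (u has_vector_derivative u' t) (at t)"
  shows "((\<lambda>t. of_real ((x - t) powr (\<gamma> - 1)) * u t) has_integral
    (of_real ((x - a) powr \<gamma>) * u a + integral {a..x} (\<lambda>t. of_real ((x - t) powr \<gamma>) * u' t)) / of_real \<gamma>) {a..x}"
proof -
  define F where "F = (\<lambda>t. - (of_real ((x - t) powr \<gamma> / \<gamma>) * u t))"
  define v where "v = (\<lambda>t. of_real ((x - t) powr \<gamma>) * u' t)"
  have cont: "continuous_on {a..x} (\<lambda>t. (x - t) powr \<gamma>)"
    using assms(1) by (intro continuous_on_powr' continuous_intros) auto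
  have "((\<lambda>t. of_real ((x - t) powr (\<gamma> - 1)) * u t - v t / of_real \<gamma>) has_integral (F x - F a)) {a..x}"
  proof (rule fundamental_theorem_of_calculus_interior[OF assms(2)])
    show "continuous_on {a..x} F"
      unfolding F_def using assms by (intro continuous_intros cont) auto
    fix t assume t: "t \<in> {a<..<x}"
    have 1: "((\<lambda>t. (x - t) powr \<gamma> / \<gamma>) has_real_derivative - ((x - t) powr (\<gamma> - 1))) (at t)"
      using t assms(1)
      by (auto intro!: derivative_eq_intros has_real_derivative_powr' simp: divide_simps powr_diff)
    have "((\<lambda>t. of_real ((x - t) powr \<gamma> / \<gamma>) * u t) has_vector_derivative
        (of_real ((x - t) powr \<gamma> / \<gamma>) * u' t + of_real (- ((x - t) powr (\<gamma> - 1))) * u t)) (at t)"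
      using t by (intro has_vector_derivative_mult has_vector_derivative_of_real
        has_real_derivative_iff_has_vector_derivative[THEN iffD1] 1 der) auto
    from has_vector_derivative_minus[OF this]
    show "(F has_vector_derivative of_real ((x - t) powr (\<gamma> - 1)) * u t - v t / of_real \<gamma>) (at t)"
      by (simp add: F_def v_def algebra_simps)
  qed
  moreover have "v integrable_on {a..x}"
    unfolding v_def by (intro integrable_continuous_real continuous_intros cont assms)
  then have "((\<lambda>t. v t / of_real \<gamma>) has_integral integral {a..x} v / of_real \<gamma>) {a..x}"
    by (intro has_integral_divide) blast
  ultimately have "((\<lambda>t. of_real ((x - t) powr (\<gamma> - 1)) * u t - v t / of_real \<gamma> + v t / of_real \<gamma>)
      has_integral (F x - F a) + integral {a..x} v / of_real \<gamma>) {a..x}"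
    by (rule has_integral_add)
  then show ?thesis using assms(1) by (simp add: F_def v_def add_divide_distrib)
qed

subsection \<open>Fractional integrals of powers\<close>

lemma pow_fun_pos: "t > 0 \<Longrightarrow> pow_fun \<beta> t = of_real t powr (\<beta> - 1)"
  by (simp add: pow_fun_def)

lemma pow_fun_of_nat: "pow_fun (of_nat i + 1) t = of_real t ^ i"
  by (simp add: pow_fun_def powr_nat')

lemma continuous_on_pow_fun:
  assumes "Re \<beta> > 1"
  shows "continuous_on {0..} (pow_fun \<beta>)"
  unfolding continuous_on_eq_continuous_within
proof
  fix x :: real assume "x \<in> {0..}"
  then consider "x = 0" | "x > 0" by fastforce
  then show "continuous (at x within {0..}) (pow_fun \<beta>)"
  proof cases
    case 1
    have "((\<lambda>t. of_real t powr (\<beta> - 1)) \<longlongrightarrow> 0) (at_right (0::real))"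
      using assms by (intro powr_complex_tendsto_0) simp
    moreover have "\<forall>\<^sub>F t in at_right 0. of_real t powr (\<beta> - 1) = pow_fun \<beta> t"
      using eventually_at_right_less[of 0] by eventually_elim (simp add: pow_fun_pos)
    ultimately have "(pow_fun \<beta> \<longlongrightarrow> 0) (at_right 0)" by (rule Lim_transform_eventually)
    moreover have "pow_fun \<beta> 0 = 0" using assms by (auto simp: pow_fun_def)
    ultimately show ?thesis
      using 1 by (simp add: continuous_within at_within_Ici_at_right)
  next
    case 2
    have "((\<lambda>t. of_real t powr (\<beta> - 1)) has_vector_derivative (\<beta> - 1) * of_real x powr (\<beta> - 1 - 1)) (at x)"
      by (intro has_vector_derivative_powr_complex 2)
    then have "isCont (\<lambda>t. of_real t powr (\<beta> - 1)) x" by (rule has_vector_derivative_continuous)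
    moreover have "\<forall>\<^sub>F t in nhds x. of_real t powr (\<beta> - 1) = pow_fun \<beta> t"
      using eventually_nhds_in_open[of "{0<..}" x] 2
      by (auto elim!: eventually_mono simp: pow_fun_pos)
    ultimately have "isCont (pow_fun \<beta>) x" by (rule iffD1[OF isCont_cong, rotated])
    then show ?thesis by (rule continuous_at_imp_continuous_at_within)
  qed
qed

text \<open>Near 0 the binomial series of \<open>(1 - t)^(\<gamma>-1)\<close> splits the integrand into powers of \<open>t\<close>, none
  of exponent \<open>-1\<close>, and a continuous remainder.\<close>

lemma fp_integral_Beta_exists:
  assumes "\<gamma> > 0" "\<beta> \<notin> \<int>\<^sub>\<le>\<^sub>0"
  shows "\<exists>L. has_fp_integral (\<lambda>t. of_real ((1 - t) powr (\<gamma> - 1)) * of_real t powr (\<beta> - 1)) L 1"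
proof -
  define \<phi> where "\<phi> = (\<lambda>t. of_real ((1 - t) powr (\<gamma> - 1)) * of_real t powr (\<beta> - 1) :: complex)"
  have int: "\<phi> integrable_on {a..1}" if "0 < a" "a \<le> 1" for a
    unfolding \<phi>_def
  proof (rule has_integral_integrable[OF kernel_by_parts])
    show "((\<lambda>t. of_real t powr (\<beta> - 1)) has_vector_derivative (\<beta> - 1) * of_real t powr (\<beta> - 1 - 1)) (at t)"
      if "a < t" "t < 1" for t
      using that \<open>0 < a\<close> by (intro has_vector_derivative_powr_complex) auto
  qed (use that assms(1) in \<open>auto intro!: continuous_intros continuous_on_powr_complex\<close>)
  \<comment> \<open>The power left in the remainder has the exponent \<beta> + M - 1, of positive
    real part, hence is continuous at 0.\<close>
  obtain M :: nat where "real M > 1 - Re \<beta>" using reals_Archimedean2 by blast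
  then have M: "Re (\<beta> + of_nat M) > 1" by simp
  define c where "c = (\<lambda>k. ((\<gamma> - 1) gchoose k) * (- 1) ^ k)"
  have c: "(\<lambda>k. c k * t ^ k) sums (1 - t) powr (\<gamma> - 1)" if "\<bar>t\<bar> < 1" for t
    using gen_binomial_real[of "- t" "\<gamma> - 1"] that by (simp add: c_def power_minus[of t] mult_ac)
  define \<rho> where "\<rho> = (\<lambda>t. \<Sum>k. c (k + M) * t ^ k)"
  have summ: "summable (\<lambda>k. c (k + M) * t ^ k)" if "\<bar>t\<bar> < 1" for t
  proof (cases "t = 0")
    case False
    have "summable (\<lambda>k. c (k + M) * t ^ (k + M))"
      using c[OF that] by (subst summable_iff_shift) (auto simp: sums_iff)
    then have "summable (\<lambda>k. c (k + M) * t ^ (k + M) * inverse (t ^ M))" by (rule summable_mult2)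
    moreover have "c (k + M) * t ^ (k + M) * inverse (t ^ M) = c (k + M) * t ^ k" for k
      using False by (simp add: power_add field_simps)
    ultimately show ?thesis by simp
  qed auto
  \<comment> \<open>The cut at 1/2 stays away from the singularity of the kernel at 1; 3/4 is a
    radius strictly between 1/2 and 1.\<close>
  have "continuous_on {0..1/2} \<rho>"
    unfolding \<rho>_def
    by (intro continuous_at_imp_continuous_on ballI isCont_powser[of _ "3/4"] summ) auto
  then have w: "continuous_on {0..1/2} (\<lambda>t. pow_fun (\<beta> + of_nat M) t * of_real (\<rho> t))"
    by (intro continuous_intros continuous_on_subset[OF continuous_on_pow_fun[OF M]]) auto
  define w where "w = (\<lambda>t. pow_fun (\<beta> + of_nat M) t * of_real (\<rho> t))"
  have split: "\<phi> t = (\<Sum>k<M. of_real (c k) * of_real t powr (\<beta> + of_nat k - 1)) + w t"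
    if t: "0 < t" "t \<le> 1/2" for t
  proof -
    have "(1 - t) powr (\<gamma> - 1) = (\<Sum>k. c (k + M) * t ^ (k + M)) + (\<Sum>k<M. c k * t ^ k)"
      using c[of t] t by (subst suminf_split_initial_segment[symmetric]) (auto simp: sums_iff)
    also have "(\<Sum>k. c (k + M) * t ^ (k + M)) = t ^ M * \<rho> t"
      using suminf_mult[OF summ, of t "t ^ M"] t by (simp add: \<rho>_def power_add mult_ac)
    finally have "\<phi> t = of_real (t ^ M * \<rho> t + (\<Sum>k<M. c k * t ^ k)) * of_real t powr (\<beta> - 1)"
      by (simp add: \<phi>_def)
    also have "\<dots> = (\<Sum>k<M. of_real (c k) * (of_real t ^ k * of_real t powr (\<beta> - 1))) +
        (of_real t ^ M * of_real t powr (\<beta> - 1)) * of_real (\<rho> t)"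
      by (simp add: algebra_simps sum_distrib_left sum_distrib_right)
    moreover have "of_real t ^ k * of_real t powr (\<beta> - 1) = of_real t powr (\<beta> + of_nat k - 1)" for k
      using t powr_add[of "of_real t" "of_nat k" "\<beta> - 1"] by (simp add: powr_nat' algebra_simps)
    ultimately show ?thesis using t by (simp add: w_def pow_fun_pos)
  qed
  \<comment> \<open>The exponents of \<epsilon> to be split off are \<beta> + k. They are nonzero
    because \<beta> is no nonpositive integer, which rules out logarithms.\<close>
  have nz: "\<beta> + of_nat k \<noteq> 0" for k
    using assms(2) by (metis add_eq_0_iff2 minus_of_nat_in_nonpos_Ints)
  have pw: "((\<lambda>t. of_real t powr (\<beta> + of_nat k - 1)) has_integral
      (of_real (1/2) powr (\<beta> + of_nat k) / (\<beta> + of_nat k) - of_real \<epsilon> powr (\<beta> + of_nat k) / (\<beta> + of_nat k)))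
      {\<epsilon>..1/2}" if "0 < \<epsilon>" "\<epsilon> < 1/2" for k and \<epsilon> :: real
  proof (rule fundamental_theorem_of_calculus)
    fix t assume t: "t \<in> {\<epsilon>..1/2}"
    have "((\<lambda>t. of_real t powr (\<beta> + of_nat k) / (\<beta> + of_nat k)) has_vector_derivative
        (\<beta> + of_nat k) * of_real t powr (\<beta> + of_nat k - 1) / (\<beta> + of_nat k)) (at t within {\<epsilon>..1/2})"
      using t that by (intro has_vector_derivative_divide has_vector_derivative_powr_complex) auto
    then show "((\<lambda>t. of_real t powr (\<beta> + of_nat k) / (\<beta> + of_nat k)) has_vector_derivative
        of_real t powr (\<beta> + of_nat k - 1)) (at t within {\<epsilon>..1/2})" using nz by simp
  qed (use that in auto)
  have eq: "integral {\<epsilon>..1} \<phi> = (\<Sum>k<M. of_real (c k) * (of_real (1/2) powr (\<beta> + of_nat k) / (\<beta> + of_nat k) +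
      (- 1 / (\<beta> + of_nat k)) * of_real \<epsilon> powr (\<beta> + of_nat k))) + (integral {\<epsilon>..1/2} w + integral {1/2..1} \<phi>)"
    if e: "0 < \<epsilon>" "\<epsilon> < 1/2" for \<epsilon>
  proof -
    have "w integrable_on {\<epsilon>..1/2}"
      using w e unfolding w_def by (intro integrable_continuous_real) (auto intro: continuous_on_subset)
    then have "((\<lambda>t. (\<Sum>k<M. of_real (c k) * of_real t powr (\<beta> + of_nat k - 1)) + w t) has_integral
      (\<Sum>k<M. of_real (c k) * (of_real (1/2) powr (\<beta> + of_nat k) / (\<beta> + of_nat k) -
         of_real \<epsilon> powr (\<beta> + of_nat k) / (\<beta> + of_nat k))) + integral {\<epsilon>..1/2} w) {\<epsilon>..1/2}"
      by (intro has_integral_add has_integral_sum has_integral_mult_right pw[OF e]) auto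
    then have "(\<phi> has_integral
      (\<Sum>k<M. of_real (c k) * (of_real (1/2) powr (\<beta> + of_nat k) / (\<beta> + of_nat k) -
         of_real \<epsilon> powr (\<beta> + of_nat k) / (\<beta> + of_nat k))) + integral {\<epsilon>..1/2} w) {\<epsilon>..1/2}"
      by (rule has_integral_eq[rotated]) (use e split in auto)
    moreover have "integral {\<epsilon>..1/2} \<phi> + integral {1/2..1} \<phi> = integral {\<epsilon>..1} \<phi>"
      using e by (intro Henstock_Kurzweil_Integration.integral_combine int) auto
    ultimately show ?thesis by (simp add: has_integral_iff add.assoc)
  qed
  have "w integrable_on {0..1/2}" using w unfolding w_def by (rule integrable_continuous_real)
  then have "fp_lim (\<lambda>\<epsilon>. integral {\<epsilon>..1/2} w) (integral {0..1/2} w)"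
    using has_fp_integral_integral[of w "1/2"] by (simp add: has_fp_integral_iff_fp_lim)
  then have "fp_lim (\<lambda>\<epsilon>. (\<Sum>k<M. of_real (c k) * (of_real (1/2) powr (\<beta> + of_nat k) / (\<beta> + of_nat k) +
      (- 1 / (\<beta> + of_nat k)) * of_real \<epsilon> powr (\<beta> + of_nat k))) + (integral {\<epsilon>..1/2} w + integral {1/2..1} \<phi>))
      ((\<Sum>k<M. of_real (c k) * (of_real (1/2) powr (\<beta> + of_nat k) / (\<beta> + of_nat k) +
      (- 1 / (\<beta> + of_nat k)) * 0)) + (integral {0..1/2} w + integral {1/2..1} \<phi>))"
    by (intro fp_lim_add fp_lim_sum fp_lim_cmult fp_lim_powr nz fp_lim_tendsto[OF tendsto_const]) auto
  moreover have "\<forall>\<^sub>F \<epsilon> in at_right 0. (\<Sum>k<M. of_real (c k) * (of_real (1/2) powr (\<beta> + of_nat k) / (\<beta> + of_nat k) +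
      (- 1 / (\<beta> + of_nat k)) * of_real \<epsilon> powr (\<beta> + of_nat k))) + (integral {\<epsilon>..1/2} w + integral {1/2..1} \<phi>)
      = integral {\<epsilon>..1} \<phi>"
    using eventually_at_right_real[of 0 "1/2"] by (rule eventually_mono) (auto simp: eq)
  ultimately have "fp_lim (\<lambda>\<epsilon>. integral {\<epsilon>..1} \<phi>) ((\<Sum>k<M. of_real (c k) * (of_real (1/2) powr (\<beta> + of_nat k) / (\<beta> + of_nat k) +
      (- 1 / (\<beta> + of_nat k)) * 0)) + (integral {0..1/2} w + integral {1/2..1} \<phi>))"
    by (rule fp_lim_cong)
  then show ?thesis using int unfolding has_fp_integral_iff_fp_lim \<phi>_def by auto
qed

section \<open>Fractional integrals of every real order as a relation\<close>

definition der_order :: "real \<Rightarrow> nat"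
  where "der_order \<alpha> = (if \<alpha> > 0 then 0 else nat (\<lfloor>- \<alpha>\<rfloor> + 1))"

text \<open>For \<alpha> \<le> 0, \<open>der_order\<close> is the least integer exceeding -\<alpha>,
  as in \<open>subst_deriv\<close>; it is 0 for \<alpha> > 0. Integrals of positive order are thus
  all that has to be differentiated.\<close>

lemma der_order_pos: "\<alpha> + real (der_order \<alpha>) > 0"
  unfolding der_order_def using floor_correct[of "- \<alpha>"]
  by (cases "\<alpha> > 0") (simp_all add: of_nat_nat, linarith)

text \<open>The relation \<open>I\<^sup>\<alpha> F = V\<close> on the positive half-line for \<open>\<sigma> = 0\<close>, together with the existence of
  all the finite parts and derivatives involved. It reduces the case of general \<open>\<sigma>\<close> to \<open>\<sigma> = 0\<close>.\<close>

definition has_frac_int :: "real \<Rightarrow> (real \<Rightarrow> complex) \<Rightarrow> (real \<Rightarrow> complex) \<Rightarrow> bool"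
  where "has_frac_int \<alpha> F V \<longleftrightarrow> (let m = der_order \<alpha>; \<gamma> = \<alpha> + real m in
    if \<alpha> = 0 then \<forall>x>0. V x = F x
    else \<exists>W. (\<forall>x>0. has_fp_integral (subst_kernel 0 \<gamma> F x) (of_real (Gamma \<gamma>) * W 0 x) x) \<and>
      (\<forall>i<m. \<forall>x>0. (W i has_vector_derivative W (Suc i) x) (at x)) \<and> (\<forall>x>0. V x = W m x))"

lemma subst_kernel_0: "subst_kernel 0 \<gamma> F x t = of_real ((x - t) powr (\<gamma> - 1)) * F t"
  by (simp add: subst_kernel_def)

lemma has_frac_int_add:
  assumes "has_frac_int \<alpha> F V" "has_frac_int \<alpha> G U"
  shows "has_frac_int \<alpha> (\<lambda>x. F x + G x) (\<lambda>x. V x + U x)"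
proof (cases "\<alpha> = 0")
  case False
  define m \<gamma> where "m = der_order \<alpha>" and "\<gamma> = \<alpha> + real m"
  obtain W where W: "\<forall>x>0. has_fp_integral (subst_kernel 0 \<gamma> F x) (of_real (Gamma \<gamma>) * W 0 x) x"
      "\<forall>i<m. \<forall>x>0. (W i has_vector_derivative W (Suc i) x) (at x)" "\<forall>x>0. V x = W m x"
    using assms(1) False by (auto simp: has_frac_int_def m_def \<gamma>_def Let_def)
  obtain W' where W': "\<forall>x>0. has_fp_integral (subst_kernel 0 \<gamma> G x) (of_real (Gamma \<gamma>) * W' 0 x) x"
      "\<forall>i<m. \<forall>x>0. (W' i has_vector_derivative W' (Suc i) x) (at x)" "\<forall>x>0. U x = W' m x"
    using assms(2) False by (auto simp: has_frac_int_def m_def \<gamma>_def Let_def)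
  have "has_fp_integral (subst_kernel 0 \<gamma> (\<lambda>x. F x + G x) x) (of_real (Gamma \<gamma>) * (W 0 x + W' 0 x)) x"
    if "x > 0" for x
    using has_fp_integral_add[of _ _ x, OF W(1)[rule_format, OF that] W'(1)[rule_format, OF that] that]
    by (simp add: subst_kernel_0[abs_def] distrib_left)
  with W W' False show ?thesis
    unfolding has_frac_int_def Let_def
    by (auto intro!: exI[of _ "\<lambda>i x. W i x + W' i x"] has_vector_derivative_add simp: m_def \<gamma>_def)
qed (use assms in \<open>auto simp: has_frac_int_def\<close>)

lemma has_frac_int_cmult:
  assumes "has_frac_int \<alpha> F V"
  shows "has_frac_int \<alpha> (\<lambda>x. k * F x) (\<lambda>x. k * V x)"
proof (cases "\<alpha> = 0")
  case False
  define m \<gamma> where "m = der_order \<alpha>" and "\<gamma> = \<alpha> + real m"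
  obtain W where W: "\<forall>x>0. has_fp_integral (subst_kernel 0 \<gamma> F x) (of_real (Gamma \<gamma>) * W 0 x) x"
      "\<forall>i<m. \<forall>x>0. (W i has_vector_derivative W (Suc i) x) (at x)" "\<forall>x>0. V x = W m x"
    using assms(1) False by (auto simp: has_frac_int_def m_def \<gamma>_def Let_def)
  have "has_fp_integral (subst_kernel 0 \<gamma> (\<lambda>x. k * F x) x) (of_real (Gamma \<gamma>) * (k * W 0 x)) x"
    if "x > 0" for x
    using has_fp_integral_cmult[OF W(1)[rule_format, OF that], of k]
    by (simp add: subst_kernel_0[abs_def] mult_ac)
  with W False show ?thesis
    unfolding has_frac_int_def Let_def
    by (auto intro!: exI[of _ "\<lambda>i x. k * W i x"] has_vector_derivative_mult_right simp: m_def \<gamma>_def)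
qed (use assms in \<open>auto simp: has_frac_int_def\<close>)

lemma has_frac_int_sum:
  assumes "finite A" "\<And>k. k \<in> A \<Longrightarrow> has_frac_int \<alpha> (F k) (V k)"
  shows "has_frac_int \<alpha> (\<lambda>x. \<Sum>k\<in>A. F k x) (\<lambda>x. \<Sum>k\<in>A. V k x)"
  using assms
proof (induction A rule: finite_induct)
  case empty
  have "has_fp_integral (\<lambda>_. 0) 0 x" for x
    by (auto simp: has_fp_integral_iff_fp_lim intro: fp_lim_tendsto)
  then show ?case
    by (auto simp: has_frac_int_def Let_def subst_kernel_0[abs_def] intro!: exI[of _ "\<lambda>_ _. 0"])
qed (auto intro: has_frac_int_add)

text \<open>Conjugation with exp(-\<sigma> x): the exponentials of kernel and integrand multiply to
  exp(-\<sigma> x), independent of \<tau>, and \<open>subst_D\<close> maps exp(-\<sigma> x) W to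
  exp(-\<sigma> x) W', the terms with \<sigma> cancelling.\<close>

lemma subst_int_eq:
  assumes "has_frac_int \<alpha> F V" "x > 0"
  shows "subst_int \<sigma> \<alpha> (\<lambda>t. exp (- \<sigma> * of_real t) * F t) x = exp (- \<sigma> * of_real x) * V x"
proof (cases "\<alpha> = 0")
  case True
  then show ?thesis using assms by (simp add: subst_int_def has_frac_int_def)
next
  case False
  define m \<gamma> where "m = der_order \<alpha>" and "\<gamma> = \<alpha> + real m"
  define f where "f = (\<lambda>t. exp (- \<sigma> * of_real t) * F t)"
  obtain W where W: "\<forall>x>0. has_fp_integral (subst_kernel 0 \<gamma> F x) (of_real (Gamma \<gamma>) * W 0 x) x"
      "\<forall>i<m. \<forall>x>0. (W i has_vector_derivative W (Suc i) x) (at x)" "\<forall>x>0. V x = W m x"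
    using assms(1) False by (auto simp: has_frac_int_def m_def \<gamma>_def Let_def)
  have "\<gamma> > 0" using der_order_pos by (simp add: \<gamma>_def m_def)
  then have "Gamma \<gamma> \<noteq> 0" by (metis Gamma_real_pos less_irrefl)
  have pos: "subst_int_pos \<sigma> \<gamma> f x = exp (- \<sigma> * of_real x) * W 0 x" if "x > 0" for x
  proof -
    have "subst_kernel \<sigma> \<gamma> f x = (\<lambda>t. exp (- \<sigma> * of_real x) * subst_kernel 0 \<gamma> F x t)"
      by (auto simp: fun_eq_iff subst_kernel_def f_def algebra_simps exp_add[symmetric] mult_exp_exp)
    then have "has_fp_integral (subst_kernel \<sigma> \<gamma> f x) (exp (- \<sigma> * of_real x) * (of_real (Gamma \<gamma>) * W 0 x)) x"
      using has_fp_integral_cmult W(1) that by auto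
    then show ?thesis using \<open>Gamma \<gamma> \<noteq> 0\<close> by (simp add: subst_int_pos_def fp_integral_eqI)
  qed
  have iter: "i \<le> m \<Longrightarrow> \<forall>x>0. (subst_D \<sigma> ^^ i) (subst_int_pos \<sigma> \<gamma> f) x = exp (- \<sigma> * of_real x) * W i x" for i
  proof (induction i)
    case (Suc i)
    show ?case
    proof (intro allI impI)
      fix x :: real assume x: "x > 0"
      have "((\<lambda>x. exp (- \<sigma> * of_real x)) has_vector_derivative - \<sigma> * exp (- \<sigma> * of_real x)) (at x)"
        by (rule has_vector_derivative_real_field) (auto intro!: derivative_eq_intros)
      then have "((\<lambda>x. exp (- \<sigma> * of_real x) * W i x) has_vector_derivative
          exp (- \<sigma> * of_real x) * W (Suc i) x + (- \<sigma> * exp (- \<sigma> * of_real x)) * W i x) (at x)"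
        using W(2) Suc.prems x by (intro has_vector_derivative_mult) auto
      then have "((subst_D \<sigma> ^^ i) (subst_int_pos \<sigma> \<gamma> f) has_vector_derivative
          exp (- \<sigma> * of_real x) * W (Suc i) x + (- \<sigma> * exp (- \<sigma> * of_real x)) * W i x) (at x)"
        by (rule has_vector_derivative_transform_within_open[of _ _ _ "{0<..}"]) (use x Suc in auto)
      then show "(subst_D \<sigma> ^^ Suc i) (subst_int_pos \<sigma> \<gamma> f) x = exp (- \<sigma> * of_real x) * W (Suc i) x"
        using Suc.IH Suc.prems x
        by (simp only: funpow.simps o_def subst_D_def[of \<sigma> "(subst_D \<sigma> ^^ i) (subst_int_pos \<sigma> \<gamma> f)"]
            vector_derivative_at) (simp add: Suc_le_eq)
    qed
  qed (use pos in auto)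
  have "subst_int \<sigma> \<alpha> f = (subst_D \<sigma> ^^ m) (subst_int_pos \<sigma> \<gamma> f)"
    using False by (simp add: subst_int_def subst_deriv_def m_def \<gamma>_def der_order_def add.commute Let_def)
  then show ?thesis using iter[of m] W(3) assms(2) unfolding f_def by simp
qed

text \<open>The substitution t = x s pulls x^(\<gamma>+\<beta>-1) out of the finite part over the
  unit interval, with \<gamma> = \<alpha> + m, and m derivatives produce the falling factorial. The
  value at x = 1 enters through the parameter \<open>B\<close>, since it comes from an existence
  statement for complex \<beta> and from the Beta integral for monomials.\<close>

lemma has_frac_int_pow_fun_aux:
  assumes "\<alpha> \<noteq> 0" and m: "m = der_order \<alpha>"
    and fp: "has_fp_integral (\<lambda>t. of_real ((1 - t) powr (\<alpha> + real m - 1)) * of_real t powr (\<beta> - 1))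
      (of_real (Gamma (\<alpha> + real m)) * B) 1"
  shows "has_frac_int \<alpha> (pow_fun \<beta>)
    (\<lambda>x. B * (\<Prod>i<m. of_real (\<alpha> + real m) + \<beta> - 1 - of_nat i) * of_real x powr (of_real \<alpha> + \<beta> - 1))"
proof -
  define \<gamma> where "\<gamma> = \<alpha> + real m"
  define W where "W = (\<lambda>i x. B * (\<Prod>j<i. of_real \<gamma> + \<beta> - 1 - of_nat j) *
    of_real x powr (of_real \<gamma> + \<beta> - 1 - of_nat i))"
  have "has_fp_integral (subst_kernel 0 \<gamma> (pow_fun \<beta>) x) (of_real (Gamma \<gamma>) * W 0 x) x" if x: "x > 0" for x
  proof -
    have "has_fp_integral (\<lambda>t. of_real x powr (of_real \<gamma> + \<beta> - 2) *
        (of_real ((1 - t / x) powr (\<gamma> - 1)) * of_real (t / x) powr (\<beta> - 1)))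
      (of_real x powr (of_real \<gamma> + \<beta> - 2) * (of_real x * (of_real (Gamma \<gamma>) * B))) x"
      using fp x by (intro has_fp_integral_cmult has_fp_integral_stretch) (simp_all add: \<gamma>_def)
    moreover have "of_real x powr (of_real \<gamma> + \<beta> - 2) * (of_real x * (of_real (Gamma \<gamma>) * B)) =
        of_real (Gamma \<gamma>) * W 0 x"
      using x powr_add[of "of_real x" "of_real \<gamma> + \<beta> - 2" 1] by (simp add: W_def algebra_simps)
    moreover have "of_real x powr (of_real \<gamma> + \<beta> - 2) *
        (of_real ((1 - t / x) powr (\<gamma> - 1)) * of_real (t / x) powr (\<beta> - 1)) = subst_kernel 0 \<gamma> (pow_fun \<beta>) x t"
      if t: "0 < t" "t \<le> x" for t
    proof -
      have "of_real x powr (of_real \<gamma> + \<beta> - 2) = of_real (x powr (\<gamma> - 1)) * of_real x powr (\<beta> - 1)"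
        using x powr_add[of "of_real x" "of_real (\<gamma> - 1)" "\<beta> - 1"]
        by (simp add: of_real_powr_eq[symmetric] algebra_simps)
      then have "of_real x powr (of_real \<gamma> + \<beta> - 2) *
          (of_real ((1 - t / x) powr (\<gamma> - 1)) * of_real (t / x) powr (\<beta> - 1)) =
          of_real (x powr (\<gamma> - 1) * (1 - t / x) powr (\<gamma> - 1)) *
          (of_real x powr (\<beta> - 1) * of_real (t / x) powr (\<beta> - 1))"
        by (simp only: of_real_mult mult_ac)
      moreover have "x powr (\<gamma> - 1) * (1 - t / x) powr (\<gamma> - 1) = (x - t) powr (\<gamma> - 1)"
        using x t by (subst powr_mult[symmetric]) (auto simp: right_diff_distrib)
      moreover have "of_real x powr (\<beta> - 1) * of_real (t / x) powr (\<beta> - 1) = of_real t powr (\<beta> - 1)"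
        using x t by (subst powr_times_real[symmetric]) auto
      ultimately show ?thesis
        using t by (simp only: subst_kernel_0 pow_fun_pos)
    qed
    ultimately show ?thesis by (simp add: has_fp_integral_cong)
  qed
  moreover have "(W i has_vector_derivative W (Suc i) x) (at x)" if "x > 0" for i x
  proof -
    have "(W i has_vector_derivative B * (\<Prod>j<i. of_real \<gamma> + \<beta> - 1 - of_nat j) *
      ((of_real \<gamma> + \<beta> - 1 - of_nat i) * of_real x powr (of_real \<gamma> + \<beta> - 1 - of_nat i - 1))) (at x)"
      unfolding W_def using that
      by (intro has_vector_derivative_mult_right has_vector_derivative_powr_complex)
    then show ?thesis by (simp add: W_def algebra_simps)
  qed
  moreover have "of_real \<gamma> + \<beta> - 1 - of_nat m = of_real \<alpha> + \<beta> - 1" by (simp add: \<gamma>_def)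
  then have "B * (\<Prod>i<m. of_real \<gamma> + \<beta> - 1 - of_nat i) * of_real x powr (of_real \<alpha> + \<beta> - 1) = W m x" for x
    by (simp only: W_def)
  ultimately show ?thesis
    using assms(1) unfolding has_frac_int_def Let_def m[symmetric] \<gamma>_def[symmetric]
    by (auto intro!: exI[of _ W])
qed

lemma has_frac_int_pow_fun:
  assumes "\<beta> \<notin> \<int>\<^sub>\<le>\<^sub>0"
  shows "\<exists>B. has_frac_int \<alpha> (pow_fun \<beta>) (\<lambda>x. B * of_real x powr (of_real \<alpha> + \<beta> - 1))"
proof (cases "\<alpha> = 0")
  case True
  then show ?thesis by (intro exI[of _ 1]) (auto simp: has_frac_int_def pow_fun_pos)
next
  case False
  define \<gamma> where "\<gamma> = \<alpha> + real (der_order \<alpha>)"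
  have "\<gamma> > 0" using der_order_pos by (simp add: \<gamma>_def)
  then have "Gamma \<gamma> \<noteq> 0" by (metis Gamma_real_pos less_irrefl)
  obtain L where "has_fp_integral (\<lambda>t. of_real ((1 - t) powr (\<gamma> - 1)) * of_real t powr (\<beta> - 1)) L 1"
    using fp_integral_Beta_exists[OF \<open>\<gamma> > 0\<close> assms] by blast
  then have "has_fp_integral (\<lambda>t. of_real ((1 - t) powr (\<gamma> - 1)) * of_real t powr (\<beta> - 1))
      (of_real (Gamma \<gamma>) * (L / of_real (Gamma \<gamma>))) 1"
    using \<open>Gamma \<gamma> \<noteq> 0\<close> by simp
  from has_frac_int_pow_fun_aux[OF False refl this[unfolded \<gamma>_def]] show ?thesis by blast
qed

text \<open>Telescoping of z * rGamma (z + 1) = rGamma z. The reciprocal Gamma function is entire,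
  so the identity holds at the poles of Gamma too. It evaluates the falling factorials from
  differentiation and, later, generalized binomial coefficients.\<close>

lemma rGamma_prod:
  "(\<Prod>j<m. z - of_nat j) * rGamma (z + 1) = rGamma (z + 1 - of_nat m :: real)"
proof (induction m)
  case (Suc m)
  have "(\<Prod>j<Suc m. z - of_nat j) * rGamma (z + 1) = (z - of_nat m) * rGamma (z - of_nat m + 1)"
    using Suc by (simp add: mult_ac) (simp add: algebra_simps)
  then show ?case by (simp add: rGamma_plus1)
qed simp

text \<open>Here the coefficient must be explicit, because the off-grid expansion compares
  coefficients of different monomials. With \<open>rGamma\<close> it is 0 when \<alpha> + i + 1 is a
  nonpositive integer, in accordance with the vanishing of high derivatives of t^i.\<close>

lemma has_frac_int_power:
  "has_frac_int \<alpha> (\<lambda>t. of_real t ^ i)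
    (\<lambda>x. of_real (fact i * rGamma (\<alpha> + real i + 1)) * of_real x powr (of_real \<alpha> + of_nat i))"
proof (cases "\<alpha> = 0")
  case True
  have "rGamma (real i + 1) = 1 / fact i"
    by (simp add: rGamma_inverse_Gamma Gamma_fact[symmetric] add.commute inverse_eq_divide)
  with True show ?thesis by (auto simp: has_frac_int_def powr_nat')
next
  case False
  define m \<gamma> where "m = der_order \<alpha>" and "\<gamma> = \<alpha> + real m"
  have "\<gamma> > 0" using der_order_pos by (simp add: \<gamma>_def m_def)
  define B where "B = fact i * rGamma (\<gamma> + real i + 1)"
  have "Beta (real i + 1) \<gamma> = Gamma \<gamma> * B"
    by (simp add: Beta_def B_def rGamma_inverse_Gamma Gamma_fact[symmetric] divide_simps add_ac)
  with has_integral_Beta_real[of "real i + 1" \<gamma>] \<open>\<gamma> > 0\<close>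
  have "((\<lambda>t. t powr real i * (1 - t) powr (\<gamma> - 1)) has_integral Gamma \<gamma> * B) {0..1}" by simp
  then have "((\<lambda>t. complex_of_real (t powr real i * (1 - t) powr (\<gamma> - 1))) has_integral of_real (Gamma \<gamma> * B)) {0..1}"
    by (rule has_integral_of_real)
  then have "has_fp_integral (\<lambda>t. complex_of_real (t powr real i * (1 - t) powr (\<gamma> - 1))) (of_real (Gamma \<gamma> * B)) 1"
    using has_fp_integral_integral[of "\<lambda>t. complex_of_real (t powr real i * (1 - t) powr (\<gamma> - 1))" 1]
    by (simp add: has_integral_iff)
  then have "has_fp_integral (\<lambda>t. of_real ((1 - t) powr (\<gamma> - 1)) * of_real t powr (of_nat i + 1 - 1))
      (of_real (Gamma \<gamma>) * of_real B) 1"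
    unfolding of_real_mult by (rule has_fp_integral_cong) (simp add: of_real_powr_eq[symmetric])
  from has_frac_int_pow_fun_aux[OF False m_def this[unfolded \<gamma>_def]]
  have 1: "has_frac_int \<alpha> (pow_fun (of_nat i + 1)) (\<lambda>x. of_real B * (\<Prod>j<m. of_real \<gamma> + of_nat i - of_nat j) *
      of_real x powr (of_real \<alpha> + of_nat i))" by (simp add: \<gamma>_def add.assoc)
  have "B * (\<Prod>j<m. \<gamma> + real i - real j) = fact i * rGamma (\<alpha> + real i + 1)"
    using rGamma_prod[of "\<gamma> + real i" m] by (simp add: B_def \<gamma>_def algebra_simps)
  moreover have "of_real B * (\<Prod>j<m. of_real \<gamma> + of_nat i - of_nat j) =
      complex_of_real (B * (\<Prod>j<m. \<gamma> + real i - real j))" by simp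
  ultimately have "of_real B * (\<Prod>j<m. of_real \<gamma> + of_nat i - of_nat j) = complex_of_real (fact i * rGamma (\<alpha> + real i + 1))"
    by (simp only:)
  with 1 show ?thesis by (simp add: pow_fun_of_nat[abs_def])
qed

subsection \<open>Functions vanishing at 0 and Riemann-Liouville integrals\<close>

text \<open>A zero of order l at 0, with an l-th derivative that is continuous up to 0. Derivatives
  are taken for x > 0 only and reach 0 by continuity, since the formulas for differentiating
  x^(\<beta>-1) R(x) make sense only for positive x.\<close>

primrec vanishing :: "nat \<Rightarrow> (real \<Rightarrow> complex) \<Rightarrow> bool"
  where "vanishing 0 F \<longleftrightarrow> continuous_on {0..} F"
  | "vanishing (Suc l) F \<longleftrightarrow> continuous_on {0..} F \<and> F 0 = 0 \<and>
      (\<exists>F'. (\<forall>x>0. (F has_vector_derivative F' x) (at x)) \<and> vanishing l F')"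

lemma vanishing_continuous: "vanishing l F \<Longrightarrow> continuous_on {0..} F"
  by (cases l) auto

lemma vanishing_add: "vanishing l F \<Longrightarrow> vanishing l G \<Longrightarrow> vanishing l (\<lambda>x. F x + G x)"
proof (induction l arbitrary: F G)
  case (Suc l)
  then obtain F' G' where "\<forall>x>0. (F has_vector_derivative F' x) (at x)" "vanishing l F'"
    "\<forall>x>0. (G has_vector_derivative G' x) (at x)" "vanishing l G'" by auto
  then show ?case using Suc
    by (auto intro!: continuous_intros exI[of _ "\<lambda>x. F' x + G' x"] has_vector_derivative_add)
qed (auto intro: continuous_intros)

lemma vanishing_cmult: "vanishing l F \<Longrightarrow> vanishing l (\<lambda>x. k * F x)"
proof (induction l arbitrary: F)
  case (Suc l)
  then obtain F' where "\<forall>x>0. (F has_vector_derivative F' x) (at x)" "vanishing l F'" by auto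
  then show ?case using Suc
    by (auto intro!: continuous_intros exI[of _ "\<lambda>x. k * F' x"] has_vector_derivative_mult_right)
qed (auto intro: continuous_intros)

text \<open>The mean value inequality at each level: a bound C x^M of the derivative and the value 0
  at 0 give C x^(M+1), with the same C.\<close>

lemma vanishing_bound:
  "vanishing M R \<Longrightarrow> \<exists>C\<ge>0. \<forall>x\<in>{0..1}. norm (R x) \<le> C * x ^ M"
proof (induction M arbitrary: R)
  case 0
  then have "continuous_on {0..1} R" by (auto intro: continuous_on_subset)
  then have "bounded (R ` {0..1})" by (intro compact_imp_bounded compact_continuous_image) auto
  then obtain B where "\<forall>y\<in>R ` {0..1}. norm y \<le> B" by (auto simp: bounded_iff)
  then show ?case by (intro exI[of _ "max 0 B"]) auto
next
  case (Suc M)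
  then obtain R' where R': "\<forall>x>0. (R has_vector_derivative R' x) (at x)" "vanishing M R'" by auto
  from Suc.IH[OF this(2)] obtain C where C: "C \<ge> 0" "\<forall>x\<in>{0..1}. norm (R' x) \<le> C * x ^ M" by auto
  have "norm (R x) \<le> C * x ^ Suc M" if x: "x \<in> {0..1}" for x
  proof (cases "x = 0")
    case True
    then show ?thesis using Suc.prems by simp
  next
    case False
    have "\<exists>\<xi>\<in>{0<..<x}. norm (R x - R 0) \<le> norm ((x - 0) *\<^sub>R R' \<xi>)"
      using False x R'(1) vanishing_continuous[OF Suc.prems]
      by (intro mvt_general) (auto intro: continuous_on_subset simp: has_vector_derivative_def)
    then obtain \<xi> where \<xi>: "0 < \<xi>" "\<xi> < x" "norm (R x) \<le> x * norm (R' \<xi>)"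
      using Suc.prems x by auto
    have "norm (R' \<xi>) \<le> C * \<xi> ^ M" using C \<xi> x by auto
    also have "\<dots> \<le> C * x ^ M" using C \<xi> by (intro mult_left_mono power_mono) auto
    finally have "x * norm (R' \<xi>) \<le> x * (C * x ^ M)" using x by (intro mult_left_mono) auto
    then show ?thesis using \<xi>(3) by (simp add: mult_ac)
  qed
  then show ?case using C(1) by auto
qed

text \<open>Near 0 the product is O(x^(Re \<beta> - 1 + M)). At 0 itself either M > 0 and R
  vanishes, or M = 0, and then Re \<beta> > 1 and the default value of \<open>pow_fun\<close> is 0;
  so the value agrees with the limit.\<close>

lemma continuous_on_pow_fun_times:
  assumes R: "vanishing M R" and M: "Re \<beta> - 1 + real M > 0"
  shows "continuous_on {0..} (\<lambda>x. pow_fun \<beta> x * R x)" and "pow_fun \<beta> 0 * R 0 = 0"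
proof -
  show 0: "pow_fun \<beta> 0 * R 0 = 0"
    using assms by (cases M) (auto simp: pow_fun_def)
  show "continuous_on {0..} (\<lambda>x. pow_fun \<beta> x * R x)"
    unfolding continuous_on_eq_continuous_within
  proof
    fix x :: real assume "x \<in> {0..}"
    then consider "x = 0" | "x > 0" by fastforce
    then show "continuous (at x within {0..}) (\<lambda>x. pow_fun \<beta> x * R x)"
    proof cases
      case 1
      obtain C where C: "C \<ge> 0" "\<forall>x\<in>{0..1}. norm (R x) \<le> C * x ^ M" using vanishing_bound[OF R] by auto
      have "((\<lambda>x. of_real x powr (\<beta> - 1 + of_nat M)) \<longlongrightarrow> 0) (at_right (0::real))"
        using M by (intro powr_complex_tendsto_0) simp
      then have "((\<lambda>x. C * norm (of_real x powr (\<beta> - 1 + of_nat M))) \<longlongrightarrow> 0) (at_right (0::real))"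
        by (intro tendsto_mult_right_zero tendsto_norm_zero)
      moreover have "\<forall>\<^sub>F x in at_right 0. norm (pow_fun \<beta> x * R x) \<le> C * norm (of_real x powr (\<beta> - 1 + of_nat M))"
        using eventually_at_right_real[of 0 "1::real"]
      proof (rule eventually_mono)
        fix x :: real assume x: "x \<in> {0<..<1}"
        have "norm (pow_fun \<beta> x * R x) \<le> x powr (Re \<beta> - 1) * (C * x ^ M)"
          using x C by (auto simp: norm_mult pow_fun_pos norm_powr_complex intro!: mult_left_mono)
        also have "\<dots> = C * norm (of_real x powr (\<beta> - 1 + of_nat M))"
          using x by (simp add: norm_mult norm_power norm_powr_complex powr_add powr_realpow mult_ac)
        finally show "norm (pow_fun \<beta> x * R x) \<le> C * norm (of_real x powr (\<beta> - 1 + of_nat M))" .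
      qed simp
      ultimately have "((\<lambda>x. pow_fun \<beta> x * R x) \<longlongrightarrow> 0) (at_right 0)"
        by (rule Lim_null_comparison[rotated])
      then show ?thesis using 1 0 by (simp only: continuous_within at_within_Ici_at_right)
    next
      case 2
      have "continuous_on {0<..} (\<lambda>x. of_real x powr (\<beta> - 1) * R x)"
        by (intro continuous_intros continuous_on_powr_complex
            continuous_on_subset[OF vanishing_continuous[OF R]]) auto
      then have "continuous_on {0<..} (\<lambda>x. pow_fun \<beta> x * R x)"
        by (rule continuous_on_cong[THEN iffD1, rotated -1]) (auto simp: pow_fun_pos)
      then have "isCont (\<lambda>x. pow_fun \<beta> x * R x) x"
        using 2 by (simp add: continuous_on_eq_continuous_at)
      then show ?thesis by (rule continuous_at_imp_continuous_at_within)
    qed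
  qed
qed

text \<open>In the product rule one summand lowers \<beta> by 1 and keeps M, the other keeps \<beta>
  and lowers M by 1. In both, Re \<beta> - 1 + M drops by 1 together with l, so the margin is
  preserved; hence the induction runs over all \<beta>, M and R.\<close>

lemma vanishing_pow_fun_times:
  "vanishing M R \<Longrightarrow> l \<le> M \<Longrightarrow> Re \<beta> - 1 + real M > real l \<Longrightarrow> vanishing l (\<lambda>x. pow_fun \<beta> x * R x)"
proof (induction l arbitrary: \<beta> M R)
  case 0
  then show ?case by (auto intro: continuous_on_pow_fun_times)
next
  case (Suc l)
  then obtain M' where M': "M = Suc M'" by (cases M) auto
  with Suc.prems obtain R' where R': "\<forall>x>0. (R has_vector_derivative R' x) (at x)" "vanishing M' R'" by auto
  have "vanishing l (\<lambda>x. (\<beta> - 1) * (pow_fun (\<beta> - 1) x * R x) + pow_fun \<beta> x * R' x)"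
    using Suc.prems M' R' by (intro vanishing_add vanishing_cmult Suc.IH[of M] Suc.IH[of M']) auto
  moreover have "((\<lambda>x. pow_fun \<beta> x * R x) has_vector_derivative
      (\<beta> - 1) * (pow_fun (\<beta> - 1) x * R x) + pow_fun \<beta> x * R' x) (at x)" if "x > 0" for x
  proof -
    have "((\<lambda>x. of_real x powr (\<beta> - 1) * R x) has_vector_derivative
        of_real x powr (\<beta> - 1) * R' x + ((\<beta> - 1) * of_real x powr (\<beta> - 1 - 1)) * R x) (at x)"
      using that R'(1) by (intro has_vector_derivative_mult has_vector_derivative_powr_complex) auto
    then have "((\<lambda>x. pow_fun \<beta> x * R x) has_vector_derivative
        of_real x powr (\<beta> - 1) * R' x + ((\<beta> - 1) * of_real x powr (\<beta> - 1 - 1)) * R x) (at x)"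
      by (rule has_vector_derivative_transform_within_open[of _ _ _ "{0<..}"])
        (use that in \<open>auto simp: pow_fun_pos\<close>)
    then show ?thesis using that by (simp add: pow_fun_pos algebra_simps)
  qed
  ultimately show ?case
    using continuous_on_pow_fun_times[OF Suc.prems(1), of \<beta>] Suc.prems(3)
    by (auto intro!: exI[of _ "\<lambda>x. (\<beta> - 1) * (pow_fun (\<beta> - 1) x * R x) + pow_fun \<beta> x * R' x"])
qed

text \<open>Taylor's formula by repeated integration. The derivative of exp(\<sigma> x) g is
  exp(\<sigma> x) (\<sigma> g + g'), again an exponential times a smooth function with one
  derivative less, so the induction is over all g.\<close>

lemma Ck_on_taylor:
  assumes "Ck_on M g {0..}"
  shows "\<exists>a. vanishing M (\<lambda>x. exp (\<sigma> * of_real x) * g x - (\<Sum>k<M. a k * of_real x ^ k))"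
  using assms
proof (induction M arbitrary: g)
  case 0
  then obtain G where "\<forall>x\<in>{0..}. G 0 x = g x" "continuous_on {0..} (G 0)" unfolding Ck_on_def by auto
  then have "continuous_on {0..} g" by (metis continuous_on_cong)
  then show ?case by (auto intro!: continuous_intros)
next
  case (Suc M)
  then obtain G where G: "\<forall>x\<in>{0..}. G 0 x = g x" "\<forall>i\<le>Suc M. continuous_on {0..} (G i)"
    "\<forall>i<Suc M. \<forall>x\<in>{0..}. (G i has_vector_derivative G (Suc i) x) (at x within {0..})"
    unfolding Ck_on_def by auto
  have "Ck_on M (\<lambda>x. \<sigma> * G 0 x + G 1 x) {0..}"
    unfolding Ck_on_def
    by (intro exI[of _ "\<lambda>i x. \<sigma> * G i x + G (Suc i) x"])
      (use G in \<open>auto intro!: continuous_intros has_vector_derivative_add has_vector_derivative_mult_right\<close>)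
  from Suc.IH[OF this] obtain a where
    a: "vanishing M (\<lambda>x. exp (\<sigma> * of_real x) * (\<sigma> * G 0 x + G 1 x) - (\<Sum>k<M. a k * of_real x ^ k))" by blast
  \<comment> \<open>Term-by-term integration of the Taylor polynomial of the derivative; the
    constant term \<open>g 0\<close> makes \<open>F\<close> vanish at 0.\<close>
  define b where "b = (\<lambda>k. case k of 0 \<Rightarrow> g 0 | Suc k \<Rightarrow> a k / of_nat (Suc k))"
  define F where "F = (\<lambda>x. exp (\<sigma> * of_real x) * g x - (\<Sum>k<Suc M. b k * of_real x ^ k))"
  have "continuous_on {0..} (G 0)" using G(2) by auto
  then have "continuous_on {0..} g" using G(1) by (metis continuous_on_cong)
  then have "continuous_on {0..} F" by (auto simp: F_def intro!: continuous_intros)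
  moreover have "F 0 = 0"
    by (simp add: F_def b_def sum.lessThan_Suc_shift del: sum.lessThan_Suc)
  moreover have "(F has_vector_derivative
      exp (\<sigma> * of_real x) * (\<sigma> * G 0 x + G 1 x) - (\<Sum>k<M. a k * of_real x ^ k)) (at x)" if x: "x > 0" for x
  proof -
    have "(G 0 has_vector_derivative G 1 x) (at x within {0<..})"
      using G(3)[rule_format, of 0 x] x has_vector_derivative_within_subset[of "G 0" "G 1 x" x "{0..}" "{0<..}"]
      by fastforce
    moreover have "at x within {0<..} = at x" using x by (intro at_within_open) auto
    ultimately have "(G 0 has_vector_derivative G 1 x) (at x)" by simp
    then have g: "(g has_vector_derivative G 1 x) (at x)"
      by (rule has_vector_derivative_transform_within_open[of _ _ _ "{0<..}"]) (use x G in auto)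
    have e: "((\<lambda>x. exp (\<sigma> * of_real x)) has_vector_derivative \<sigma> * exp (\<sigma> * of_real x)) (at x)"
      by (rule has_vector_derivative_real_field) (auto intro!: derivative_eq_intros)
    have p: "((\<lambda>x. of_real x ^ k :: complex) has_vector_derivative of_nat k * of_real x ^ (k - 1)) (at x)" for k
      by (rule has_vector_derivative_real_field) (auto intro!: derivative_eq_intros)
    have "(F has_vector_derivative (exp (\<sigma> * of_real x) * G 1 x + (\<sigma> * exp (\<sigma> * of_real x)) * g x) -
        (\<Sum>k<Suc M. b k * (of_nat k * of_real x ^ (k - 1)))) (at x)"
      unfolding F_def
      by (intro has_vector_derivative_diff has_vector_derivative_mult has_vector_derivative_sum
          has_vector_derivative_mult_right e g p)
    moreover have "(\<Sum>k<Suc M. b k * (of_nat k * of_real x ^ (k - 1))) = (\<Sum>k<M. a k * of_real x ^ k)"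
      by (simp add: sum.lessThan_Suc_shift b_def del: sum.lessThan_Suc of_nat_Suc)
    ultimately show ?thesis using G(1) x by (simp add: algebra_simps)
  qed
  ultimately have "vanishing (Suc M) F"
    using a unfolding vanishing.simps
    by (intro conjI exI[of _ "\<lambda>x. exp (\<sigma> * of_real x) * (\<sigma> * G 0 x + G 1 x) - (\<Sum>k<M. a k * of_real x ^ k)"]) auto
  then show ?case unfolding F_def by blast
qed

section \<open>Riemann-Liouville integrals of continuous functions\<close>

definition rl_int :: "real \<Rightarrow> (real \<Rightarrow> complex) \<Rightarrow> real \<Rightarrow> complex"
  where "rl_int \<gamma> F x = integral {0..x} (\<lambda>t. of_real ((x - t) powr (\<gamma> - 1)) * F t) / of_real (Gamma \<gamma>)"

lemma rl_int_by_parts: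
  assumes "\<gamma> > 0" "x \<ge> 0" "continuous_on {0..} F" "F 0 = 0" "continuous_on {0..} F'"
    and "\<forall>x>0. (F has_vector_derivative F' x) (at x)"
  shows "(\<lambda>t. of_real ((x - t) powr (\<gamma> - 1)) * F t) integrable_on {0..x}"
    and "rl_int \<gamma> F x = rl_int (\<gamma> + 1) F' x"
proof -
  have *: "((\<lambda>t. of_real ((x - t) powr (\<gamma> - 1)) * F t) has_integral
    (of_real ((x - 0) powr \<gamma>) * F 0 + integral {0..x} (\<lambda>t. of_real ((x - t) powr \<gamma>) * F' t)) / of_real \<gamma>) {0..x}"
    using assms by (intro kernel_by_parts) (auto intro: continuous_on_subset)
  then show "(\<lambda>t. of_real ((x - t) powr (\<gamma> - 1)) * F t) integrable_on {0..x}" by blast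
  have "\<gamma> \<notin> \<int>\<^sub>\<le>\<^sub>0" using assms(1) by (auto simp: nonpos_Ints_def)
  then have "Gamma (\<gamma> + 1) = \<gamma> * Gamma \<gamma>" by (rule Gamma_plus1)
  with integral_unique[OF *] assms(4) show "rl_int \<gamma> F x = rl_int (\<gamma> + 1) F' x"
    by (simp add: rl_int_def)
qed

text \<open>\<open>u\<close> is the l-th derivative and precedes \<gamma> in the quantifiers: the
  same \<open>u\<close> has to represent the function itself and its fractional integrals.\<close>

lemma vanishing_rl_int:
  "vanishing l F \<Longrightarrow> \<exists>u. continuous_on {0..} u \<and> (\<forall>\<gamma>>0. \<forall>x\<ge>0. rl_int \<gamma> F x = rl_int (\<gamma> + real l) u x)"
proof (induction l arbitrary: F)
  case (Suc l)
  then obtain F' where F': "continuous_on {0..} F" "F 0 = 0" "\<forall>x>0. (F has_vector_derivative F' x) (at x)"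
    "vanishing l F'" by auto
  from Suc.IH[OF F'(4)] obtain u where
    u: "continuous_on {0..} u" "\<forall>\<gamma>>0. \<forall>x\<ge>0. rl_int \<gamma> F' x = rl_int (\<gamma> + real l) u x" by blast
  have "rl_int \<gamma> F x = rl_int (\<gamma> + real (Suc l)) u x" if "\<gamma> > 0" "x \<ge> 0" for \<gamma> x
    using rl_int_by_parts(2)[OF that F'(1,2) vanishing_continuous[OF F'(4)] F'(3)] u(2) that
    by (simp add: add_ac)
  with u(1) show ?case by blast
qed auto

lemma rl_int_1:
  assumes "x \<ge> 0" "continuous_on {0..} F" "F 0 = 0" "\<forall>x>0. (F has_vector_derivative F' x) (at x)"
  shows "rl_int 1 F' x = F x"
proof -
  have "(F' has_integral F x - F 0) {0..x}"
    using assms by (intro fundamental_theorem_of_calculus_interior) (auto intro: continuous_on_subset)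
  \<comment> \<open>\<open>0 powr 0\<close> is 0, so the integrand can differ from \<open>F'\<close>
    at t = x; a single point is negligible.\<close>
  then have "((\<lambda>t. of_real ((x - t) powr (1 - 1)) * F' t) has_integral F x - F 0) {0..x}"
    by (rule has_integral_spike_finite[of "{x}", rotated 2]) auto
  then show ?thesis using assms(3) by (simp add: rl_int_def integral_unique)
qed

text \<open>The truncated kernel is differentiable across its kink as soon as \<gamma> > 1, which
  lets the variable upper limit of a Riemann-Liouville integral be traded for a fixed one.\<close>

lemma has_real_derivative_max_powr:
  assumes "\<gamma> > 1"
  shows "((\<lambda>s. max 0 s powr \<gamma>) has_real_derivative \<gamma> * max 0 s powr (\<gamma> - 1)) (at s)"
proof -
  consider "s < 0" | "s = 0" | "s > 0" by linarith
  then show ?thesis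
  proof cases
    case 1
    have "((\<lambda>s. 0) has_real_derivative \<gamma> * max 0 s powr (\<gamma> - 1)) (at s)"
      using 1 by simp
    then show ?thesis
      by (rule has_field_derivative_transform_within_open[of _ _ _ "{..<0}"]) (use 1 in auto)
  next
    case 3
    have "((\<lambda>s. s powr \<gamma>) has_real_derivative \<gamma> * max 0 s powr (\<gamma> - 1)) (at s)"
      using 3 has_real_derivative_powr[of s \<gamma>] by simp
    then show ?thesis
      by (rule has_field_derivative_transform_within_open[of _ _ _ "{0<..}"]) (use 3 in auto)
  next
    case 2
    have "((\<lambda>h. \<bar>h\<bar> powr (\<gamma> - 1)) \<longlongrightarrow> \<bar>0\<bar> powr (\<gamma> - 1)) (at (0::real))"
      using assms by (intro tendsto_powr2 tendsto_intros) auto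
    then have lim: "((\<lambda>h. \<bar>h\<bar> powr (\<gamma> - 1)) \<longlongrightarrow> 0) (at (0::real))"
      using assms by simp
    have "((\<lambda>h. max 0 h powr \<gamma> / h) \<longlongrightarrow> 0) (at (0::real))"
    proof (rule Lim_null_comparison[OF _ lim])
      show "\<forall>\<^sub>F h in at 0. norm (max 0 h powr \<gamma> / h) \<le> \<bar>h\<bar> powr (\<gamma> - 1)"
      proof (intro always_eventually allI)
        fix h :: real
        show "norm (max 0 h powr \<gamma> / h) \<le> \<bar>h\<bar> powr (\<gamma> - 1)"
        proof (cases "h > 0")
          case True
          then show ?thesis by (simp add: powr_diff)
        qed simp
      qed
    qed
    then show ?thesis using 2 assms by (simp add: DERIV_def)
  qed
qed

text \<open>Truncation replaces the moving interval {0..x} by a fixed {0..b} with b > x, so Leibniz'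
  rule applies without a boundary term; \<Gamma>(\<gamma>+1) = \<gamma> \<Gamma>(\<gamma>) restores
  the normalization.\<close>

lemma rl_int_has_vector_derivative:
  assumes "\<gamma> > 1" "continuous_on {0..} u" "x > 0"
  shows "(rl_int (\<gamma> + 1) u has_vector_derivative rl_int \<gamma> u x) (at x)"
proof -
  define b where "b = x + 1"
  have ext: "integral {0..b} (\<lambda>t. of_real (max 0 (y - t) powr \<nu>) * u t) =
      integral {0..y} (\<lambda>t. of_real ((y - t) powr \<nu>) * u t)" if "0 < y" "y \<le> b" for y \<nu>
  proof -
    have "integral {0..b} (\<lambda>t. of_real (max 0 (y - t) powr \<nu>) * u t) =
        integral {0..y} (\<lambda>t. of_real (max 0 (y - t) powr \<nu>) * u t)"
      by (rule integral_spike_set[symmetric])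
        (auto intro!: negligible_subset[OF negligible_empty] simp: that, use that in auto)
    also have "\<dots> = integral {0..y} (\<lambda>t. of_real ((y - t) powr \<nu>) * u t)"
      by (intro integral_cong) auto
    finally show ?thesis .
  qed
  define fx where "fx = (\<lambda>y t. of_real (\<gamma> * max 0 (y - t) powr (\<gamma> - 1)) * u t)"
  have "((\<lambda>y. integral (cbox 0 b) (\<lambda>t. of_real (max 0 (y - t) powr \<gamma>) * u t)) has_vector_derivative
      integral (cbox 0 b) (fx x)) (at x within {0<..<b})"
  proof (rule leibniz_rule_vector_derivative)
    fix y t assume y: "y \<in> {0<..<b}" and t: "t \<in> cbox 0 b"
    have "((\<lambda>y. max 0 (y - t) powr \<gamma>) has_real_derivative \<gamma> * max 0 (y - t) powr (\<gamma> - 1) * (1 - 0)) (at y)"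
      by (intro DERIV_chain2[OF has_real_derivative_max_powr[OF assms(1)]] derivative_intros)
    then have "((\<lambda>y. of_real (max 0 (y - t) powr \<gamma>)) has_vector_derivative
        complex_of_real (\<gamma> * max 0 (y - t) powr (\<gamma> - 1))) (at y within {0<..<b})"
      by (intro has_vector_derivative_of_real has_vector_derivative_at_within
          has_real_derivative_iff_has_vector_derivative[THEN iffD1]) simp
    then show "((\<lambda>y. of_real (max 0 (y - t) powr \<gamma>) * u t) has_vector_derivative fx y t) (at y within {0<..<b})"
      unfolding fx_def by (rule has_vector_derivative_mult_left)
  next
    fix y assume "y \<in> {0<..<b}"
    show "(\<lambda>t. of_real (max 0 (y - t) powr \<gamma>) * u t) integrable_on cbox 0 b"
      using assms unfolding cbox_interval
      by (intro integrable_continuous_real continuous_intros continuous_on_powr'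
          continuous_on_subset[OF assms(2)]) auto
  next
    have "continuous_on ({0<..<b} \<times> cbox 0 b) (\<lambda>z. u (snd z))"
      by (rule continuous_on_compose2[OF assms(2)]) (auto intro!: continuous_intros)
    then show "continuous_on ({0<..<b} \<times> cbox 0 b) (\<lambda>(y, t). fx y t)"
      unfolding fx_def case_prod_beta using assms
      by (intro continuous_intros continuous_on_powr') auto
  qed (use assms in \<open>auto simp: b_def\<close>)
  moreover have "at x within {0<..<b} = at x" using assms(3) by (intro at_within_open) (auto simp: b_def)
  ultimately have "((\<lambda>y. integral {0..b} (\<lambda>t. of_real (max 0 (y - t) powr \<gamma>) * u t)) has_vector_derivative
      integral {0..b} (fx x)) (at x)"
    by (simp only: cbox_interval)
  then have "((\<lambda>y. integral {0..y} (\<lambda>t. of_real ((y - t) powr \<gamma>) * u t)) has_vector_derivative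
      integral {0..b} (fx x)) (at x)"
    by (rule has_vector_derivative_transform_within_open[of _ _ _ "{0<..<b}"])
      (use assms in \<open>auto simp: ext b_def[symmetric], auto simp: b_def\<close>)
  then have "(rl_int (\<gamma> + 1) u has_vector_derivative integral {0..b} (fx x) / of_real (Gamma (\<gamma> + 1))) (at x)"
    unfolding rl_int_def[abs_def] by (intro has_vector_derivative_divide) simp
  moreover have "integral {0..b} (fx x) = of_real \<gamma> * integral {0..x} (\<lambda>t. of_real ((x - t) powr (\<gamma> - 1)) * u t)"
    using assms by (subst ext[symmetric]) (auto simp: b_def fx_def mult.assoc)
  moreover have "Gamma (\<gamma> + 1) = \<gamma> * Gamma \<gamma>"
    using assms(1) by (intro Gamma_plus1) (auto simp: nonpos_Ints_def)
  ultimately show ?thesis using assms(1) by (simp add: rl_int_def)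
qed

text \<open>Integration by parts raises the order of the integral to \<gamma> + L, with \<gamma> =
  \<alpha> + m, before the m derivatives lower it to \<alpha> + L. The integral of order \<gamma>,
  whose kernel may be singular, is never differentiated in its original form.\<close>

lemma vanishing_has_frac_int:
  assumes "vanishing L F" "L \<ge> 1" "\<alpha> + real L > 1"
  obtains u where "continuous_on {0..} u" "\<And>x. x \<ge> 0 \<Longrightarrow> F x = rl_int (real L) u x"
    "has_frac_int \<alpha> F (rl_int (\<alpha> + real L) u)"
proof -
  obtain l where l: "L = Suc l" using assms(2) by (cases L) auto
  with assms(1) obtain F' where F': "continuous_on {0..} F" "F 0 = 0"
    "\<forall>x>0. (F has_vector_derivative F' x) (at x)" "vanishing l F'" by auto
  obtain u where u: "continuous_on {0..} u" "\<forall>\<gamma>>0. \<forall>x\<ge>0. rl_int \<gamma> F' x = rl_int (\<gamma> + real l) u x"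
    using vanishing_rl_int[OF F'(4)] by blast
  have rep: "F x = rl_int (real L) u x" if "x \<ge> 0" for x
    using rl_int_1[OF that F'(1-3)] u(2) that l by simp
  have "has_frac_int \<alpha> F (rl_int (\<alpha> + real L) u)"
  proof (cases "\<alpha> = 0")
    case True
    then show ?thesis using rep by (simp add: has_frac_int_def)
  next
    case False
    define m \<gamma> where "m = der_order \<alpha>" and "\<gamma> = \<alpha> + real m"
    have "\<gamma> > 0" using der_order_pos by (simp add: \<gamma>_def m_def)
    then have G: "Gamma \<gamma> \<noteq> 0" by (metis Gamma_real_pos less_irrefl)
    define W where "W = (\<lambda>i. rl_int (\<gamma> + real L - real i) u)"
    have "has_fp_integral (subst_kernel 0 \<gamma> F x) (of_real (Gamma \<gamma>) * W 0 x) x" if x: "x > 0" for x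
    proof -
      note parts = rl_int_by_parts[OF \<open>\<gamma> > 0\<close> less_imp_le[OF x] F'(1,2) vanishing_continuous[OF F'(4)] F'(3)]
      have "rl_int \<gamma> F x = W 0 x"
        using parts(2) u(2) \<open>\<gamma> > 0\<close> x l by (simp add: W_def add_ac)
      then have "integral {0..x} (\<lambda>t. of_real ((x - t) powr (\<gamma> - 1)) * F t) = of_real (Gamma \<gamma>) * W 0 x"
        using G by (simp add: rl_int_def field_simps)
      with has_fp_integral_integral[OF parts(1) x] show ?thesis
        by (simp add: subst_kernel_0[abs_def])
    qed
    moreover have "(W i has_vector_derivative W (Suc i) x) (at x)" if "i < m" "x > 0" for i x
    proof -
      have "real m \<ge> real i + 1" using that by linarith
      \<comment> \<open>For i < m the order \<gamma> + L - i - 1 is at least \<alpha> + L > 1, as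
        the differentiation lemma demands.\<close>
      have "(rl_int ((\<gamma> + real L - real i - 1) + 1) u has_vector_derivative
          rl_int (\<gamma> + real L - real i - 1) u x) (at x)"
        using that assms(3) \<open>real m \<ge> real i + 1\<close> u(1)
        by (intro rl_int_has_vector_derivative) (auto simp: \<gamma>_def)
      then show ?thesis by (simp add: W_def algebra_simps)
    qed
    moreover have "rl_int (\<alpha> + real L) u = W m" by (simp add: W_def \<gamma>_def)
    ultimately show ?thesis
      using False unfolding has_frac_int_def Let_def m_def[symmetric] \<gamma>_def[symmetric]
      by (auto intro!: exI[of _ W])
  qed
  with that u(1) rep show ?thesis by blast
qed

subsection \<open>The error on the grid\<close>

text \<open>The exponent may have either sign; adding the values at both ends avoids a case
  distinction at each use.\<close>

lemma powr_le_add_powr: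
  assumes "0 < a" "a \<le> x" "x \<le> (b::real)"
  shows "x powr e \<le> a powr e + b powr e"
proof (cases "e \<ge> 0")
  case True
  then have "x powr e \<le> b powr e" using assms by (intro powr_mono2) auto
  then show ?thesis by (simp add: add_increasing)
next
  case False
  then have "x powr e \<le> a powr e" using assms by (intro powr_mono2') auto
  then show ?thesis by (simp add: add_increasing2)
qed

lemma powr_of_nat_le:
  assumes "1 \<le> q" "real q \<le> y"
  shows "real q powr e \<le> 1 + y powr e"
  using powr_le_add_powr[of 1 "real q" y e] assms by simp

lemma pow_fun_scale:
  "h > 0 \<Longrightarrow> pow_fun \<beta> (real j * h) = of_real h powr (\<beta> - 1) * pow_fun \<beta> (real j)"
  by (cases "j = 0") (auto simp: pow_fun_def powr_times_real)

section \<open>Homogeneity of the error on powers\<close>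

definition cq_sum :: "(nat \<Rightarrow> complex) \<Rightarrow> (real \<Rightarrow> complex) \<Rightarrow> nat \<Rightarrow> complex"
  where "cq_sum \<omega> F n = (\<Sum>j=0..n. \<omega> (n - j) * F (real j))"

lemma conv_quad_exp:
  "conv_quad \<sigma> \<omega> \<alpha> h (\<lambda>t. exp (- \<sigma> * of_real t) * F t) n =
    exp (- \<sigma> * of_real (real n * h)) * (of_real (h powr \<alpha>) * cq_sum \<omega> (\<lambda>t. F (t * h)) n)"
proof -
  have "cq_weight \<sigma> \<omega> h (n - j) * (exp (- \<sigma> * of_real (real j * h)) * F (real j * h)) =
      exp (- \<sigma> * of_real (real n * h)) * (\<omega> (n - j) * F (real j * h))" if "j \<in> {0..n}" for j
  proof -
    have "- of_nat (n - j) * \<sigma> * of_real h + (- \<sigma> * of_real (real j * h)) = - \<sigma> * of_real (real n * h)"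
      using that by (simp add: of_nat_diff algebra_simps)
    then have "exp (- of_nat (n - j) * \<sigma> * of_real h) * exp (- \<sigma> * of_real (real j * h)) =
        exp (- \<sigma> * of_real (real n * h))" by (simp only: exp_add[symmetric])
    then show ?thesis unfolding cq_weight_def by (simp only: mult_ac)
  qed
  then have "(\<Sum>j=0..n. cq_weight \<sigma> \<omega> h (n - j) * (exp (- \<sigma> * of_real (real j * h)) * F (real j * h))) =
      (\<Sum>j=0..n. exp (- \<sigma> * of_real (real n * h)) * (\<omega> (n - j) * F (real j * h)))"
    by (rule sum.cong[OF refl])
  then show ?thesis
    unfolding conv_quad_def cq_sum_def sum_distrib_left[symmetric] by (simp only: mult.left_commute)
qed

text \<open>Apart from the exponential in n h, the dependence on h is a single power in front of a
  bracket that is a function of n alone. So the error at x = 1 with h = 1/n determines the error for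
  every h and n.\<close>

lemma quad_error_exp_pow_fun:
  assumes "has_frac_int \<alpha> (pow_fun \<beta>) (\<lambda>x. B * of_real x powr (of_real \<alpha> + \<beta> - 1))" "h > 0" "n \<ge> 1"
  shows "quad_error \<sigma> \<omega> \<alpha> h (\<lambda>t. exp (- \<sigma> * of_real t) * pow_fun \<beta> t) n =
    exp (- \<sigma> * of_real (real n * h)) * of_real h powr (of_real \<alpha> + \<beta> - 1) *
    (cq_sum \<omega> (pow_fun \<beta>) n - B * of_real (real n) powr (of_real \<alpha> + \<beta> - 1))"
proof -
  have "of_real (h powr \<alpha>) * cq_sum \<omega> (\<lambda>t. pow_fun \<beta> (t * h)) n =
      (of_real h powr of_real \<alpha> * of_real h powr (\<beta> - 1)) * cq_sum \<omega> (pow_fun \<beta>) n"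
    unfolding cq_sum_def pow_fun_scale[OF assms(2)] of_real_powr_eq[OF assms(2)] sum_distrib_left
    by (simp only: mult_ac)
  also have "of_real h powr of_real \<alpha> * of_real h powr (\<beta> - 1) = of_real h powr (of_real \<alpha> + \<beta> - 1)"
    by (simp add: powr_add[symmetric] add_diff_eq)
  finally have 1: "of_real (h powr \<alpha>) * cq_sum \<omega> (\<lambda>t. pow_fun \<beta> (t * h)) n =
      of_real h powr (of_real \<alpha> + \<beta> - 1) * cq_sum \<omega> (pow_fun \<beta>) n" .
  have 2: "of_real (real n * h) powr (of_real \<alpha> + \<beta> - 1) =
      of_real (real n) powr (of_real \<alpha> + \<beta> - 1) * of_real h powr (of_real \<alpha> + \<beta> - 1)"
    using assms by (subst powr_times_real[symmetric]) auto
  have "subst_int \<sigma> \<alpha> (\<lambda>t. exp (- \<sigma> * of_real t) * pow_fun \<beta> t) (real n * h) =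
    exp (- \<sigma> * of_real (real n * h)) * (B * of_real (real n * h) powr (of_real \<alpha> + \<beta> - 1))"
    using assms by (intro subst_int_eq[OF assms(1)]) auto
  then show ?thesis
    unfolding quad_error_def conv_quad_exp 1 2 by (simp only: right_diff_distrib mult_ac)
qed

text \<open>At h = 1/n the factor in front of the bracket has modulus n^(1-\<alpha>-Re \<beta>)
  times a constant; removing it turns the orders n^(-Re \<beta>) and n^(-p) into n^(\<alpha>-1) and
  n^(\<alpha>+Re \<beta>-1-p).\<close>

lemma cq_convergent_grid:
  assumes conv: "cq_convergent \<sigma> \<omega> \<alpha> p" and \<beta>: "\<beta> \<notin> \<int>\<^sub>\<le>\<^sub>0"
    and B: "has_frac_int \<alpha> (pow_fun \<beta>) (\<lambda>x. B * of_real x powr (of_real \<alpha> + \<beta> - 1))"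
  shows "\<exists>C\<ge>0. \<forall>n\<ge>1. norm (cq_sum \<omega> (pow_fun \<beta>) n - B * of_real (real n) powr (of_real \<alpha> + \<beta> - 1))
    \<le> C * (real n powr (\<alpha> - 1) + real n powr (\<alpha> + Re \<beta> - 1 - p))"
proof -
  define E where "E = (\<lambda>n. norm (cq_sum \<omega> (pow_fun \<beta>) n - B * of_real (real n) powr (of_real \<alpha> + \<beta> - 1)))"
  define bd where "bd = (\<lambda>n. real n powr (\<alpha> - 1) + real n powr (\<alpha> + Re \<beta> - 1 - p))"
  have bd: "bd n > 0" if "n \<ge> 1" for n using that by (auto simp: bd_def intro!: add_pos_pos)
  have "(\<lambda>n. norm (quad_error \<sigma> \<omega> \<alpha> (1 / real n) (\<lambda>t. exp (- \<sigma> * of_real t) * pow_fun \<beta> t) n))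
        \<in> O(\<lambda>n. (1 / real n) powr Re \<beta> + (1 / real n) powr p)"
    using conv \<beta> unfolding cq_convergent_def by blast
  then obtain c where c: "c > 0" and ev: "\<forall>\<^sub>F n in sequentially.
      norm (norm (quad_error \<sigma> \<omega> \<alpha> (1 / real n) (\<lambda>t. exp (- \<sigma> * of_real t) * pow_fun \<beta> t) n))
      \<le> c * norm ((1 / real n) powr Re \<beta> + (1 / real n) powr p)"
    by (elim landau_o.bigE)
  from ev obtain N where N: "\<And>n. n \<ge> N \<Longrightarrow>
      norm (norm (quad_error \<sigma> \<omega> \<alpha> (1 / real n) (\<lambda>t. exp (- \<sigma> * of_real t) * pow_fun \<beta> t) n))
      \<le> c * norm ((1 / real n) powr Re \<beta> + (1 / real n) powr p)"
    unfolding eventually_sequentially by blast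
  define c' where "c' = c / norm (exp (- \<sigma>))"
  have large: "E n \<le> c' * bd n" if n: "n \<ge> 1" "n \<ge> N" for n
  proof -
    have "norm (of_real (1 / real n) powr (of_real \<alpha> + \<beta> - 1) :: complex) = (1 / real n) powr (\<alpha> + Re \<beta> - 1)"
      using n by (subst norm_powr_complex) auto
    then have "norm (exp (- \<sigma>)) * (1 / real n) powr (\<alpha> + Re \<beta> - 1) * E n \<le>
        c * ((1 / real n) powr Re \<beta> + (1 / real n) powr p)"
      using N[OF n(2)] n quad_error_exp_pow_fun[OF B, of "1 / real n" n \<sigma> \<omega>]
      by (simp add: norm_mult E_def)
    then have "(norm (exp (- \<sigma>)) * (1 / real n) powr (\<alpha> + Re \<beta> - 1) * E n) * (real n powr (\<alpha> + Re \<beta> - 1) / norm (exp (- \<sigma>))) \<le>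
        (c * ((1 / real n) powr Re \<beta> + (1 / real n) powr p)) * (real n powr (\<alpha> + Re \<beta> - 1) / norm (exp (- \<sigma>)))"
      by (intro mult_right_mono) auto
    moreover have "(1 / real n) powr e = real n powr (- e)" for e
      using n by (simp add: powr_minus_divide powr_divide)
    moreover have "real n powr - (\<alpha> + Re \<beta> - 1) * real n powr (\<alpha> + Re \<beta> - 1) = 1"
      using n by (simp add: powr_add[symmetric])
    moreover have "real n powr - Re \<beta> * real n powr (\<alpha> + Re \<beta> - 1) = real n powr (\<alpha> - 1)"
      "real n powr - p * real n powr (\<alpha> + Re \<beta> - 1) = real n powr (\<alpha> + Re \<beta> - 1 - p)"
      by (simp_all add: powr_add[symmetric] algebra_simps)
    ultimately have "E n \<le> c / norm (exp (- \<sigma>)) * (real n powr - Re \<beta> * real n powr (\<alpha> + Re \<beta> - 1) +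
        real n powr - p * real n powr (\<alpha> + Re \<beta> - 1))"
      by (simp add: field_simps)
    then show ?thesis
      by (simp only: c'_def bd_def \<open>real n powr - Re \<beta> * real n powr (\<alpha> + Re \<beta> - 1) = real n powr (\<alpha> - 1)\<close>
        \<open>real n powr - p * real n powr (\<alpha> + Re \<beta> - 1) = real n powr (\<alpha> + Re \<beta> - 1 - p)\<close>)
  qed
  \<comment> \<open>The O-bound holds from \<open>N\<close> on; the finitely many smaller n are
    absorbed by adding their quotients \<open>E n / bd n\<close>, where \<open>bd n\<close> is
    positive.\<close>
  define C where "C = c' + (\<Sum>n=1..N. E n / bd n)"
  have E0: "E n \<ge> 0" for n by (simp add: E_def)
  have c'0: "c' \<ge> 0" using c by (simp add: c'_def)
  have sum0: "(\<Sum>n=1..N. E n / bd n) \<ge> 0" using bd E0 by (intro sum_nonneg) (auto intro!: divide_nonneg_pos)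
  have "E n \<le> C * bd n" if n: "n \<ge> 1" for n
  proof (cases "n \<ge> N")
    case True
    have "c' * bd n \<le> C * bd n" using sum0 bd[OF n] by (intro mult_right_mono) (auto simp: C_def)
    with large[OF n True] show ?thesis by linarith
  next
    case False
    have "E n / bd n \<le> (\<Sum>n=1..N. E n / bd n)"
      using n False bd E0 by (intro member_le_sum) (auto intro!: divide_nonneg_pos)
    then have "E n / bd n \<le> C" using c'0 by (simp add: C_def)
    then show ?thesis using bd[OF n] by (simp add: field_simps)
  qed
  moreover have "C \<ge> 0" using c'0 sum0 by (simp add: C_def)
  ultimately show ?thesis unfolding E_def bd_def by blast
qed

text \<open>In h^(\<alpha>+Re \<beta>-1) n^(\<alpha>-1) = h^(Re \<beta>) (n h)^(\<alpha>-1), and in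
  the analogous product with h^p, the power of n h is bounded, as n h stays in {a..b} away from
  0.\<close>

lemma quad_error_pow_fun_bound:
  assumes conv: "cq_convergent \<sigma> \<omega> \<alpha> p" and \<beta>: "\<beta> \<notin> \<int>\<^sub>\<le>\<^sub>0" and ab: "0 < a" "a \<le> b"
  shows "\<exists>C\<ge>0. \<forall>h n. 0 < h \<and> a \<le> real n * h \<and> real n * h \<le> b \<longrightarrow>
    norm (quad_error \<sigma> \<omega> \<alpha> h (\<lambda>t. exp (- \<sigma> * of_real t) * pow_fun \<beta> t) n) \<le> C * (h powr Re \<beta> + h powr p)"
proof -
  obtain B where B: "has_frac_int \<alpha> (pow_fun \<beta>) (\<lambda>x. B * of_real x powr (of_real \<alpha> + \<beta> - 1))"
    using has_frac_int_pow_fun[OF \<beta>] by blast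
  obtain C where C: "C \<ge> 0" "\<forall>n\<ge>1. norm (cq_sum \<omega> (pow_fun \<beta>) n - B * of_real (real n) powr (of_real \<alpha> + \<beta> - 1))
    \<le> C * (real n powr (\<alpha> - 1) + real n powr (\<alpha> + Re \<beta> - 1 - p))"
    using cq_convergent_grid[OF conv \<beta> B] by blast
  define e1 where "e1 = a powr (\<alpha> - 1) + b powr (\<alpha> - 1)"
  define e2 where "e2 = a powr (\<alpha> + Re \<beta> - 1 - p) + b powr (\<alpha> + Re \<beta> - 1 - p)"
  define C' where "C' = exp (norm \<sigma> * b) * (C * (e1 + e2))"
  have e: "e1 \<ge> 0" "e2 \<ge> 0" by (auto simp: e1_def e2_def)
  have "norm (quad_error \<sigma> \<omega> \<alpha> h (\<lambda>t. exp (- \<sigma> * of_real t) * pow_fun \<beta> t) n) \<le> C' * (h powr Re \<beta> + h powr p)"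
    if h: "0 < h" "a \<le> real n * h" "real n * h \<le> b" for h n
  proof -
    have n: "n \<ge> 1" using h ab by (cases n) auto
    have ex: "norm (exp (- \<sigma> * of_real (real n * h))) \<le> exp (norm \<sigma> * b)"
    proof -
      have "norm (exp (- \<sigma> * of_real (real n * h))) \<le> exp (norm (- \<sigma> * of_real (real n * h)))"
        by (rule norm_exp)
      also have "\<dots> \<le> exp (norm \<sigma> * b)" using h by (auto simp: norm_mult intro!: mult_left_mono)
      finally show ?thesis .
    qed
    have nh: "(real n * h) powr e = real n powr e * h powr e" for e
      using h n by (simp add: powr_mult)
    have "h powr (\<alpha> + Re \<beta> - 1) * (real n powr (\<alpha> - 1) + real n powr (\<alpha> + Re \<beta> - 1 - p)) =
        h powr Re \<beta> * (real n * h) powr (\<alpha> - 1) + h powr p * (real n * h) powr (\<alpha> + Re \<beta> - 1 - p)"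
    proof -
      have "h powr Re \<beta> * h powr (\<alpha> - 1) = h powr (\<alpha> + Re \<beta> - 1)"
        "h powr p * h powr (\<alpha> + Re \<beta> - 1 - p) = h powr (\<alpha> + Re \<beta> - 1)"
        by (simp_all add: powr_add[symmetric] algebra_simps)
      then have "h powr Re \<beta> * (x * h powr (\<alpha> - 1)) = h powr (\<alpha> + Re \<beta> - 1) * x"
        "h powr p * (x * h powr (\<alpha> + Re \<beta> - 1 - p)) = h powr (\<alpha> + Re \<beta> - 1) * x" for x
        by (simp_all only: mult.left_commute) (simp_all only: mult.commute)
      then show ?thesis unfolding nh distrib_left by (simp only:)
    qed
    also have "\<dots> \<le> h powr Re \<beta> * (e1 + e2) + h powr p * (e1 + e2)"
      using powr_le_add_powr[OF ab(1) h(2,3), of "\<alpha> - 1"] powr_le_add_powr[OF ab(1) h(2,3), of "\<alpha> + Re \<beta> - 1 - p"] e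
      by (intro add_mono mult_left_mono) (auto simp: e1_def[symmetric] e2_def[symmetric])
    finally have 1: "h powr (\<alpha> + Re \<beta> - 1) * (real n powr (\<alpha> - 1) + real n powr (\<alpha> + Re \<beta> - 1 - p))
      \<le> (e1 + e2) * (h powr Re \<beta> + h powr p)" by (simp add: algebra_simps)
    have "norm (quad_error \<sigma> \<omega> \<alpha> h (\<lambda>t. exp (- \<sigma> * of_real t) * pow_fun \<beta> t) n) =
        norm (exp (- \<sigma> * of_real (real n * h))) * (h powr (\<alpha> + Re \<beta> - 1) *
        norm (cq_sum \<omega> (pow_fun \<beta>) n - B * of_real (real n) powr (of_real \<alpha> + \<beta> - 1)))"
      unfolding quad_error_exp_pow_fun[OF B h(1) n] norm_mult
      using norm_powr_complex[OF h(1), of "of_real \<alpha> + \<beta> - 1"] by simp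
    also have "\<dots> \<le> exp (norm \<sigma> * b) * (h powr (\<alpha> + Re \<beta> - 1) *
        (C * (real n powr (\<alpha> - 1) + real n powr (\<alpha> + Re \<beta> - 1 - p))))"
      using C n ex by (intro mult_mono mult_left_mono) auto
    also have "\<dots> = exp (norm \<sigma> * b) * (C * (h powr (\<alpha> + Re \<beta> - 1) *
        (real n powr (\<alpha> - 1) + real n powr (\<alpha> + Re \<beta> - 1 - p))))" by (simp only: mult_ac)
    also have "\<dots> \<le> exp (norm \<sigma> * b) * (C * ((e1 + e2) * (h powr Re \<beta> + h powr p)))"
      using 1 C(1) by (intro mult_left_mono) auto
    finally show ?thesis by (simp add: C'_def mult_ac)
  qed
  moreover have "C' \<ge> 0" using C(1) e by (simp add: C'_def)
  ultimately show ?thesis by blast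
qed

text \<open>Lagrange's form of the remainder is used because the bound must include y = 1, reached
  for q = 1 and \<theta> = 1, where the binomial series can diverge. The power in the m-th
  derivative is bounded by the sum of its values at the ends of {1..2}.\<close>

lemma binomial_powr_remainder:
  fixes a :: real
  shows "\<exists>C\<ge>0. \<forall>y\<in>{0..1}. \<bar>(1 + y) powr a - (\<Sum>k<m. (a gchoose k) * y ^ k)\<bar> \<le> C * y ^ m"
proof -
  define diff where "diff = (\<lambda>k y. (\<Prod>i=0..<k. a - real i) * (1 + y) powr (a - real k))"
  have der: "(diff k has_real_derivative diff (Suc k) t) (at t)" if "t \<ge> 0" for k t
  proof -
    have "((\<lambda>y. (1 + y) powr (a - real k)) has_real_derivative (a - real k) * (1 + t) powr (a - real k - 1) * 1) (at t)"
      using that by (intro DERIV_chain2[OF has_real_derivative_powr]) (auto intro!: derivative_eq_intros)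
    from DERIV_cmult[OF this, of "\<Prod>i=0..<k. a - real i"] show ?thesis
      unfolding diff_def by (simp add: algebra_simps)
  qed
  define C where "C = \<bar>\<Prod>i=0..<m. a - real i\<bar> / fact m * (1 + 2 powr (a - real m))"
  have "\<bar>(1 + y) powr a - (\<Sum>k<m. (a gchoose k) * y ^ k)\<bar> \<le> C * y ^ m" if y: "y \<in> {0..1}" for y
  proof (cases "y = 0")
    case True
    have "(\<Sum>k<m. (a gchoose k) * 0 ^ k) = (if m = 0 then 0 else 1)"
      by (cases m) (auto simp: sum.lessThan_Suc_shift simp del: sum.lessThan_Suc)
    then show ?thesis using True by (auto simp: C_def)
  next
    case False
    have "\<exists>t. 0 < t \<and> t \<le> y \<and> (1 + y) powr a = (\<Sum>k<m. diff k 0 / fact k * y ^ k) + diff m t / fact m * y ^ m"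
      using False y der by (intro Maclaurin2) (auto simp: diff_def)
    then obtain t where t: "0 < t" "t \<le> y"
      "(1 + y) powr a = (\<Sum>k<m. diff k 0 / fact k * y ^ k) + diff m t / fact m * y ^ m" by blast
    have "(1 + t) powr (a - real m) \<le> 1 + 2 powr (a - real m)"
      using powr_le_add_powr[of 1 "1 + t" 2 "a - real m"] t y by simp
    then have "\<bar>diff m t / fact m\<bar> \<le> C"
      unfolding diff_def C_def abs_divide abs_mult
      by (simp add: divide_right_mono mult_left_mono)
    then have "\<bar>diff m t / fact m * y ^ m\<bar> \<le> C * y ^ m"
      using mult_right_mono[of "\<bar>diff m t / fact m\<bar>" C "y ^ m"] y by (simp add: abs_mult)
    then show ?thesis using t(3) by (simp add: diff_def gbinomial_prod_rev)
  qed
  moreover have "C \<ge> 0" by (auto simp: C_def)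
  ultimately show ?thesis by blast
qed

text \<open>The quadrature error of \<open>t^l / l!\<close> at a point \<open>q + \<theta>\<close> of the real line, for \<open>h = 1\<close>.\<close>

definition peano :: "(nat \<Rightarrow> complex) \<Rightarrow> real \<Rightarrow> nat \<Rightarrow> nat \<Rightarrow> real \<Rightarrow> complex"
  where "peano \<omega> \<alpha> l q \<theta> = (\<Sum>i=0..q. \<omega> (q - i) * of_real ((real i + \<theta>) ^ l)) / fact l -
    of_real (rGamma (\<alpha> + real l + 1) * (real q + \<theta>) powr (\<alpha> + real l))"

text \<open>Binomial expansion in \<open>\<theta>\<close> of both terms reduces off-grid points to the grid: the coefficients agree
  because of \<open>(a gchoose (l - k)) / \<Gamma>(a + 1) = 1 / ((l - k)! \<Gamma>(\<alpha> + k + 1))\<close> for \<open>a = \<alpha> + l\<close>.\<close>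

lemma peano_bound:
  assumes conv: "cq_convergent \<sigma> \<omega> \<alpha> p"
  shows "\<exists>C\<ge>0. \<forall>q\<ge>1. \<forall>\<theta>\<in>{0..1}. norm (peano \<omega> \<alpha> l q \<theta>) \<le>
    C * (real q powr (\<alpha> - 1) + (\<Sum>k<Suc l. real q powr (\<alpha> + real k - p)))"
proof -
  define a where "a = \<alpha> + real l"
  define v where "v = (\<lambda>k q. fact k * rGamma (\<alpha> + real k + 1) * real q powr (\<alpha> + real k))"
  define T where "T = (\<lambda>k q. \<Sum>i=0..q. \<omega> (q - i) * of_nat i ^ k)"
  have "\<exists>C\<ge>0. \<forall>q\<ge>1. norm (T k q - of_real (v k q)) \<le> C * (real q powr (\<alpha> - 1) + real q powr (\<alpha> + real k - p))" for k
  proof -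
    have "of_nat k + 1 \<notin> (\<int>\<^sub>\<le>\<^sub>0 :: complex set)"
      by (metis Suc_neq_Zero of_nat_Suc add.commute of_nat_in_nonpos_Ints_iff)
    moreover have "has_frac_int \<alpha> (pow_fun (of_nat k + 1))
      (\<lambda>x. of_real (fact k * rGamma (\<alpha> + real k + 1)) * of_real x powr (of_real \<alpha> + (of_nat k + 1) - 1))"
      using has_frac_int_power[of \<alpha> k] by (simp add: pow_fun_of_nat[abs_def])
    ultimately have "\<exists>C\<ge>0. \<forall>q\<ge>1. norm (cq_sum \<omega> (pow_fun (of_nat k + 1)) q -
        of_real (fact k * rGamma (\<alpha> + real k + 1)) * of_real (real q) powr (of_real \<alpha> + (of_nat k + 1) - 1))
        \<le> C * (real q powr (\<alpha> - 1) + real q powr (\<alpha> + Re (of_nat k + 1) - 1 - p))"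
      by (rule cq_convergent_grid[OF conv])
    moreover have "of_real (real q) powr (of_real \<alpha> + (of_nat k + 1) - 1) = complex_of_real (real q powr (\<alpha> + real k))"
      if "q \<ge> 1" for q
      using that of_real_powr_eq[of "real q" "\<alpha> + real k"] by simp
    ultimately show ?thesis
      by (simp add: T_def v_def cq_sum_def pow_fun_of_nat[abs_def])
  qed
  then obtain C1 where C1: "\<And>k. C1 k \<ge> 0"
    "\<And>k q. q \<ge> 1 \<Longrightarrow> norm (T k q - of_real (v k q)) \<le> C1 k * (real q powr (\<alpha> - 1) + real q powr (\<alpha> + real k - p))"
    by metis
  obtain C2 where C2: "C2 \<ge> 0"
    "\<And>y. y \<in> {0..1} \<Longrightarrow> \<bar>(1 + y) powr a - (\<Sum>k<Suc l. (a gchoose k) * y ^ k)\<bar> \<le> C2 * y ^ Suc l"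
    using binomial_powr_remainder[of a "Suc l"] by blast
  define C where "C = (\<Sum>k<Suc l. real (l choose k) * C1 k) + \<bar>rGamma (a + 1)\<bar> * C2"
  have "norm (peano \<omega> \<alpha> l q \<theta>) \<le> C * (real q powr (\<alpha> - 1) + (\<Sum>k<Suc l. real q powr (\<alpha> + real k - p)))"
    if q: "q \<ge> 1" and \<theta>: "\<theta> \<in> {0..1}" for q \<theta>
  proof -
    define D where "D = real q powr (\<alpha> - 1) + (\<Sum>k<Suc l. real q powr (\<alpha> + real k - p))"
    have Dk: "real q powr (\<alpha> - 1) + real q powr (\<alpha> + real k - p) \<le> D" if "k < Suc l" for k
      unfolding D_def using that
      by (intro add_left_mono member_le_sum) auto
    have D0: "D \<ge> 0" unfolding D_def by (intro add_nonneg_nonneg sum_nonneg) auto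
    have "(\<Sum>i=0..q. \<omega> (q - i) * of_real ((real i + \<theta>) ^ l)) =
        (\<Sum>i=0..q. \<Sum>k<Suc l. of_real (real (l choose k) * \<theta> ^ (l - k)) * (\<omega> (q - i) * of_nat i ^ k))"
      by (simp only: binomial_ring lessThan_Suc_atMost) (simp add: sum_distrib_left mult_ac)
    also have "\<dots> = (\<Sum>k<Suc l. of_real (real (l choose k) * \<theta> ^ (l - k)) * T k q)"
      unfolding T_def sum_distrib_left by (rule sum.swap)
    finally have quad: "(\<Sum>i=0..q. \<omega> (q - i) * of_real ((real i + \<theta>) ^ l)) =
      (\<Sum>k<Suc l. of_real (real (l choose k) * \<theta> ^ (l - k)) * T k q)" .
    have coeff: "real (l choose k) * \<theta> ^ (l - k) * v k q / fact l =
        rGamma (a + 1) * ((a gchoose (l - k)) * (\<theta> / real q) ^ (l - k) * real q powr a)" if "k < Suc l" for k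
    proof -
      have "(a gchoose (l - k)) * rGamma (a + 1) = rGamma (\<alpha> + real k + 1) / fact (l - k)"
        using rGamma_prod[of a "l - k"] that
        by (simp add: gbinomial_prod_rev a_def atLeast0LessThan of_nat_diff algebra_simps)
      moreover have "real q powr (\<alpha> + real k) = real q powr a / real q ^ (l - k)"
        using q that by (simp add: a_def powr_realpow[symmetric] powr_diff[symmetric] of_nat_diff algebra_simps)
      moreover have "real (l choose k) * fact k / fact l = 1 / fact (l - k)"
        using that by (simp add: binomial_fact)
      ultimately have "real (l choose k) * \<theta> ^ (l - k) * v k q / fact l =
          \<theta> ^ (l - k) * (1 / fact (l - k)) * (rGamma (\<alpha> + real k + 1)) * (real q powr a / real q ^ (l - k))"
        using that by (simp add: v_def field_simps)
      also have "\<dots> = ((a gchoose (l - k)) * rGamma (a + 1)) * (\<theta> ^ (l - k) / real q ^ (l - k)) * real q powr a"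
        using \<open>(a gchoose (l - k)) * rGamma (a + 1) = rGamma (\<alpha> + real k + 1) / fact (l - k)\<close> by simp
      finally show ?thesis by (simp add: power_divide mult_ac)
    qed
    have "(\<Sum>k<Suc l. real (l choose k) * \<theta> ^ (l - k) * v k q) / fact l =
        (\<Sum>k<Suc l. rGamma (a + 1) * ((a gchoose (l - k)) * (\<theta> / real q) ^ (l - k) * real q powr a))"
      using coeff unfolding sum_divide_distrib by (intro sum.cong) auto
    also have "\<dots> = (\<Sum>k<Suc l. rGamma (a + 1) * ((a gchoose k) * (\<theta> / real q) ^ k * real q powr a))"
      using sum.nat_diff_reindex[of "\<lambda>k. rGamma (a + 1) * ((a gchoose k) * (\<theta> / real q) ^ k * real q powr a)" "Suc l"]
      by simp
    also have "\<dots> = rGamma (a + 1) * (real q powr a * (\<Sum>k<Suc l. (a gchoose k) * (\<theta> / real q) ^ k))"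
      unfolding sum_distrib_left by (simp only: mult_ac)
    finally have main: "(\<Sum>k<Suc l. real (l choose k) * \<theta> ^ (l - k) * v k q) / fact l =
      rGamma (a + 1) * (real q powr a * (\<Sum>k<Suc l. (a gchoose k) * (\<theta> / real q) ^ k))" .
    have y: "\<theta> / real q \<in> {0..1}" using q \<theta> by (auto simp: field_simps)
    have pw: "(real q + \<theta>) powr a = real q powr a * (1 + \<theta> / real q) powr a"
      using q \<theta> by (subst powr_mult[symmetric]) (auto simp: distrib_left)
    \<comment> \<open>Each moment is its exact value \<open>v k q\<close> plus a grid error. The
      exact values sum to the binomial polynomial of (q + \<theta>)^a, so only the remainder of that
      expansion is left.\<close>
    have "peano \<omega> \<alpha> l q \<theta> = (\<Sum>k<Suc l. of_real (real (l choose k) * \<theta> ^ (l - k)) * (T k q - of_real (v k q))) / fact l +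
        of_real ((\<Sum>k<Suc l. real (l choose k) * \<theta> ^ (l - k) * v k q) / fact l - rGamma (a + 1) * (real q + \<theta>) powr a)"
      unfolding peano_def quad by (simp add: a_def right_diff_distrib sum_subtractf diff_divide_distrib del: sum.lessThan_Suc)
    also have "(\<Sum>k<Suc l. real (l choose k) * \<theta> ^ (l - k) * v k q) / fact l - rGamma (a + 1) * (real q + \<theta>) powr a =
        - (rGamma (a + 1) * (real q powr a * ((1 + \<theta> / real q) powr a - (\<Sum>k<Suc l. (a gchoose k) * (\<theta> / real q) ^ k))))"
      unfolding main pw by (simp add: right_diff_distrib del: sum.lessThan_Suc)
    finally have "norm (peano \<omega> \<alpha> l q \<theta>) \<le>
        norm ((\<Sum>k<Suc l. of_real (real (l choose k) * \<theta> ^ (l - k)) * (T k q - of_real (v k q))) / fact l) +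
        \<bar>rGamma (a + 1) * (real q powr a * ((1 + \<theta> / real q) powr a - (\<Sum>k<Suc l. (a gchoose k) * (\<theta> / real q) ^ k)))\<bar>"
      by (simp only: order_trans[OF norm_triangle_ineq] norm_of_real abs_minus_cancel order_refl)
    moreover have "norm ((\<Sum>k<Suc l. of_real (real (l choose k) * \<theta> ^ (l - k)) * (T k q - of_real (v k q))) / fact l)
        \<le> (\<Sum>k<Suc l. real (l choose k) * C1 k) * D"
    proof -
      have "norm ((\<Sum>k<Suc l. of_real (real (l choose k) * \<theta> ^ (l - k)) * (T k q - of_real (v k q))) / fact l)
          \<le> norm (\<Sum>k<Suc l. of_real (real (l choose k) * \<theta> ^ (l - k)) * (T k q - of_real (v k q))) / 1"
        unfolding norm_divide by (intro divide_left_mono) (auto simp: norm_fact)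
      also have "\<dots> \<le> (\<Sum>k<Suc l. real (l choose k) * C1 k * D)"
        unfolding div_by_1
      proof (rule sum_norm_le)
        fix k assume k: "k \<in> {..<Suc l}"
        have "norm (T k q - of_real (v k q)) \<le> C1 k * D"
          using C1(2)[OF q, of k] mult_left_mono[OF Dk C1(1), of k k] k by auto
        moreover have "\<theta> ^ (l - k) \<le> 1" "\<theta> ^ (l - k) \<ge> 0" using \<theta> by (auto intro: power_le_one)
        ultimately have "\<theta> ^ (l - k) * norm (T k q - of_real (v k q)) \<le> 1 * (C1 k * D)"
          by (intro mult_mono) auto
        then have "real (l choose k) * (\<theta> ^ (l - k) * norm (T k q - of_real (v k q))) \<le> real (l choose k) * (C1 k * D)"
          by (intro mult_left_mono) auto
        then show "norm (of_real (real (l choose k) * \<theta> ^ (l - k)) * (T k q - of_real (v k q)))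
          \<le> real (l choose k) * C1 k * D"
          using \<theta> by (simp add: norm_mult norm_power mult_ac)
      qed
      finally show ?thesis by (simp only: sum_distrib_right)
    qed
    moreover have "\<bar>rGamma (a + 1) * (real q powr a * ((1 + \<theta> / real q) powr a - (\<Sum>k<Suc l. (a gchoose k) * (\<theta> / real q) ^ k)))\<bar>
        \<le> \<bar>rGamma (a + 1)\<bar> * C2 * D"
    proof -
      \<comment> \<open>With \<theta> \<le> 1 and a = \<alpha> + l, the remainder of order l + 1 has
        the size q^(\<alpha>-1), the first term of \<open>D\<close>.\<close>
      have "real q powr a * (\<theta> / real q) ^ Suc l \<le> real q powr a * (1 / real q) ^ Suc l"
        using \<theta> q by (intro mult_left_mono power_mono divide_right_mono) auto
      also have "\<dots> = real q powr (\<alpha> - 1)"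
        using q powr_diff[of "real q" a "real (Suc l)"] powr_realpow[of "real q" "Suc l"]
        by (simp add: a_def power_divide del: power_Suc)
      also have "\<dots> \<le> D" unfolding D_def by (simp add: sum_nonneg del: sum.lessThan_Suc)
      finally have "real q powr a * (\<theta> / real q) ^ Suc l \<le> D" .
      then have "C2 * (real q powr a * (\<theta> / real q) ^ Suc l) \<le> C2 * D" using C2(1) by (intro mult_left_mono)
      moreover have "real q powr a * \<bar>(1 + \<theta> / real q) powr a - (\<Sum>k<Suc l. (a gchoose k) * (\<theta> / real q) ^ k)\<bar>
          \<le> real q powr a * (C2 * (\<theta> / real q) ^ Suc l)"
        using C2(2)[OF y] by (intro mult_left_mono) auto
      ultimately have "real q powr a * \<bar>(1 + \<theta> / real q) powr a - (\<Sum>k<Suc l. (a gchoose k) * (\<theta> / real q) ^ k)\<bar> \<le> C2 * D"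
        by (simp only: mult.left_commute)
      then have "\<bar>rGamma (a + 1)\<bar> * (real q powr a * \<bar>(1 + \<theta> / real q) powr a - (\<Sum>k<Suc l. (a gchoose k) * (\<theta> / real q) ^ k)\<bar>)
          \<le> \<bar>rGamma (a + 1)\<bar> * (C2 * D)" by (intro mult_left_mono) auto
      then show ?thesis by (simp add: abs_mult mult.assoc del: sum.lessThan_Suc)
    qed
    ultimately have "norm (peano \<omega> \<alpha> l q \<theta>) \<le> C * D" unfolding C_def distrib_right by linarith
    then show ?thesis by (simp only: D_def)
  qed
  moreover have "C \<ge> 0" unfolding C_def using C1(1) C2(1) by (intro add_nonneg_nonneg sum_nonneg mult_nonneg_nonneg) auto
  ultimately show ?thesis by blast
qed

subsection \<open>Remainder terms\<close>

text \<open>As q \<le> b/h, the power q^e costs at most a multiple of h^(-e) for e \<ge> 0 and is at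
  most 1 for e < 0; the conditions on A - e and on A cover these two cases.\<close>

lemma powr_scaled_le:
  assumes "0 < h" "h \<le> 1" "1 \<le> q" "real q * h \<le> b" "A \<ge> p" "A - e \<ge> p"
  shows "h powr A * real q powr e \<le> (1 + b powr e) * h powr p"
proof -
  have "b > 0" using assms by (meson less_le_trans mult_pos_pos of_nat_0_less_iff zero_less_one_class.zero_le_one less_one not_le)
  have "real q \<le> b / h" using assms by (simp add: field_simps)
  then have "h powr A * real q powr e \<le> h powr A * (1 + (b / h) powr e)"
    using assms by (intro mult_left_mono powr_of_nat_le) auto
  also have "\<dots> = h powr A + b powr e * h powr (A - e)"
    using assms \<open>b > 0\<close> by (simp add: powr_divide powr_diff field_simps)
  also have "\<dots> \<le> h powr p + b powr e * h powr p"
    using assms by (intro add_mono mult_left_mono powr_mono') auto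
  finally show ?thesis by (simp add: algebra_simps)
qed

text \<open>With A = \<alpha> + l, the exponent e = \<alpha> - 1 gives A - e = l + 1, and e =
  \<alpha> + k - p gives A - e = l - k + p \<ge> p; this is the origin of the lower bounds by p. The
  cell q = 0, outside the reach of \<open>peano_bound\<close>, is treated directly by means of
  \<alpha> + l \<ge> 0.\<close>

lemma peano_scaled_bound:
  assumes conv: "cq_convergent \<sigma> \<omega> \<alpha> p"
    and l: "\<alpha> + real l \<ge> p" "\<alpha> + real l \<ge> 0" "real l + 1 \<ge> p"
  shows "\<exists>C\<ge>0. \<forall>h q. \<forall>\<theta>\<in>{0..1}. 0 < h \<and> h \<le> 1 \<and> real q * h \<le> b \<longrightarrow>
    h powr (\<alpha> + real l) * norm (peano \<omega> \<alpha> l q \<theta>) \<le> C * h powr p"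
proof -
  obtain C0 where C0: "C0 \<ge> 0" "\<And>q \<theta>. q \<ge> 1 \<Longrightarrow> \<theta> \<in> {0..1} \<Longrightarrow> norm (peano \<omega> \<alpha> l q \<theta>) \<le>
    C0 * (real q powr (\<alpha> - 1) + (\<Sum>k<Suc l. real q powr (\<alpha> + real k - p)))"
    using peano_bound[OF conv, of l] by blast
  define C1 where "C1 = C0 * ((1 + b powr (\<alpha> - 1)) + (\<Sum>k<Suc l. 1 + b powr (\<alpha> + real k - p)))"
  define C2 where "C2 = norm (\<omega> 0) + \<bar>rGamma (\<alpha> + real l + 1)\<bar>"
  have C1: "C1 \<ge> 0" using C0(1) unfolding C1_def
    by (intro mult_nonneg_nonneg add_nonneg_nonneg sum_nonneg) auto
  have C2: "C2 \<ge> 0" by (simp add: C2_def)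
  have "h powr (\<alpha> + real l) * norm (peano \<omega> \<alpha> l q \<theta>) \<le> (C1 + C2) * h powr p"
    if \<theta>: "\<theta> \<in> {0..1}" and h: "0 < h" "h \<le> 1" "real q * h \<le> b" for h q \<theta>
  proof (cases "q = 0")
    case True
    have "\<theta> powr (\<alpha> + real l) \<le> 1" using \<theta> l(2) by (auto intro: powr_le1)
    then have "\<bar>rGamma (\<alpha> + real l + 1)\<bar> * \<theta> powr (\<alpha> + real l) \<le> \<bar>rGamma (\<alpha> + real l + 1)\<bar> * 1"
      by (intro mult_left_mono) auto
    then have 2: "norm (complex_of_real (rGamma (\<alpha> + real l + 1) * \<theta> powr (\<alpha> + real l))) \<le> \<bar>rGamma (\<alpha> + real l + 1)\<bar>"
      unfolding norm_of_real abs_mult by simp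
    have "norm (\<omega> 0 * of_real (\<theta> ^ l) / fact l) = norm (\<omega> 0) * (\<theta> ^ l / fact l)"
      using \<theta> by (simp add: norm_mult norm_divide norm_power)
    also have "\<dots> \<le> norm (\<omega> 0) * (1 / 1)"
      using \<theta> by (intro mult_left_mono frac_le power_le_one) auto
    finally have 1: "norm (\<omega> 0 * of_real (\<theta> ^ l) / fact l) \<le> norm (\<omega> 0)" by simp
    have "norm (peano \<omega> \<alpha> l q \<theta>) \<le> C2"
      unfolding C2_def peano_def using True order_trans[OF norm_triangle_ineq4 add_mono[OF 1 2]] by simp
    moreover have "h powr (\<alpha> + real l) \<le> h powr p" using h l by (intro powr_mono') auto
    ultimately have "h powr (\<alpha> + real l) * norm (peano \<omega> \<alpha> l q \<theta>) \<le> h powr p * C2"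
      by (intro mult_mono) auto
    also have "\<dots> \<le> (C1 + C2) * h powr p" using C1 by (simp add: algebra_simps)
    finally show ?thesis .
  next
    case False
    then have q: "1 \<le> q" by simp
    define A where "A = \<alpha> + real l"
    have "h powr A * norm (peano \<omega> \<alpha> l q \<theta>) \<le>
        h powr A * (C0 * (real q powr (\<alpha> - 1) + (\<Sum>k<Suc l. real q powr (\<alpha> + real k - p))))"
      using C0(2)[OF q \<theta>] by (intro mult_left_mono) auto
    also have "\<dots> = C0 * (h powr A * real q powr (\<alpha> - 1) + (\<Sum>k<Suc l. h powr A * real q powr (\<alpha> + real k - p)))"
      by (simp only: distrib_left sum_distrib_left mult.left_commute)
    also have "\<dots> \<le> C0 * ((1 + b powr (\<alpha> - 1)) * h powr p + (\<Sum>k<Suc l. (1 + b powr (\<alpha> + real k - p)) * h powr p))"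
      using C0(1) h q l
      by (intro mult_left_mono add_mono sum_mono powr_scaled_le) (auto simp: A_def)
    also have "\<dots> = C1 * h powr p"
      by (simp only: C1_def distrib_right sum_distrib_right mult.assoc)
    also have "\<dots> \<le> (C1 + C2) * h powr p" using C2 by (simp add: algebra_simps)
    finally show ?thesis by (simp add: A_def)
  qed
  moreover have "C1 + C2 \<ge> 0" using C1 C2 by simp
  ultimately show ?thesis by blast
qed

text \<open>A common domain {0..x} for all grid values lets the quadrature sum be moved under the
  integral. For l = 0 the truncated power would be 1 beyond y, as \<open>0 ^ 0\<close> is 1; hence l
  \<ge> 1.\<close>

lemma rl_int_truncated_power:
  assumes "0 \<le> y" "y \<le> x" "l \<ge> 1"
  shows "rl_int (real l + 1) u y = integral {0..x} (\<lambda>t. of_real (max 0 (y - t) ^ l / fact l) * u t)"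
proof -
  have "integral {0..x} (\<lambda>t. of_real (max 0 (y - t) ^ l / fact l) * u t) =
      integral {0..y} (\<lambda>t. of_real (max 0 (y - t) ^ l / fact l) * u t)"
    by (rule integral_spike_set[symmetric])
      (rule negligible_subset[OF negligible_empty], use assms in \<open>auto simp: max_def split: if_splits\<close>)+
  also have "\<dots> = integral {0..y} (\<lambda>t. (of_real ((y - t) powr (real l + 1 - 1)) * u t) / of_real (fact l))"
  proof (intro integral_cong)
    fix t assume t: "t \<in> {0..y}"
    have "max 0 (y - t) ^ l = (y - t) powr (real l + 1 - 1)"
      using t assms(3) by (cases "t = y") (auto simp: powr_realpow)
    then show "of_real (max 0 (y - t) ^ l / fact l) * u t =
        (of_real ((y - t) powr (real l + 1 - 1)) * u t) / of_real (fact l)" by simp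
  qed
  also have "\<dots> = rl_int (real l + 1) u y"
    using Gamma_fact[of l, where 'a = real] unfolding integral_divide
    by (simp add: rl_int_def add.commute)
  finally show ?thesis ..
qed

text \<open>Here s = n h - t is the distance of the kink t from the right end, and s = (q +
  \<theta>) h. Grid points with j < n - q lie left of t and contribute 0; writing the others as j =
  i + (n - q) gives j h - t = (i + \<theta>) h, the argument in \<open>peano\<close>.\<close>

lemma peano_kernel:
  assumes h: "h > 0" and s: "0 \<le> s" "s \<le> real n * h" and l: "l \<ge> 1"
  obtains q \<theta> where "\<theta> \<in> {0..1}" "q \<le> n"
    "of_real (h powr \<alpha>) * (\<Sum>j=0..n. \<omega> (n - j) * of_real (max 0 (real j * h - (real n * h - s)) ^ l / fact l)) -
       of_real (rGamma (\<alpha> + real l + 1) * s powr (\<alpha> + real l)) =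
     of_real (h powr (\<alpha> + real l)) * peano \<omega> \<alpha> l q \<theta>"
proof -
  define q where "q = nat \<lfloor>s / h\<rfloor>"
  define \<theta> where "\<theta> = s / h - real q"
  have "real q = of_int \<lfloor>s / h\<rfloor>" using h s by (simp add: q_def)
  then have \<theta>: "0 \<le> \<theta>" "\<theta> < 1" by (auto simp: \<theta>_def) linarith
  have sq: "s = (real q + \<theta>) * h" using h by (simp add: \<theta>_def)
  have "real q * h \<le> s" using \<theta> h by (simp add: sq)
  then have "real q * h \<le> real n * h" using s by linarith
  then have qn: "q \<le> n" using h by simp
  define k where "k = n - q"
  have nk: "n = q + k" using qn by (simp add: k_def)
  define f where "f = (\<lambda>j. \<omega> (n - j) * of_real (max 0 (real j * h - (real n * h - s)) ^ l / fact l))"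
  have "(\<Sum>j=0..n. f j) = (\<Sum>j=0+k..q+k. f j)"
  proof (rule sum.mono_neutral_right)
    show "\<forall>j\<in>{0..n} - {0+k..q+k}. f j = 0"
    proof
      fix j assume "j \<in> {0..n} - {0+k..q+k}"
      then have "j + 1 \<le> k" by (auto simp: nk)
      then have "real j + 1 \<le> real k" by linarith
      then have "(real j + \<theta> - real k) * h \<le> 0" using \<theta> h by (intro mult_nonpos_nonneg) auto
      then have "real j * h - (real n * h - s) \<le> 0" by (simp add: sq nk algebra_simps)
      then show "f j = 0" using l by (simp add: f_def)
    qed
  qed (auto simp: nk)
  also have "\<dots> = (\<Sum>i=0..q. f (i + k))" by (rule sum.shift_bounds_cl_nat_ivl)
  also have "\<dots> = (\<Sum>i=0..q. of_real (h ^ l) * (\<omega> (q - i) * of_real ((real i + \<theta>) ^ l)) / fact l)"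
  proof (intro sum.cong refl)
    fix i assume "i \<in> {0..q}"
    have "real (i + k) * h - (real n * h - s) = h * (real i + \<theta>)" by (simp add: sq nk algebra_simps)
    moreover have "h * (real i + \<theta>) \<ge> 0" using h \<theta> by simp
    ultimately have "max 0 (real (i + k) * h - (real n * h - s)) ^ l = h ^ l * (real i + \<theta>) ^ l"
      by (simp add: power_mult_distrib max_def)
    then show "f (i + k) = of_real (h ^ l) * (\<omega> (q - i) * of_real ((real i + \<theta>) ^ l)) / fact l"
      by (simp add: f_def nk del: of_real_add of_real_power)
  qed
  also have "\<dots> = of_real (h ^ l) * ((\<Sum>i=0..q. \<omega> (q - i) * of_real ((real i + \<theta>) ^ l)) / fact l)"
    by (simp only: sum_distrib_left sum_divide_distrib times_divide_eq_right)
  finally have 1: "of_real (h powr \<alpha>) * (\<Sum>j=0..n. f j) =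
      of_real (h powr (\<alpha> + real l)) * ((\<Sum>i=0..q. \<omega> (q - i) * of_real ((real i + \<theta>) ^ l)) / fact l)"
    using h by (simp add: powr_add powr_realpow)
  have 2: "s powr (\<alpha> + real l) = h powr (\<alpha> + real l) * (real q + \<theta>) powr (\<alpha> + real l)"
    using h \<theta> unfolding sq by (subst powr_mult) auto
  have "of_real (h powr \<alpha>) * (\<Sum>j=0..n. f j) - of_real (rGamma (\<alpha> + real l + 1) * s powr (\<alpha> + real l)) =
      of_real (h powr (\<alpha> + real l)) * peano \<omega> \<alpha> l q \<theta>"
    unfolding 1 2 peano_def right_diff_distrib of_real_mult by (simp only: mult.left_commute)
  then show ?thesis using that[of \<theta> q] \<theta> qn by (simp add: f_def)
qed

text \<open>Peano's argument: on the \<open>(l+1)\<close>-fold integral of \<open>u\<close> the error functional is the integral of \<open>u\<close>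
  against the error for truncated powers.\<close>

lemma quad_error_rl_int_bound:
  assumes conv: "cq_convergent \<sigma> \<omega> \<alpha> p" and u: "continuous_on {0..} u"
    and l: "l \<ge> 1" "\<alpha> + real l \<ge> p" "\<alpha> + real l > 0" "real l + 1 \<ge> p"
  shows "\<exists>C\<ge>0. \<forall>h n. 0 < h \<and> h \<le> 1 \<and> real n * h \<le> b \<longrightarrow>
    norm (of_real (h powr \<alpha>) * cq_sum \<omega> (\<lambda>t. rl_int (real l + 1) u (t * h)) n -
      rl_int (\<alpha> + (real l + 1)) u (real n * h)) \<le> C * h powr p"
proof -
  have "continuous_on {0..b} u" using u by (auto intro: continuous_on_subset)
  then have "bounded (u ` {0..b})" by (intro compact_imp_bounded compact_continuous_image) auto
  then obtain U where "\<forall>y\<in>u ` {0..b}. norm y \<le> U" by (auto simp: bounded_iff)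
  then have U: "norm (u t) \<le> max 0 U" if "t \<in> {0..b}" for t using that by (auto simp: le_max_iff_disj)
  obtain C where C: "C \<ge> 0" "\<And>h q \<theta>. \<theta> \<in> {0..1} \<Longrightarrow> 0 < h \<Longrightarrow> h \<le> 1 \<Longrightarrow> real q * h \<le> b \<Longrightarrow>
    h powr (\<alpha> + real l) * norm (peano \<omega> \<alpha> l q \<theta>) \<le> C * h powr p"
    using peano_scaled_bound[OF conv l(2) less_imp_le[OF l(3)] l(4), of b] by blast
  have "norm (of_real (h powr \<alpha>) * cq_sum \<omega> (\<lambda>t. rl_int (real l + 1) u (t * h)) n -
      rl_int (\<alpha> + (real l + 1)) u (real n * h)) \<le> (C * max 0 U * max 0 b) * h powr p"
    if h: "0 < h" "h \<le> 1" "real n * h \<le> b" for h n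
  proof -
    define x where "x = real n * h"
    have x: "0 \<le> x" "x \<le> b" using h by (auto simp: x_def)
    have ux: "continuous_on {0..x} u" using u by (auto intro: continuous_on_subset)
    define k1 where "k1 = (\<lambda>j t. of_real (max 0 (real j * h - t) ^ l / fact l) * u t)"
    have k1: "continuous_on {0..x} (k1 j)" for j
      unfolding k1_def by (intro continuous_intros ux) auto
    define Q where "Q = (\<lambda>t. of_real (h powr \<alpha>) * (\<Sum>j=0..n. \<omega> (n - j) * k1 j t))"
    define R where "R = (\<lambda>t. of_real (rGamma (\<alpha> + real l + 1) * (x - t) powr (\<alpha> + real l)) * u t)"
    have Q: "continuous_on {0..x} Q" unfolding Q_def by (intro continuous_intros k1)
    have R: "continuous_on {0..x} R" unfolding R_def
      using l(3) by (intro continuous_intros continuous_on_powr' ux) auto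
    have "cq_sum \<omega> (\<lambda>t. rl_int (real l + 1) u (t * h)) n = (\<Sum>j=0..n. \<omega> (n - j) * integral {0..x} (k1 j))"
      unfolding cq_sum_def k1_def
      by (intro sum.cong refl arg_cong2[of _ _ _ _ "(*)"] rl_int_truncated_power)
        (use h l in \<open>auto simp: x_def\<close>)
    then have "of_real (h powr \<alpha>) * cq_sum \<omega> (\<lambda>t. rl_int (real l + 1) u (t * h)) n = integral {0..x} Q"
      unfolding Q_def by (simp add: integral_sum integrable_continuous_real k1 continuous_intros)
    moreover have "rl_int (\<alpha> + (real l + 1)) u x = integral {0..x} R"
    proof -
      have "integral {0..x} R = of_real (rGamma (\<alpha> + real l + 1)) *
          integral {0..x} (\<lambda>t. of_real ((x - t) powr (\<alpha> + real l)) * u t)"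
        by (simp add: R_def mult.assoc)
      then show ?thesis
        by (simp add: rl_int_def rGamma_inverse_Gamma divide_inverse add.assoc mult.commute)
    qed
    ultimately have "of_real (h powr \<alpha>) * cq_sum \<omega> (\<lambda>t. rl_int (real l + 1) u (t * h)) n -
      rl_int (\<alpha> + (real l + 1)) u x = integral {0..x} (\<lambda>t. Q t - R t)"
      using Q R by (simp add: integral_diff integrable_continuous_real)
    moreover have "norm (integral {0..x} (\<lambda>t. Q t - R t)) \<le> (C * h powr p * max 0 U) * (x - 0)"
    proof (rule integral_bound)
      fix t assume t: "t \<in> {0..x}"
      then have s: "0 \<le> x - t" "x - t \<le> real n * h" by (auto simp: x_def)
      obtain q \<theta> where q: "\<theta> \<in> {0..1}" "q \<le> n"
        "of_real (h powr \<alpha>) * (\<Sum>j=0..n. \<omega> (n - j) * of_real (max 0 (real j * h - (real n * h - (x - t))) ^ l / fact l)) -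
       of_real (rGamma (\<alpha> + real l + 1) * (x - t) powr (\<alpha> + real l)) =
         of_real (h powr (\<alpha> + real l)) * peano \<omega> \<alpha> l q \<theta>"
        by (rule peano_kernel[OF h(1) s l(1)])
      have "Q t - R t = (of_real (h powr \<alpha>) * (\<Sum>j=0..n. \<omega> (n - j) * of_real (max 0 (real j * h - t) ^ l / fact l)) -
       of_real (rGamma (\<alpha> + real l + 1) * (x - t) powr (\<alpha> + real l))) * u t"
        unfolding Q_def R_def k1_def left_diff_distrib by (simp only: sum_distrib_right mult.assoc)
      also have "\<dots> = of_real (h powr (\<alpha> + real l)) * peano \<omega> \<alpha> l q \<theta> * u t"
        using q(3) by (simp add: x_def)
      finally have "norm (Q t - R t) = (h powr (\<alpha> + real l) * norm (peano \<omega> \<alpha> l q \<theta>)) * norm (u t)"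
        by (simp add: norm_mult)
      also have "\<dots> \<le> (C * h powr p) * max 0 U"
      proof (rule mult_mono)
        have "real q * h \<le> real n * h" using q h by simp
        then have "real q * h \<le> b" using h by linarith
        then show "h powr (\<alpha> + real l) * norm (peano \<omega> \<alpha> l q \<theta>) \<le> C * h powr p"
          using h by (intro C(2) q) auto
        show "norm (u t) \<le> max 0 U" using t x by (intro U) auto
      qed (use C(1) in auto)
      finally show "norm (Q t - R t) \<le> C * h powr p * max 0 U" .
    qed (use x Q R in \<open>auto intro: continuous_intros\<close>)
    moreover have "(C * h powr p * max 0 U) * (x - 0) \<le> (C * h powr p * max 0 U) * max 0 b"
      using x C(1) by (intro mult_left_mono) auto
    ultimately show ?thesis unfolding x_def by (simp only: mult_ac)
  qed
  moreover have "C * max 0 U * max 0 b \<ge> 0" using C(1) by simp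
  ultimately show ?thesis by blast
qed

text \<open>The coefficients of the Lagrange basis polynomials invert the Vandermonde matrix.\<close>

lemma vandermonde_inverse:
  "\<exists>A :: nat \<Rightarrow> nat \<Rightarrow> real. \<forall>i<r. \<forall>k<r. (\<Sum>j=1..r. A j i * real j ^ k) = (if k = i then 1 else 0)"
proof -
  define \<l> where "\<l> = (\<lambda>j. smult (1 / (\<Prod>m\<in>{1..r} - {j}. real j - real m)) (\<Prod>m\<in>{1..r} - {j}. [:- real m, 1:]))"
  have deg: "degree (\<l> j) \<le> r - 1" if "j \<in> {1..r}" for j
  proof -
    have "degree (\<Prod>m\<in>S. [:- real m, 1:]) \<le> card S" if "finite S" for S
      using that
    proof (induction S rule: finite_induct)
      case (insert m S)
      then show ?case
        using degree_mult_le[of "[:- real m, 1:]" "\<Prod>m\<in>S. [:- real m, 1:]"] by simp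
    qed simp
    from this[of "{1..r} - {j}"] that show ?thesis
      unfolding \<l>_def by (intro order_trans[OF degree_smult_le]) simp
  qed
  have val: "poly (\<l> j) (real m) = (if m = j then 1 else 0)" if "j \<in> {1..r}" "m \<in> {1..r}" for j m
  proof (cases "m = j")
    case True
    have "(\<Prod>m\<in>{1..r} - {j}. real j - real m) \<noteq> 0" by auto
    then show ?thesis using True by (simp add: \<l>_def poly_prod)
  next
    case False
    then have "(\<Prod>m'\<in>{1..r} - {j}. poly [:- real m', 1:] (real m)) = 0"
      using that by (intro prod_zero) auto
    then show ?thesis using False by (simp add: \<l>_def poly_prod)
  qed
  \<comment> \<open>The left side interpolates X^k at the r nodes; two polynomials of degree below r
    that agree there are equal.\<close>
  have "(\<Sum>j=1..r. smult (real j ^ k) (\<l> j)) = monom 1 k" if k: "k < r" for k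
  proof (rule poly_eqI_degree[where A = "real ` {1..r}"])
    fix x assume "x \<in> real ` {1..r}"
    then obtain m where m: "m \<in> {1..r}" "x = real m" by auto
    have "poly (\<Sum>j=1..r. smult (real j ^ k) (\<l> j)) x = (\<Sum>j=1..r. if j = m then real j ^ k else 0)"
      unfolding poly_sum poly_smult m(2) by (intro sum.cong) (use m val in auto)
    then show "poly (\<Sum>j=1..r. smult (real j ^ k) (\<l> j)) x = poly (monom 1 k) x"
      using m by (simp add: poly_monom)
  next
    have card: "card (real ` {1..r}) = r" by (subst card_image) (auto simp: inj_on_def)
    have "degree (\<Sum>j=1..r. smult (real j ^ k) (\<l> j)) \<le> r - 1"
      using deg by (intro degree_sum_le) (auto intro: order_trans[OF degree_smult_le])
    then show "degree (\<Sum>j=1..r. smult (real j ^ k) (\<l> j)) < card (real ` {1..r})" using k card by simp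
    show "degree (monom (1::real) k) < card (real ` {1..r})" using k card by (simp add: degree_monom_eq)
  qed
  \<comment> \<open>Comparing coefficients of X^i shows that the i-th coefficient of the j-th basis
    polynomial is an entry of the inverse.\<close>
  moreover have "(\<Sum>j=1..r. coeff (\<l> j) i * real j ^ k) = (if k = i then 1 else 0)"
    if "(\<Sum>j=1..r. smult (real j ^ k) (\<l> j)) = monom 1 k" for i k
    using arg_cong[OF that, of "\<lambda>P. coeff P i"] by (simp add: coeff_sum mult.commute)
  ultimately show ?thesis by (intro exI[of _ "\<lambda>j i. coeff (\<l> j) i"]) simp
qed

subsection \<open>Starting weights\<close>

text \<open>At t = 0 the default values have to match: \<beta> + k = 1 with k > 0, where the right
  side is 1 and the left side 0, would make \<beta> a nonpositive integer. This keeps the term j = 0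
  of the quadrature consistent.\<close>

lemma pow_fun_times_power:
  assumes "\<beta> \<notin> \<int>\<^sub>\<le>\<^sub>0"
  shows "pow_fun \<beta> t * of_real t ^ k = pow_fun (\<beta> + of_nat k) t"
proof (cases "t = 0")
  case True
  have "\<beta> + of_nat k \<noteq> 1" if "k > 0"
  proof
    assume "\<beta> + of_nat k = 1"
    then have "\<beta> = - of_nat (k - 1)" using that by (simp add: of_nat_diff algebra_simps)
    with assms show False by (metis minus_of_nat_in_nonpos_Ints)
  qed
  then show ?thesis using True by (cases k) (auto simp: pow_fun_def)
next
  case False
  then have "of_real t powr (\<beta> - 1) * of_real t ^ k = of_real t powr (\<beta> + of_nat k - 1)"
    using powr_add[of "of_real t" "\<beta> - 1" "of_nat k"] by (simp add: powr_nat' algebra_simps)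
  then show ?thesis using False by (simp add: pow_fun_def)
qed

lemma add_of_nat_notin_nonpos_Ints:
  "\<beta> \<notin> \<int>\<^sub>\<le>\<^sub>0 \<Longrightarrow> \<beta> + of_nat k \<notin> (\<int>\<^sub>\<le>\<^sub>0 :: complex set)"
  by (metis add_diff_cancel_right' diff_conv_add_uminus minus_of_nat_in_nonpos_Ints nonpos_Ints_add)

lemma pow_fun_nonzero: "t > 0 \<Longrightarrow> pow_fun \<beta> t \<noteq> 0"
  by (simp add: pow_fun_def)

text \<open>The solution of the moment equations \<Sum> c_j (j h)^k = - e_k for k < M when
  \<open>A\<close> is the inverse Vandermonde matrix of 1, ..., M; the division by h^i passes to the
  nodes j h. The starting weights arise from it by dividing by h^\<alpha> and by exp(-\<sigma> t)
  t^(\<beta>-1) at t = j h.\<close>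

definition start_coeff :: "(nat \<Rightarrow> nat \<Rightarrow> real) \<Rightarrow> nat \<Rightarrow> real \<Rightarrow> (nat \<Rightarrow> complex) \<Rightarrow> nat \<Rightarrow> complex"
  where "start_coeff A M h e j = - (\<Sum>i<M. of_real (A j i) * (e i / of_real (h ^ i)))"

lemma start_coeff_exact:
  assumes A: "\<And>i k. i < M \<Longrightarrow> k < M \<Longrightarrow> (\<Sum>j=1..M. A j i * real j ^ k) = (if k = i then 1 else 0)"
    and "h > 0" "k < M"
  shows "(\<Sum>j=1..M. start_coeff A M h e j * of_real (real j * h) ^ k) = - e k"
proof -
  have "(\<Sum>j=1..M. start_coeff A M h e j * of_real (real j * h) ^ k) =
      - (\<Sum>j=1..M. \<Sum>i<M. of_real (A j i * real j ^ k) * (e i / of_real (h ^ i) * of_real (h ^ k)))"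
    unfolding start_coeff_def mult_minus_left sum_negf sum_distrib_right
    by (intro arg_cong[of _ _ uminus] sum.cong refl) (simp add: power_mult_distrib)
  also have "(\<Sum>j=1..M. \<Sum>i<M. of_real (A j i * real j ^ k) * (e i / of_real (h ^ i) * of_real (h ^ k))) =
      (\<Sum>i<M. of_real (\<Sum>j=1..M. A j i * real j ^ k) * (e i / of_real (h ^ i) * of_real (h ^ k)))"
    unfolding of_real_sum sum_distrib_right by (rule sum.swap)
  also have "\<dots> = (\<Sum>i<M. if i = k then e i else 0)"
    using assms by (intro sum.cong) auto
  finally show ?thesis using assms(3) by simp
qed

text \<open>To be used with s = Re \<beta>. The term of index i is of size (h^(s+i) + h^p) / h^i;
  after multiplication by h^M the powers h^(s+M) and h^(p+M-i) remain, both at most h^p, whence the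
  factor 2.\<close>

lemma start_coeff_bound:
  assumes "0 < h" "h \<le> 1" and e: "\<And>i. i < M \<Longrightarrow> norm (e i) \<le> C i * (h powr (s + real i) + h powr p)"
    and C: "\<And>i. C i \<ge> 0" and M: "s + real M \<ge> p"
  shows "norm (start_coeff A M h e j) * h ^ M \<le> (\<Sum>i<M. \<bar>A j i\<bar> * (C i * 2)) * h powr p"
proof -
  have "norm (start_coeff A M h e j) \<le> (\<Sum>i<M. norm (of_real (A j i) * (e i / of_real (h ^ i))))"
    unfolding start_coeff_def norm_minus_cancel by (rule norm_sum)
  then have "norm (start_coeff A M h e j) * h ^ M \<le> (\<Sum>i<M. norm (of_real (A j i) * (e i / of_real (h ^ i)))) * h ^ M"
    using assms by (intro mult_right_mono) auto
  also have "\<dots> = (\<Sum>i<M. norm (of_real (A j i) * (e i / of_real (h ^ i))) * h ^ M)"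
    by (rule sum_distrib_right)
  also have "\<dots> \<le> (\<Sum>i<M. \<bar>A j i\<bar> * (C i * 2) * h powr p)"
  proof (rule sum_mono)
    fix i assume "i \<in> {..<M}"
    then have i: "i < M" by simp
    have "norm (e i) * h powr (real M - real i) \<le> (C i * (h powr (s + real i) + h powr p)) * h powr (real M - real i)"
      by (intro mult_right_mono e i) auto
    also have "\<dots> = C i * (h powr (s + real M) + h powr (p + (real M - real i)))"
      by (simp add: distrib_right distrib_left mult.assoc powr_add[symmetric])
    also have "\<dots> \<le> C i * (h powr p + h powr p)"
      using assms C i by (intro mult_left_mono add_mono powr_mono') auto
    finally have "\<bar>A j i\<bar> * (norm (e i) * h powr (real M - real i)) \<le> \<bar>A j i\<bar> * (C i * (h powr p + h powr p))"
      by (rule mult_left_mono) simp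
    moreover have "norm (of_real (A j i) * (e i / of_real (h ^ i))) * h ^ M =
        \<bar>A j i\<bar> * (norm (e i) * h powr (real M - real i))"
      using assms by (simp add: norm_mult norm_divide norm_power powr_diff powr_realpow)
    moreover have "\<bar>A j i\<bar> * (C i * 2) * h powr p = \<bar>A j i\<bar> * (C i * (h powr p + h powr p))"
      by simp
    ultimately show "norm (of_real (A j i) * (e i / of_real (h ^ i))) * h ^ M \<le> \<bar>A j i\<bar> * (C i * 2) * h powr p"
      by linarith
  qed
  finally show ?thesis by (simp add: sum_distrib_right)
qed

text \<open>Exact bookkeeping: exp(\<sigma> x) f splits into the terms a_k x^(\<beta>-1+k), on which
  the starting weights cancel the errors e_k, and x^(\<beta>-1) R. On the latter the convolution
  error and the action of the starting weights survive.\<close>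

lemma corrected_quad_error_eq:
  assumes \<beta>: "\<beta> \<notin> \<int>\<^sub>\<le>\<^sub>0" and h: "h > 0" and n: "n \<ge> 1"
    and A: "\<And>i k. i < M \<Longrightarrow> k < M \<Longrightarrow> (\<Sum>j=1..M. A j i * real j ^ k) = (if k = i then 1 else 0)"
    and e: "\<And>i. e i = quad_error \<sigma> \<omega> \<alpha> h (\<lambda>t. exp (- \<sigma> * of_real t) * pow_fun (\<beta> + of_nat i) t) n"
    and \<kappa>: "\<And>j. \<kappa> n j = start_coeff A M h e j * exp (\<sigma> * of_real (real j * h)) /
      (of_real (h powr \<alpha>) * pow_fun \<beta> (real j * h))"
    and R: "\<And>x. R x = exp (\<sigma> * of_real x) * g x - (\<Sum>k<M. a k * of_real x ^ k)"
    and H: "has_frac_int \<alpha> (\<lambda>x. pow_fun \<beta> x * R x) V"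
  shows "corrected_quad \<sigma> \<omega> \<alpha> M \<kappa> h (\<lambda>x. pow_fun \<beta> x * g x) n -
      subst_int \<sigma> \<alpha> (\<lambda>x. pow_fun \<beta> x * g x) (real n * h) =
    exp (- \<sigma> * of_real (real n * h)) *
      (of_real (h powr \<alpha>) * cq_sum \<omega> (\<lambda>t. pow_fun \<beta> (t * h) * R (t * h)) n - V (real n * h)) +
    (\<Sum>j=1..M. start_coeff A M h e j * R (real j * h))"
proof -
  define f where "f = (\<lambda>x. pow_fun \<beta> x * g x)"
  define F where "F = (\<lambda>x. (\<Sum>k<M. a k * pow_fun (\<beta> + of_nat k) x) + pow_fun \<beta> x * R x)"
  define x where "x = real n * h"
  have x: "x > 0" using h n by (simp add: x_def)
  have FR: "F x = pow_fun \<beta> x * ((\<Sum>k<M. a k * of_real x ^ k) + R x)" for x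
    unfolding F_def by (simp add: pow_fun_times_power[OF \<beta>, symmetric] distrib_left sum_distrib_left mult_ac)
  have f: "f = (\<lambda>x. exp (- \<sigma> * of_real x) * F x)"
    unfolding f_def FR R by (auto simp: fun_eq_iff exp_minus)
  obtain B where B: "\<And>k. has_frac_int \<alpha> (pow_fun (\<beta> + of_nat k))
      (\<lambda>x. B k * of_real x powr (of_real \<alpha> + (\<beta> + of_nat k) - 1))"
    using has_frac_int_pow_fun[OF add_of_nat_notin_nonpos_Ints[OF \<beta>], of \<alpha>] by metis
  define W where "W = (\<lambda>k x. B k * of_real x powr (of_real \<alpha> + (\<beta> + of_nat k) - 1))"
  have W: "has_frac_int \<alpha> (pow_fun (\<beta> + of_nat k)) (W k)" for k using B by (simp add: W_def)
  have "has_frac_int \<alpha> F (\<lambda>x. (\<Sum>k<M. a k * W k x) + V x)"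
    unfolding F_def by (intro has_frac_int_add has_frac_int_sum has_frac_int_cmult W H) auto
  then have 1: "subst_int \<sigma> \<alpha> f x = exp (- \<sigma> * of_real x) * ((\<Sum>k<M. a k * W k x) + V x)"
    unfolding f by (rule subst_int_eq[OF _ x])
  have "cq_sum \<omega> (\<lambda>t. F (t * h)) n = (\<Sum>k<M. a k * cq_sum \<omega> (\<lambda>t. pow_fun (\<beta> + of_nat k) (t * h)) n) +
      cq_sum \<omega> (\<lambda>t. pow_fun \<beta> (t * h) * R (t * h)) n"
  proof -
    have "(\<Sum>j=0..n. \<omega> (n - j) * (\<Sum>k<M. a k * pow_fun (\<beta> + of_nat k) (real j * h))) =
        (\<Sum>k<M. \<Sum>j=0..n. a k * (\<omega> (n - j) * pow_fun (\<beta> + of_nat k) (real j * h)))"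
      unfolding sum_distrib_left by (subst sum.swap) (simp only: mult.left_commute)
    then show ?thesis
      unfolding cq_sum_def F_def distrib_left sum.distrib by (simp only: sum_distrib_left)
  qed
  then have 2: "conv_quad \<sigma> \<omega> \<alpha> h f n = exp (- \<sigma> * of_real x) *
      ((\<Sum>k<M. a k * (of_real (h powr \<alpha>) * cq_sum \<omega> (\<lambda>t. pow_fun (\<beta> + of_nat k) (t * h)) n)) +
       of_real (h powr \<alpha>) * cq_sum \<omega> (\<lambda>t. pow_fun \<beta> (t * h) * R (t * h)) n)"
    unfolding f conv_quad_exp x_def by (simp add: distrib_left sum_distrib_left mult_ac)
  have 3: "e k = exp (- \<sigma> * of_real x) *
      (of_real (h powr \<alpha>) * cq_sum \<omega> (\<lambda>t. pow_fun (\<beta> + of_nat k) (t * h)) n - W k x)" for k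
    unfolding e quad_error_def conv_quad_exp x_def[symmetric] subst_int_eq[OF W x] right_diff_distrib ..
  have "(\<Sum>k<M. a k * e k) = exp (- \<sigma> * of_real x) *
      ((\<Sum>k<M. a k * (of_real (h powr \<alpha>) * cq_sum \<omega> (\<lambda>t. pow_fun (\<beta> + of_nat k) (t * h)) n)) - (\<Sum>k<M. a k * W k x))"
    unfolding 3 by (simp only: sum_subtractf[symmetric] sum_distrib_left right_diff_distrib mult.left_commute)
  then have 4: "conv_quad \<sigma> \<omega> \<alpha> h f n - subst_int \<sigma> \<alpha> f x = (\<Sum>k<M. a k * e k) + exp (- \<sigma> * of_real x) *
      (of_real (h powr \<alpha>) * cq_sum \<omega> (\<lambda>t. pow_fun \<beta> (t * h) * R (t * h)) n - V x)"
    unfolding 1 2 by (simp only: distrib_left right_diff_distrib) (simp only: diff_conv_add_uminus minus_add_distrib add_ac)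
  \<comment> \<open>The normalization of \<open>\<kappa>\<close> removes h^\<alpha> and the factor
    exp(-\<sigma> t) t^(\<beta>-1) of f, so that \<open>start_coeff\<close> acts on a polynomial
    plus \<open>R\<close>.\<close>
  have "of_real (h powr \<alpha>) * (\<kappa> n j * f (real j * h)) =
      start_coeff A M h e j * ((\<Sum>k<M. a k * of_real (real j * h) ^ k) + R (real j * h))" if "j \<in> {1..M}" for j
  proof -
    define y where "y = real j * h"
    have "pow_fun \<beta> y \<noteq> 0" using that h by (intro pow_fun_nonzero) (auto simp: y_def)
    moreover have "complex_of_real (h powr \<alpha>) \<noteq> 0" using h by simp
    ultimately show ?thesis unfolding \<kappa> f FR y_def[symmetric]
      by (simp add: exp_minus)
  qed
  then have "of_real (h powr \<alpha>) * (\<Sum>j=1..M. \<kappa> n j * f (real j * h)) =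
      (\<Sum>j=1..M. start_coeff A M h e j * ((\<Sum>k<M. a k * of_real (real j * h) ^ k) + R (real j * h)))"
    unfolding sum_distrib_left by (rule sum.cong[OF refl])
  also have "\<dots> = (\<Sum>k<M. a k * (\<Sum>j=1..M. start_coeff A M h e j * of_real (real j * h) ^ k)) +
      (\<Sum>j=1..M. start_coeff A M h e j * R (real j * h))"
    unfolding distrib_left sum.distrib sum_distrib_left
    by (subst sum.swap) (simp only: mult.left_commute)
  also have "(\<Sum>k<M. a k * (\<Sum>j=1..M. start_coeff A M h e j * of_real (real j * h) ^ k)) = (\<Sum>k<M. a k * - e k)"
    by (intro sum.cong refl arg_cong2[of _ _ _ _ "(*)"] start_coeff_exact A h) auto
  finally have 5: "of_real (h powr \<alpha>) * (\<Sum>j=1..M. \<kappa> n j * f (real j * h)) =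
      - (\<Sum>k<M. a k * e k) + (\<Sum>j=1..M. start_coeff A M h e j * R (real j * h))"
    by (simp add: sum_negf)
  have "corrected_quad \<sigma> \<omega> \<alpha> M \<kappa> h f n - subst_int \<sigma> \<alpha> f x =
      (conv_quad \<sigma> \<omega> \<alpha> h f n - subst_int \<sigma> \<alpha> f x) + of_real (h powr \<alpha>) * (\<Sum>j=1..M. \<kappa> n j * f (real j * h))"
    by (simp add: corrected_quad_def)
  also have "\<dots> = exp (- \<sigma> * of_real x) *
      (of_real (h powr \<alpha>) * cq_sum \<omega> (\<lambda>t. pow_fun \<beta> (t * h) * R (t * h)) n - V x) +
      (\<Sum>j=1..M. start_coeff A M h e j * R (real j * h))"
    unfolding 4 5 by (simp only: add.assoc[symmetric] add.commute add.right_inverse) simp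
  finally show ?thesis unfolding f_def x_def .
qed

text \<open>The nodes j h with j \<le> M lie in {0..1}, where R(x) = O(x^M) is available; the factor
  M^M in the constant comes from j \<le> M. The constant depends neither on h nor on the errors
  \<open>e\<close>.\<close>

lemma sum_start_coeff_bound:
  assumes "vanishing M R"
  shows "\<exists>K\<ge>0. \<forall>h e. 0 < h \<and> real M * h \<le> 1 \<longrightarrow>
    norm (\<Sum>j=1..M. start_coeff A M h e j * R (real j * h)) \<le> K * (\<Sum>j=1..M. norm (start_coeff A M h e j) * h ^ M)"
proof -
  obtain C where C: "C \<ge> 0" "\<forall>x\<in>{0..1}. norm (R x) \<le> C * x ^ M"
    using vanishing_bound[OF assms] by blast
  define K where "K = C * real M ^ M"
  have "norm (\<Sum>j=1..M. start_coeff A M h e j * R (real j * h)) \<le> K * (\<Sum>j=1..M. norm (start_coeff A M h e j) * h ^ M)"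
    if h: "0 < h" "real M * h \<le> 1" for h e
    unfolding sum_distrib_left
  proof (rule sum_norm_le)
    fix j assume j: "j \<in> {1..M}"
    have "real j * h \<le> real M * h" using j h by (intro mult_right_mono) auto
    moreover from this have "real j * h \<le> 1" using h by linarith
    ultimately have "norm (R (real j * h)) \<le> C * (real j * h) ^ M" using C(2) h by auto
    also have "\<dots> \<le> C * (real M * h) ^ M"
      using \<open>real j * h \<le> real M * h\<close> h C(1) by (intro mult_left_mono power_mono) auto
    finally have "norm (R (real j * h)) \<le> K * h ^ M" by (simp add: K_def power_mult_distrib)
    then have "norm (start_coeff A M h e j) * norm (R (real j * h)) \<le> norm (start_coeff A M h e j) * (K * h ^ M)"
      by (intro mult_left_mono) auto
    then show "norm (start_coeff A M h e j * R (real j * h)) \<le> K * (norm (start_coeff A M h e j) * h ^ M)"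
      by (simp add: norm_mult mult_ac)
  qed
  moreover have "K \<ge> 0" using C(1) by (simp add: K_def)
  ultimately show ?thesis by blast
qed

text \<open>The weights are built from the errors of the model powers and not from the Taylor
  coefficients of g. They can therefore be fixed before g, and one M serves both as the number
  \<open>r\<close> of starting weights and as the smoothness \<open>K\<close>. The constant is
  uniform on each {a..b} with a > 0, because the error on powers involves n h to exponents of either
  sign.\<close>

theorem theorem4p13:
  fixes \<sigma> :: complex and \<alpha> p :: real and \<omega> :: "nat \<Rightarrow> complex"
    and \<omega>t rt :: "complex \<Rightarrow> complex" and c :: "nat \<Rightarrow> complex" and N :: nat and \<beta> :: complex
  assumes generating: "\<And>\<zeta>. norm \<zeta> < 1 \<Longrightarrow>
      (\<lambda>n. \<omega> n * \<zeta> ^ n) sums ((1 - \<zeta>) powr (- of_real \<alpha>) * \<omega>t \<zeta>)"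
    and taylor: "\<And>\<zeta>. norm \<zeta> < 1 \<Longrightarrow>
      \<omega>t \<zeta> = (\<Sum>k<N. c k * (1 - \<zeta>) ^ k) + (1 - \<zeta>) ^ N * rt \<zeta>"
    and remainder: "rt \<in> O[at 1 within ball 0 1](\<lambda>_. 1)"
    and convergent: "cq_convergent \<sigma> \<omega> \<alpha> p"
    and beta_nonneg: "\<alpha> \<ge> 0 \<Longrightarrow> \<beta> \<notin> \<int>\<^sub>\<le>\<^sub>0"
    and beta_neg: "\<alpha> < 0 \<Longrightarrow> Re \<beta> > of_int \<lceil>- \<alpha>\<rceil>"
  shows "\<exists>K r (\<kappa> :: real \<Rightarrow> nat \<Rightarrow> nat \<Rightarrow> complex). \<forall>g. Ck_on K g {0..} \<longrightarrow>
    (let f = (\<lambda>x. pow_fun \<beta> x * g x) in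
      \<forall>a b. 0 < a \<and> a \<le> b \<longrightarrow>
        (\<exists>C h0. h0 > 0 \<and> (\<forall>h n. 0 < h \<and> h < h0 \<and> a \<le> real n * h \<and> real n * h \<le> b \<longrightarrow>
          norm (corrected_quad \<sigma> \<omega> \<alpha> r (\<kappa> h) h f n - subst_int \<sigma> \<alpha> f (real n * h))
            \<le> C * h powr p)))"
proof -
  \<comment> \<open>For \<alpha> < 0 the ceiling is positive, so Re \<beta> > 0 and both cases yield
    the same exclusion.\<close>
  have \<beta>: "\<beta> \<notin> \<int>\<^sub>\<le>\<^sub>0"
  proof (cases "\<alpha> \<ge> 0")
    case False
    then have "\<lceil>- \<alpha>\<rceil> > 0" by simp
    with False beta_neg have "Re \<beta> > 0" by (smt (verit) of_int_0_less_iff)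
    then show ?thesis by (auto simp: nonpos_Ints_def)
  qed (use beta_nonneg in auto)
  \<comment> \<open>The remainder will be integrated l + 1 times: \<alpha> + l \<ge> p and l + 1
    \<ge> p give order p, \<alpha> + l > 0 makes the kernel continuous, and l \<ge> 1 admits
    truncated powers.\<close>
  obtain l :: nat where "real l \<ge> max 1 (max (p - \<alpha>) (max (1 - \<alpha>) p))"
    using real_arch_simple by blast
  then have l: "l \<ge> 1" "\<alpha> + real l \<ge> p" "\<alpha> + real l > 0" "real l + 1 \<ge> p" by auto
  \<comment> \<open>The bound l + 3 - Re \<beta> gives Re \<beta> - 1 + M \<ge> l + 2, so
    x^(\<beta>-1) R has a zero of order l + 1; Re \<beta> + M \<ge> p controls the starting
    weights.\<close>
  obtain M :: nat where "real M \<ge> max (real l + 1) (max (real l + 3 - Re \<beta>) (p - Re \<beta>))"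
    using real_arch_simple by blast
  then have M: "Suc l \<le> M" "Re \<beta> - 1 + real M > real (Suc l)" "Re \<beta> + real M \<ge> p" by auto
  obtain A :: "nat \<Rightarrow> nat \<Rightarrow> real" where
    A: "\<And>i k. i < M \<Longrightarrow> k < M \<Longrightarrow> (\<Sum>j=1..M. A j i * real j ^ k) = (if k = i then 1 else 0)"
    using vandermonde_inverse[of M] by blast
  define e where "e = (\<lambda>h n i. quad_error \<sigma> \<omega> \<alpha> h (\<lambda>t. exp (- \<sigma> * of_real t) * pow_fun (\<beta> + of_nat i) t) n)"
  define \<kappa> where "\<kappa> = (\<lambda>h n j. start_coeff A M h (e h n) j * exp (\<sigma> * of_real (real j * h)) /
      (of_real (h powr \<alpha>) * pow_fun \<beta> (real j * h)))"
  \<comment> \<open>The threshold 1/M keeps the nodes h, ..., M h in {0..1} and makes h \<le>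
    1.\<close>
  have "\<exists>C. \<forall>h n. 0 < h \<and> h < 1 / real M \<and> a \<le> real n * h \<and> real n * h \<le> b \<longrightarrow>
      norm (corrected_quad \<sigma> \<omega> \<alpha> M (\<kappa> h) h (\<lambda>x. pow_fun \<beta> x * g x) n -
        subst_int \<sigma> \<alpha> (\<lambda>x. pow_fun \<beta> x * g x) (real n * h)) \<le> C * h powr p"
    if g: "Ck_on M g {0..}" and ab: "0 < a" "a \<le> b" for g a b
  proof -
    obtain d where d: "vanishing M (\<lambda>x. exp (\<sigma> * of_real x) * g x - (\<Sum>k<M. d k * of_real x ^ k))"
      using Ck_on_taylor[OF g] by blast
    define R where "R = (\<lambda>x. exp (\<sigma> * of_real x) * g x - (\<Sum>k<M. d k * of_real x ^ k))"
    have R: "vanishing M R" using d by (simp add: R_def)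
    have "vanishing (Suc l) (\<lambda>x. pow_fun \<beta> x * R x)"
      by (rule vanishing_pow_fun_times[OF R M(1,2)])
    then obtain u where u: "continuous_on {0..} u"
      "\<And>x. x \<ge> 0 \<Longrightarrow> pow_fun \<beta> x * R x = rl_int (real (Suc l)) u x"
      "has_frac_int \<alpha> (\<lambda>x. pow_fun \<beta> x * R x) (rl_int (\<alpha> + real (Suc l)) u)"
      using l by (elim vanishing_has_frac_int) auto
    obtain C1 where C1: "C1 \<ge> 0" "\<And>h n. 0 < h \<Longrightarrow> h \<le> 1 \<Longrightarrow> real n * h \<le> b \<Longrightarrow>
      norm (of_real (h powr \<alpha>) * cq_sum \<omega> (\<lambda>t. rl_int (real l + 1) u (t * h)) n -
        rl_int (\<alpha> + (real l + 1)) u (real n * h)) \<le> C1 * h powr p"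
      using quad_error_rl_int_bound[OF convergent u(1) l, of b] by blast
    have "\<forall>i. \<exists>C\<ge>0. \<forall>h n. 0 < h \<and> a \<le> real n * h \<and> real n * h \<le> b \<longrightarrow>
        norm (e h n i) \<le> C * (h powr (Re \<beta> + real i) + h powr p)"
      using quad_error_pow_fun_bound[OF convergent add_of_nat_notin_nonpos_Ints[OF \<beta>] ab]
      by (simp add: e_def)
    then obtain C2 where C2: "\<And>i. C2 i \<ge> 0" "\<And>i h n. 0 < h \<Longrightarrow> a \<le> real n * h \<Longrightarrow> real n * h \<le> b \<Longrightarrow>
        norm (e h n i) \<le> C2 i * (h powr (Re \<beta> + real i) + h powr p)" by metis
    obtain K where K: "K \<ge> 0" "\<And>h e. 0 < h \<Longrightarrow> real M * h \<le> 1 \<Longrightarrow>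
      norm (\<Sum>j=1..M. start_coeff A M h e j * R (real j * h)) \<le> K * (\<Sum>j=1..M. norm (start_coeff A M h e j) * h ^ M)"
      using sum_start_coeff_bound[OF R, of A] by blast
    \<comment> \<open>The first part is the convolution error of the remainder, with
      \<open>exp (norm \<sigma> * b)\<close> bounding exp(-\<sigma> x) for 0 \<le> x \<le> b; the
      second is the effect of the starting weights on \<open>R\<close>.\<close>
    define C where "C = exp (norm \<sigma> * b) * C1 + K * (\<Sum>j=1..M. \<Sum>i<M. \<bar>A j i\<bar> * (C2 i * 2))"
    have "norm (corrected_quad \<sigma> \<omega> \<alpha> M (\<kappa> h) h (\<lambda>x. pow_fun \<beta> x * g x) n -
        subst_int \<sigma> \<alpha> (\<lambda>x. pow_fun \<beta> x * g x) (real n * h)) \<le> C * h powr p"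
      if h: "0 < h" "h < 1 / real M" and nh: "a \<le> real n * h" "real n * h \<le> b" for h n
    proof -
      have n: "n \<ge> 1" using nh ab by (cases n) auto
      have Mh: "real M * h \<le> 1" using h M(1) by (simp add: field_simps)
      have "1 * h \<le> real M * h" using M(1) h by (intro mult_right_mono) auto
      then have h1: "h \<le> 1" using Mh by simp
      define T where "T = of_real (h powr \<alpha>) * cq_sum \<omega> (\<lambda>t. pow_fun \<beta> (t * h) * R (t * h)) n -
        rl_int (\<alpha> + real (Suc l)) u (real n * h)"
      define S where "S = (\<Sum>j=1..M. start_coeff A M h (e h n) j * R (real j * h))"
      have eq: "corrected_quad \<sigma> \<omega> \<alpha> M (\<kappa> h) h (\<lambda>x. pow_fun \<beta> x * g x) n -
          subst_int \<sigma> \<alpha> (\<lambda>x. pow_fun \<beta> x * g x) (real n * h) = exp (- \<sigma> * of_real (real n * h)) * T + S"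
        unfolding T_def S_def
        by (rule corrected_quad_error_eq[OF \<beta> h(1) n A _ _ _ u(3)]) (simp_all add: e_def \<kappa>_def R_def)
      have "cq_sum \<omega> (\<lambda>t. pow_fun \<beta> (t * h) * R (t * h)) n = cq_sum \<omega> (\<lambda>t. rl_int (real l + 1) u (t * h)) n"
        unfolding cq_sum_def using u(2) h(1) by (intro sum.cong) (auto simp: add.commute)
      then have T: "norm T \<le> C1 * h powr p"
        using C1(2)[OF h(1) h1 nh(2)] by (simp add: T_def add.commute)
      have "norm (exp (- \<sigma> * of_real (real n * h))) \<le> exp (norm (- \<sigma> * of_real (real n * h)))"
        by (rule norm_exp)
      also have "\<dots> \<le> exp (norm \<sigma> * b)" using h nh by (auto simp: norm_mult intro!: mult_left_mono)
      finally have "norm (exp (- \<sigma> * of_real (real n * h)) * T) \<le> exp (norm \<sigma> * b) * (C1 * h powr p)"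
        unfolding norm_mult using T by (intro mult_mono) auto
      moreover have "norm S \<le> K * (\<Sum>j=1..M. (\<Sum>i<M. \<bar>A j i\<bar> * (C2 i * 2)) * h powr p)"
      proof -
        have "norm S \<le> K * (\<Sum>j=1..M. norm (start_coeff A M h (e h n) j) * h ^ M)"
          unfolding S_def by (rule K(2)[OF h(1) Mh])
        also have "\<dots> \<le> K * (\<Sum>j=1..M. (\<Sum>i<M. \<bar>A j i\<bar> * (C2 i * 2)) * h powr p)"
          using K(1) by (intro mult_left_mono sum_mono start_coeff_bound[OF h(1) h1 _ _ M(3)] C2 h nh)
        finally show ?thesis .
      qed
      ultimately have "norm (exp (- \<sigma> * of_real (real n * h)) * T + S) \<le>
          exp (norm \<sigma> * b) * (C1 * h powr p) + K * (\<Sum>j=1..M. (\<Sum>i<M. \<bar>A j i\<bar> * (C2 i * 2)) * h powr p)"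
        by (rule order_trans[OF norm_triangle_ineq add_mono])
      also have "\<dots> = C * h powr p"
        unfolding C_def sum_distrib_right[symmetric] distrib_right by (simp only: mult.assoc)
      finally show ?thesis unfolding eq .
    qed
    then show ?thesis by blast
  qed
  moreover have "1 / real M > 0" using M(1) by simp
  ultimately show ?thesis unfolding Let_def
    by (intro exI[of _ M] exI[of _ \<kappa>]) blast
qed

end
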